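(* Let $d\ge1$ be an integer, let $\phi,\theta_1,\dots,\theta_d>0$, and let $\tilde X_n\sim N_{n^d}(0,\Sigma_{\phi,\theta_1,\dots,\theta_d;n})$. Then the elements of the Fisher information matrix for the parameters $\phi,\theta_1,\dots,\theta_d$ are given by $$-E\left[\frac{\partial^2}{\partial\phi^2}\log L_n(\phi,\theta_1,\dots,\theta_d)\right]=\frac{d^2n^d}{2\phi^2},$$ $$-E\left[\frac{\partial^2}{\partial\theta_t^2}\log L_n(\phi,\theta_1,\dots,\theta_d)\right]=\frac{n^{d-1}(2\theta_t+5)}{\theta_t^2}+O(n^{d-2}),$$ $$-E\left[\frac{\partial^2}{\partial\phi\,\partial\theta_t}\log L_n(\phi,\theta_1,\dots,\theta_d)\right]=-\frac{dn^{d-1}(\theta_t+2)}{\phi\theta_t}+O(n^{d-2}),$$ $$-E\left[\frac{\partial^2}{\partial\theta_s\,\partial\theta_t}\log L_n(\phi,\theta_1,\dots,\theta_d)\right]=O(n^{d-2}),$$ as $n\to\infty$, whenever $1\le s\ne t\le d$.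
   Context: For $\theta>0$ and a positive integer $n$, $R_{\theta,n}$ is the $n\times n$ matrix with $(i,j)$th element $(1+\theta|i-j|/n)e^{-\theta|i-j|/n}$. The covariance matrix is $$\Sigma_{\phi,\theta_1,\dots,\theta_d;n}=\frac{\pi^d\phi^d}{2^d\theta_1^3\cdots\theta_d^3}\bigotimes_{t=1}^dR_{\theta_t,n}$$ ($\otimes$ = Kronecker product). It is the covariance matrix of the observations $X(i_1/n,\dots,i_d/n)$, $1\le i_t\le n$, ordered lexicographically, of a mean-zero Gaussian random field $X$ on $[0,1]^d$ with $$\mathrm{Cov}(X(x),X(y))=\frac{\pi^d\phi^d}{2^d\theta_1^3\cdots\theta_d^3}\prod_{t=1}^d(1+\theta_t|x_t-y_t|)e^{-\theta_t|x_t-y_t|}.$$ The likelihood function is $$L_n(\phi,\theta_1,\dots,\theta_d)=(2\pi)^{-n^d/2}|\Sigma_{\phi,\theta_1,\dots,\theta_d;n}|^{-1/2}\exp\left(-\tilde X_n'\Sigma_{\phi,\theta_1,\dots,\theta_d;n}^{-1}\tilde X_n/2\right),$$ where $|\cdot|$ is the determinant and $'$ the transpose; expectations are taken under the same parameter $(\phi,\theta_1,\dots,\theta_d)$, which is fixed as $n\to\infty$. *)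

theory Defs
  imports
    "HOL-Probability.Probability"
    "Jordan_Normal_Form.Determinant"
    "Jordan_Normal_Form.Gauss_Jordan_Elimination"
begin

definition kronecker :: "'a::semiring_1 mat \<Rightarrow> 'a mat \<Rightarrow> 'a mat" where
  "kronecker A B = mat (dim_row A * dim_row B) (dim_col A * dim_col B)
     (\<lambda>(i, j). A $$ (i div dim_row B, j div dim_col B) * B $$ (i mod dim_row B, j mod dim_col B))"

definition kronecker_list :: "'a::semiring_1 mat list \<Rightarrow> 'a mat" where
  "kronecker_list As = foldr kronecker As (1\<^sub>m 1)"

definition R_mat :: "real \<Rightarrow> nat \<Rightarrow> real mat" where
  "R_mat \<theta> n = mat n n (\<lambda>(i, j). (1 + \<theta> * \<bar>real i - real j\<bar> / real n) * exp (- \<theta> * \<bar>real i - real j\<bar> / real n))"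

text \<open>The range parameters are \<open>\<theta> 1, \<dots>, \<theta> d\<close>; all other values of \<open>\<theta>\<close> are irrelevant.\<close>

definition Sigma_mat :: "nat \<Rightarrow> nat \<Rightarrow> real \<Rightarrow> (nat \<Rightarrow> real) \<Rightarrow> real mat" where
  "Sigma_mat d n \<phi> \<theta> =
     (pi ^ d * \<phi> ^ d / (2 ^ d * (\<Prod>t=1..d. \<theta> t ^ 3))) \<cdot>\<^sub>m
       kronecker_list (map (\<lambda>t. R_mat (\<theta> t) n) [1..<Suc d])"

text \<open>Only meaningful for an invertible matrix.\<close>

definition inverse_mat :: "'a::field mat \<Rightarrow> 'a mat" where
  "inverse_mat A = the (mat_inverse A)"

definition likelihood :: "nat \<Rightarrow> nat \<Rightarrow> real \<Rightarrow> (nat \<Rightarrow> real) \<Rightarrow> real vec \<Rightarrow> real" where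
  "likelihood d n \<phi> \<theta> x =
     (2 * pi) powr (- real (n ^ d) / 2)
     * Determinant.det (Sigma_mat d n \<phi> \<theta>) powr (- 1 / 2)
     * exp (- scalar_prod x (inverse_mat (Sigma_mat d n \<phi> \<theta>) *\<^sub>v x) / 2)"

text \<open>The univariate normal law with mean \<open>\<mu>\<close> and variance \<open>v\<close>, a point mass if \<open>v = 0\<close>.\<close>

definition normal_law :: "real \<Rightarrow> real \<Rightarrow> real measure" where
  "normal_law \<mu> v = (if v = 0 then return borel \<mu> else density lborel (normal_density \<mu> (sqrt v)))"

text \<open>
  \<open>X\<close> has the multivariate normal law with mean \<open>\<mu>\<close> and covariance matrix \<open>S\<close>: every linear
  combination \<open>a \<bullet> X\<close> is univariate normal with mean \<open>a \<bullet> \<mu>\<close> and variance \<open>a \<bullet> S a\<close>.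
  Measurability of all \<open>a \<bullet> X\<close> includes that of the coordinates of \<open>X\<close>.
\<close>

definition multivariate_normal ::
    "'a measure \<Rightarrow> ('a \<Rightarrow> real vec) \<Rightarrow> real vec \<Rightarrow> real mat \<Rightarrow> bool" where
  "multivariate_normal M X \<mu> S \<longleftrightarrow>
     prob_space M \<and>
     (\<forall>\<omega>\<in>space M. X \<omega> \<in> carrier_vec (dim_vec \<mu>)) \<and>
     (\<forall>a\<in>carrier_vec (dim_vec \<mu>).
        (\<lambda>\<omega>. scalar_prod a (X \<omega>)) \<in> borel_measurable M \<and>
        distr M borel (\<lambda>\<omega>. scalar_prod a (X \<omega>))
          = normal_law (scalar_prod a \<mu>) (scalar_prod a (S *\<^sub>v a)))"

definition partial_deriv :: "nat \<Rightarrow> ((nat \<Rightarrow> real) \<Rightarrow> real) \<Rightarrow> (nat \<Rightarrow> real) \<Rightarrow> real" where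
  "partial_deriv i f p = deriv (\<lambda>u. f (p(i := u))) (p i)"

definition partially_differentiable :: "nat \<Rightarrow> ((nat \<Rightarrow> real) \<Rightarrow> real) \<Rightarrow> (nat \<Rightarrow> real) \<Rightarrow> bool" where
  "partially_differentiable i f p \<longleftrightarrow> (\<lambda>u. f (p(i := u))) differentiable at (p i)"

text \<open>The iterated derivative \<open>partial_deriv i (partial_deriv j f) p\<close> genuinely exists.\<close>

definition second_partial_exists ::
    "nat \<Rightarrow> nat \<Rightarrow> ((nat \<Rightarrow> real) \<Rightarrow> real) \<Rightarrow> (nat \<Rightarrow> real) \<Rightarrow> bool" where
  "second_partial_exists i j f p \<longleftrightarrow>
     (\<forall>\<^sub>F u in nhds (p i). partially_differentiable j f (p(i := u))) \<and>
     partially_differentiable i (partial_deriv j f) p"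

text \<open>
  The full parameter vector is a single function \<open>p\<close> with \<open>\<phi>\<close> in coordinate \<open>0\<close> and \<open>\<theta> t\<close> in
  coordinate \<open>t \<in> {1..d}\<close>, so that row and column \<open>0\<close> of the information matrix belong to \<open>\<phi>\<close>.
\<close>

definition param :: "real \<Rightarrow> (nat \<Rightarrow> real) \<Rightarrow> nat \<Rightarrow> real" where
  "param \<phi> \<theta> = (\<lambda>i. if i = 0 then \<phi> else \<theta> i)"

definition log_likelihood :: "nat \<Rightarrow> nat \<Rightarrow> (nat \<Rightarrow> real) \<Rightarrow> real vec \<Rightarrow> real" where
  "log_likelihood d n p x = ln (likelihood d n (p 0) p x)"

definition fisher_info ::
    "'a measure \<Rightarrow> ('a \<Rightarrow> real vec) \<Rightarrow> ((nat \<Rightarrow> real) \<Rightarrow> real vec \<Rightarrow> real) \<Rightarrow> (nat \<Rightarrow> real) \<Rightarrow> nat \<Rightarrow> nat \<Rightarrow> real" where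
  "fisher_info M X l p i j = - (\<integral>\<omega>. partial_deriv i (partial_deriv j (\<lambda>q. l q (X \<omega>))) p \<partial>M)"

text \<open>
  Since \<^const>\<open>deriv\<close> and the Bochner integral are total, this records that the derivative and the
  expectation in \<^const>\<open>fisher_info\<close> exist.
\<close>

definition fisher_info_exists ::
    "'a measure \<Rightarrow> ('a \<Rightarrow> real vec) \<Rightarrow> ((nat \<Rightarrow> real) \<Rightarrow> real vec \<Rightarrow> real) \<Rightarrow> (nat \<Rightarrow> real) \<Rightarrow> nat \<Rightarrow> nat \<Rightarrow> bool" where
  "fisher_info_exists M X l p i j \<longleftrightarrow>
     (\<forall>\<omega>\<in>space M. second_partial_exists i j (\<lambda>q. l q (X \<omega>)) p) \<and>
     integrable M (\<lambda>\<omega>. partial_deriv i (partial_deriv j (\<lambda>q. l q (X \<omega>))) p)"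

end

theory Submission
  imports Defs "HOL-Real_Asymp.Real_Asymp"
begin

text \<open>
  Write \<open>K\<^sub>t = R\<^bsub>\<theta> t,n\<^esub> / \<theta> t\<^sup>3\<close>, so that the covariance matrix is a multiple of \<open>\<phi>\<^sup>d\<close> times the Kronecker product of the
  \<open>K\<^sub>t\<close>, each of which depends on one parameter. Since \<open>E (x\<^sub>I x\<^sub>J)\<close> is the \<open>(I, J)\<close> entry of the covariance matrix, all
  expectations factor into traces, and with \<open>L\<^sub>t = K\<^sub>t\<^sup>-\<^sup>1 \<partial>K\<^sub>t\<close> the entries of the information matrix are
  \<open>n\<^sup>d\<^sup>-\<^sup>1 tr (L\<^sub>t\<^sup>2) / 2\<close>, \<open>d n\<^sup>d\<^sup>-\<^sup>1 tr L\<^sub>t / (2 \<phi>)\<close> and \<open>n\<^sup>d\<^sup>-\<^sup>2 tr L\<^sub>s tr L\<^sub>t / 2\<close>.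
  It remains to see that \<open>tr L\<^sub>t = - 2 (\<theta> + 2) / \<theta> + O(1 / n)\<close> and \<open>tr (L\<^sub>t\<^sup>2) = 2 (2 \<theta> + 5) / \<theta>\<^sup>2 + O(1 / n)\<close>.
  A banded triangular transformation makes \<open>K\<^sub>t\<close> tridiagonal and strictly diagonally dominant. It carries \<open>\<partial>K\<^sub>t\<close> to a
  matrix for which \<open>L\<^sub>t\<close> can be guessed up to a small residual: it is the discretised kernel \<open>- 2 exp (- \<theta> \<bar>x - y\<bar>)\<close>
  bordered by two rows and columns that account for the behaviour at \<open>0\<close>. Diagonal dominance turns
  the bound on the residual into one on the error of the guess, and the traces of the guess are geometric sums.
\<close>

subsection \<open>Whitening the Matern covariance on a grid\<close>

text \<open>Why \<open>K\<close> carries the factor \<open>1 / \<theta>^3\<close>: on the whole line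
  its spectral density is then a constant times \<open>1 / (\<theta>^2 + w^2)^2\<close>, whose
  high-frequency behaviour is free of \<theta>. The logarithmic derivative
  \<open>- 4 * \<theta> / (\<theta>^2 + w^2)\<close> is the Fourier transform of
  \<open>- 2 * exp (- \<theta> * \<bar>x\<bar>)\<close>, hence the kernel of the guess. Its traces
  stay bounded on an interval, so each \<theta> is informed only at order \<open>n^(d-1)\<close>,
  while \<phi> carries the scale and gets \<open>n^d\<close>. The border comes from the pair value
  and derivative at 0: their variances \<open>\<theta>^-3\<close> and \<open>\<theta>^-1\<close>
  have logarithmic derivatives \<open>- 3 / \<theta>\<close> and \<open>- 1 / \<theta>\<close>. With
  the constant diagonal \<open>- 2\<close> of the kernel they give the trace
  \<open>- 4 / \<theta> - 2\<close>. The obstacle is that the inverse of the tridiagonal matrix is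
  no closed expression in \<open>exp (- h)\<close>: it involves the root of the moving average.
  Hence a guess with a residual instead of a formula. Errors add up over \<open>n\<close> rows, so
  the residual must be of order \<open>h^2\<close> in all but boundedly many rows, where order
  \<open>h\<close> is enough.\<close>

definition ndist :: "nat \<Rightarrow> nat \<Rightarrow> nat" where
  "ndist i j = (i - j) + (j - i)"

lemma ndist_simps [simp]:
  "ndist i i = 0" "ndist i (i + k) = k" "ndist (i + k) i = k" "ndist i (Suc i) = 1" "ndist (Suc i) i = 1"
  "ndist (Suc i) (Suc j) = ndist i j" "ndist 0 i = i" "ndist i 0 = i"
  by (auto simp: ndist_def)

lemma ndist_commute: "ndist i j = ndist j i"
  by (simp add: ndist_def)

lemma real_ndist: "real (ndist i j) = \<bar>real i - real j\<bar>"
  by (simp add: ndist_def)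

text \<open>
  Put \<open>h = \<theta> / n\<close>. The entries of \<open>R\<^bsub>\<theta>,n\<^esub>\<close> are \<open>cov_seq h \<bar>i - j\<bar>\<close>, and
  \<open>dcov_seq h \<bar>i - j\<bar>\<close> are the entries of \<open>\<theta>\<^sup>4\<close> times the \<open>\<theta>\<close>-derivative of \<open>R\<^bsub>\<theta>,n\<^esub> / \<theta>\<^sup>3\<close>.
\<close>

definition cov_seq :: "real \<Rightarrow> nat \<Rightarrow> real" where
  "cov_seq h k = (1 + real k * h) * exp (- h) ^ k"

definition dcov_seq :: "real \<Rightarrow> nat \<Rightarrow> real" where
  "dcov_seq h k = - (3 + 3 * real k * h + (real k * h)\<^sup>2) * exp (- h) ^ k"

text \<open>
  The process sampled on the grid is ARMA(2,1) with a double autoregressive root \<open>exp (- h)\<close>, so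
  \<open>(1 - exp (- h) B)\<^sup>2\<close>, with \<open>B\<close> the backward shift, leaves a moving average of order one: the whitened
  covariance \<open>whiten2 h (cov_seq h)\<close> is tridiagonal. Entry \<open>1\<close> is the residual of regressing on entry \<open>0\<close>.
\<close>

definition whiten :: "real \<Rightarrow> (nat \<Rightarrow> real) \<Rightarrow> nat \<Rightarrow> real" where
  "whiten h f i = (if i = 0 then f 0 else if i = 1 then f 1 - (1 + h) * exp (- h) * f 0
     else f i - 2 * exp (- h) * f (i - 1) + exp (- h) ^ 2 * f (i - 2))"

definition whiten2 :: "real \<Rightarrow> (nat \<Rightarrow> real) \<Rightarrow> nat \<Rightarrow> nat \<Rightarrow> real" where
  "whiten2 h s i j = whiten h (\<lambda>x. whiten h (\<lambda>y. s (ndist x y)) j) i"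

lemma whiten2_commute: "whiten2 h s i j = whiten2 h s j i"
proof -
  have "whiten h (\<lambda>x. whiten h (\<lambda>y. F x y) j) i = whiten h (\<lambda>y. whiten h (\<lambda>x. F x y) i) j" for F
    by (simp add: whiten_def algebra_simps)
  then show ?thesis
    unfolding whiten2_def by (subst ndist_commute) simp
qed

definition innov_var :: "real \<Rightarrow> real" where
  "innov_var h = 1 - exp (- h) ^ 4 - 4 * h * exp (- h) ^ 2"

definition innov_cov :: "real \<Rightarrow> real" where
  "innov_cov h = exp (- h) * (h - 1) + exp (- h) ^ 3 * (1 + h)"

definition start_var :: "real \<Rightarrow> real" where
  "start_var h = 1 - ((1 + h) * exp (- h))\<^sup>2"

text \<open>A linear polynomial in the lag times \<open>exp (- h) ^ k\<close> is annihilated by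
  \<open>(1 - exp (- h) B)^2\<close>: this is what the double root means.\<close>

lemma whiten_cov_seq_far: "whiten h (\<lambda>y. cov_seq h (ndist x y)) (x + m + 2) = 0"
proof -
  have "ndist x (x + m + 2) = m + 2" "ndist x (x + m + 2 - 1) = m + 1" "ndist x (x + m + 2 - 2) = m"
    by (auto simp: ndist_def)
  then show ?thesis
    by (simp add: whiten_def cov_seq_def power_add power2_eq_square algebra_simps)
qed

lemma whiten_cov_seq_adj: "whiten h (\<lambda>y. cov_seq h (ndist (Suc x) y)) (Suc (Suc x)) = innov_cov h"
  by (simp add: whiten_def cov_seq_def innov_cov_def power2_eq_square power3_eq_cube algebra_simps)

text \<open>The outer filter reads only positions up to \<open>i\<close>, and at each of them the
  inner filter, at least two steps further on, already returns 0.\<close>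

lemma whiten2_cov_far: "i + 2 \<le> j \<Longrightarrow> whiten2 h (cov_seq h) i j = 0"
proof -
  assume ij: "i + 2 \<le> j"
  have "whiten h (\<lambda>y. cov_seq h (ndist x y)) j = 0" if "x \<le> i" for x
    using whiten_cov_seq_far[of h x "j - x - 2"] ij that by (simp del: One_nat_def add_2_eq_Suc')
  from this[of i] this[of 0] this[of "i - 1"] this[of "i - 2"] show ?thesis
    by (auto simp: whiten2_def whiten_def[of h _ i] simp del: ndist_simps)
qed

lemma whiten2_cov_adj: "whiten2 h (cov_seq h) (Suc i) (Suc (Suc i)) = innov_cov h"
proof -
  have "whiten h (\<lambda>y. cov_seq h (ndist x y)) (Suc (Suc i)) = 0" if "x \<le> i" for x
    using whiten_cov_seq_far[of h x "i - x"] that by simp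
  from this[of i] this[of 0] this[of "i - 1"] show ?thesis
    by (auto simp: whiten2_def whiten_def[of h _ "Suc i"] whiten_cov_seq_adj simp del: ndist_simps)
qed

lemma whiten2_cov_diag: "whiten2 h (cov_seq h) (Suc (Suc i)) (Suc (Suc i)) = innov_var h"
proof -
  have "ndist (Suc (Suc i)) i = 2" "ndist i (Suc (Suc i)) = 2" by (simp_all add: ndist_def)
  then show ?thesis
    by (simp add: whiten2_def whiten_def cov_seq_def innov_var_def power2_eq_square power4_eq_xxxx algebra_simps)
qed

lemma whiten2_cov_start:
  "whiten2 h (cov_seq h) 0 0 = 1" "whiten2 h (cov_seq h) 0 (Suc 0) = 0"
  "whiten2 h (cov_seq h) (Suc 0) (Suc 0) = start_var h"
  by (auto simp: whiten2_def whiten_def cov_seq_def start_var_def power2_eq_square algebra_simps)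

text \<open>The filter \<open>(1 - exp (- h) B)^2\<close> has autocorrelation
  \<open>1 + 4 * a^2 + a^4\<close>, \<open>- 2 * (a + a^3)\<close>, \<open>a^2\<close> at lags 0, 1,
  2, where \<open>a = exp (- h)\<close>. \<open>dinnov_var\<close> and \<open>dinnov_cov\<close> are
  these weights applied to the values of \<open>dcov_seq\<close> at lags 0 to 3.\<close>

definition dinnov_var :: "real \<Rightarrow> real" where
  "dinnov_var h = - (3 * (1 + 4 * exp (- h) ^ 2 + exp (- h) ^ 4) - 4 * (exp (- h) + exp (- h) ^ 3) * ((3 + 3 * h + h\<^sup>2) * exp (- h))
     + 2 * exp (- h) ^ 2 * ((3 + 6 * h + 4 * h\<^sup>2) * exp (- h) ^ 2))"

definition dinnov_cov :: "real \<Rightarrow> real" where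
  "dinnov_cov h = - ((1 + 4 * exp (- h) ^ 2 + exp (- h) ^ 4) * ((3 + 3 * h + h\<^sup>2) * exp (- h))
     - 2 * (exp (- h) + exp (- h) ^ 3) * (3 + (3 + 6 * h + 4 * h\<^sup>2) * exp (- h) ^ 2)
     + exp (- h) ^ 2 * ((3 + 3 * h + h\<^sup>2) * exp (- h) + (3 + 9 * h + 9 * h\<^sup>2) * exp (- h) ^ 3))"

definition dstart_var :: "real \<Rightarrow> real" where
  "dstart_var h = - 3 + 2 * (1 + h) * exp (- h) * ((3 + 3 * h + h\<^sup>2) * exp (- h)) - 3 * ((1 + h) * exp (- h))\<^sup>2"

definition dstart_cov :: "real \<Rightarrow> real" where
  "dstart_cov h = - ((3 + 3 * h + h\<^sup>2) * exp (- h) * (1 + exp (- h)^2) - 6 * exp (- h)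
     - (1 + h) * exp (- h) * ((3 + 6 * h + 4 * h\<^sup>2) * exp (- h) ^ 2 - 2 * exp (- h) * ((3 + 3 * h + h\<^sup>2) * exp (- h)) + 3 * exp (- h)^2))"

text \<open>The filter takes a second difference of the polynomial factor of
  \<open>dcov_seq\<close>, so only the quadratic term survives, as the constant
  \<open>- 2 * h^2\<close>.\<close>

lemma whiten_dcov_seq_far:
  "whiten h (\<lambda>y. dcov_seq h (ndist x y)) (x + m + 2) = - 2 * h\<^sup>2 * exp (- h) ^ (m + 2)"
proof -
  have "ndist x (x + m + 2) = m + 2" "ndist x (x + m + 2 - 1) = m + 1" "ndist x (x + m + 2 - 2) = m"
    by (auto simp: ndist_def)
  then show ?thesis
    by (simp add: whiten_def dcov_seq_def power_add power2_eq_square algebra_simps)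
qed

lemma whiten_dcov_seq_le:
  "x + 2 \<le> j \<Longrightarrow> whiten h (\<lambda>y. dcov_seq h (ndist x y)) j = - 2 * h\<^sup>2 * exp (- h) ^ (j - x)"
  using whiten_dcov_seq_far[of h x "j - x - 2"] by (simp del: One_nat_def add_2_eq_Suc')

text \<open>In the left index the remaining factor is proportional to
  \<open>exp (- h) ^ (- i)\<close>, so each application of \<open>1 - exp (- h) B\<close> on that
  side multiplies it by \<open>1 - exp (- h)^2\<close>.\<close>

lemma whiten2_dcov_far:
  assumes "2 \<le> i" "i + 2 \<le> j"
  shows "whiten2 h (dcov_seq h) i j = - 2 * h\<^sup>2 * (1 - exp (- h) ^ 2)\<^sup>2 * exp (- h) ^ (j - i)"
proof -
  have e: "j - (i - 1) = (j - i) + 1" "j - (i - 2) = (j - i) + 2" using assms by auto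
  have "whiten2 h (dcov_seq h) i j = - 2 * h\<^sup>2 * exp (- h) ^ (j - i) - 2 * exp (- h) * (- 2 * h\<^sup>2 * exp (- h) ^ (j - (i-1)))
     + exp (- h) ^ 2 * (- 2 * h\<^sup>2 * exp (- h) ^ (j - (i-2)))"
    using assms by (simp add: whiten2_def whiten_def[of h _ i] whiten_dcov_seq_le)
  also have "\<dots> = - 2 * h\<^sup>2 * (1 - exp (- h) ^ 2)\<^sup>2 * exp (- h) ^ (j - i)"
    unfolding e power_add by (simp add: power2_eq_square algebra_simps)
  finally show ?thesis .
qed

lemma whiten2_dcov_diag: "whiten2 h (dcov_seq h) (Suc (Suc i)) (Suc (Suc i)) = dinnov_var h"
proof -
  have "ndist (Suc (Suc i)) i = 2" "ndist i (Suc (Suc i)) = 2"  by (simp_all add: ndist_def)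
  then show ?thesis
    by (simp add: whiten2_def whiten_def dcov_seq_def dinnov_var_def power2_eq_square power3_eq_cube power4_eq_xxxx algebra_simps)
qed

lemma whiten2_dcov_adj: "whiten2 h (dcov_seq h) (Suc (Suc i)) (Suc (Suc (Suc i))) = dinnov_cov h"
proof -
  have "ndist (Suc (Suc i)) i = 2" "ndist i (Suc (Suc i)) = 2" "ndist i (Suc (Suc (Suc i))) = 3"
    by (simp_all add: ndist_def)
  then show ?thesis
    by (simp add: whiten2_def whiten_def dcov_seq_def dinnov_cov_def power2_eq_square power3_eq_cube power4_eq_xxxx algebra_simps)
qed

lemma whiten2_dcov_start:
  "whiten2 h (dcov_seq h) 0 0 = - 3" "whiten2 h (dcov_seq h) 0 (Suc 0) = - h\<^sup>2 * exp (- h)"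
  "2 \<le> j \<Longrightarrow> whiten2 h (dcov_seq h) 0 j = - 2 * h\<^sup>2 * exp (- h) ^ j"
  "whiten2 h (dcov_seq h) (Suc 0) (Suc 0) = dstart_var h"
  "whiten2 h (dcov_seq h) (Suc 0) 2 = dstart_cov h"
  "3 \<le> j \<Longrightarrow> whiten2 h (dcov_seq h) (Suc 0) j = - 2 * h\<^sup>2 * exp (- h) ^ (j - 1) * (1 - (1 + h) * exp (- h) ^ 2)"
proof -
  show "whiten2 h (dcov_seq h) 0 0 = - 3" "whiten2 h (dcov_seq h) 0 (Suc 0) = - h\<^sup>2 * exp (- h)"
    "whiten2 h (dcov_seq h) (Suc 0) (Suc 0) = dstart_var h"
    "whiten2 h (dcov_seq h) (Suc 0) 2 = dstart_cov h"
    by (auto simp: whiten2_def whiten_def dcov_seq_def dstart_var_def dstart_cov_def numeral_2_eq_2 power3_eq_cube algebra_simps)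
  show "2 \<le> j \<Longrightarrow> whiten2 h (dcov_seq h) 0 j = - 2 * h\<^sup>2 * exp (- h) ^ j"
    using whiten_dcov_seq_le[of 0 j h] by (simp add: whiten2_def whiten_def[of h _ 0])
  assume j: "3 \<le> j"
  then have "exp (-h) ^ j = exp (-h) * exp (- h) ^ (j - 1)"
    by (metis Suc_diff_1 gr0I not_numeral_le_zero power_Suc)
  then show "whiten2 h (dcov_seq h) (Suc 0) j = - 2 * h\<^sup>2 * exp (- h) ^ (j - 1) * (1 - (1 + h) * exp (- h) ^ 2)"
    using whiten_dcov_seq_le[of 0 j h] whiten_dcov_seq_le[of 1 j h] j
    by (simp add: whiten2_def whiten_def[of h _ "Suc 0"] power2_eq_square algebra_simps)
qed

subsection \<open>Small-step expansions\<close>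

lemma uniform_bound_at_right:
  fixes S :: "(real \<Rightarrow> real) set"
  assumes "finite S" "\<And>f. f \<in> S \<Longrightarrow> f \<in> O[at_right 0](\<lambda>_. 1)"
  shows "\<exists>C>0. \<forall>\<^sub>F h in at_right 0. \<forall>f\<in>S. \<bar>f h\<bar> \<le> C"
  using assms
proof (induction S rule: finite_induct)
  case empty
  show ?case by (intro exI[of _ 1]) auto
next
  case (insert f S)
  then obtain C where C: "C > 0" "\<forall>\<^sub>F h in at_right 0. \<forall>f\<in>S. \<bar>f h\<bar> \<le> C" by auto
  obtain D where D: "D > 0" "\<forall>\<^sub>F h in at_right 0. norm (f h) \<le> D * norm (1::real)"
    using insert.prems[of f] by (auto elim: landau_o.bigE)
  have "\<forall>\<^sub>F h in at_right 0. \<forall>f\<in>insert f S. \<bar>f h\<bar> \<le> C + D"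
    using C(2) D(2) by eventually_elim (use C(1) D(1) in force)
  then show ?case using C(1) D(1) by (intro exI[of _ "C + D"]) auto
qed

text \<open>
  Every scalar that enters the error analysis, divided by its claimed order in \<open>h\<close>, so that one
  constant bounds all of them near \<open>0\<close>.
\<close>

definition error_terms :: "(real \<Rightarrow> real) set" where
  "error_terms = {
    \<lambda>h. innov_var h / h^3, \<lambda>h. innov_cov h / h^3, \<lambda>h. start_var h / h^2,
    \<lambda>h. dinnov_var h / h^4, \<lambda>h. dinnov_cov h / h^4, \<lambda>h. dstart_cov h / h^3,
    \<lambda>h. (1 - exp (-h)^2)^2 / h^2, \<lambda>h. (1 - (1 + h) * exp (- h) ^ 2) / h,
    \<lambda>h. (dstart_var h / h^2 + start_var h / h^2) / h,
    \<lambda>h. (dstart_cov h / h^3 + 2 * (start_var h / h^2) * exp (-h)^2) / h,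
    \<lambda>h. (- 2 * exp (-h) * (1 - (1 + h) * exp (- h) ^ 2) / h + 2 * (start_var h / h^2) * exp (-h)^2) / h,
    \<lambda>h. (- 2 * exp (-h) + (innov_var h * exp (-h) + innov_cov h * (1 + exp (-h)^2)) / (2 * h^3)) / h,
    \<lambda>h. (- 2 * (1 - (1 + h) * exp (- h) ^ 2) + (innov_var h * exp (-h) + innov_cov h * (1 + exp (-h)^2)) / (2 * h^2)) / h^2,
    \<lambda>h. (- 2 * (1 - exp (-h)^2)^2 * exp (-h) / h + 2 * (innov_var h * exp (-h) + innov_cov h * (1 + exp (-h)^2)) / h^2) / h^2,
    \<lambda>h. (dinnov_cov h / h^3 + 2 * (innov_var h * exp (-h) + innov_cov h * (1 + exp (-h)^2)) / h^2) / h^2,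
    \<lambda>h. (dinnov_var h / h^3 + 2 * (innov_var h + 2 * innov_cov h * exp (-h)) / h^2) / h^2,
    \<lambda>h. (2 * h * exp (-h)^2 / (1 - exp (-h)^2) - 1) / h,
    \<lambda>h. (1 - exp (-h)^4) / h,
    \<lambda>h. ((start_var h - innov_cov h) / h^2 - 1) / h,
    \<lambda>h. ((innov_var h - 2 * innov_cov h) / h^3 - 4/3) / h}"

lemma error_terms_bigo: "f \<in> error_terms \<Longrightarrow> f \<in> O[at_right 0](\<lambda>_. 1)"
  unfolding error_terms_def innov_var_def innov_cov_def start_var_def dinnov_var_def dinnov_cov_def dstart_var_def dstart_cov_def
  apply (elim insertE emptyE; hypsubst)
  apply real_asymp+
  done

text \<open>
  Solving \<open>A F = E\<close> with \<open>A\<close> strictly column diagonally dominant: the sum over the rows of the row maxima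
  is controlled. This norm dominates the trace and is submultiplicative under \<open>trace (F G)\<close>.
\<close>

lemma column_dominant_bound:
  fixes A F E :: "nat \<Rightarrow> nat \<Rightarrow> real"
  assumes m: "0 < m"
    and eq: "\<And>i j. i < n \<Longrightarrow> j < m \<Longrightarrow> (\<Sum>k<n. A i k * F k j) = E i j"
    and e: "\<And>i j. i < n \<Longrightarrow> j < m \<Longrightarrow> \<bar>E i j\<bar> \<le> e i"
    and dom: "\<And>k. k < n \<Longrightarrow> c \<le> A k k - (\<Sum>i\<in>{..<n}-{k}. \<bar>A i k\<bar>)"
  obtains f where "\<And>i j. i < n \<Longrightarrow> j < m \<Longrightarrow> \<bar>F i j\<bar> \<le> f i" "\<And>i. 0 \<le> f i"
    "c * (\<Sum>i<n. f i) \<le> (\<Sum>i<n. e i)"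
proof
  define f where "f i = Max ((\<lambda>j. \<bar>F i j\<bar>) ` {..<m})" for i
  have f_ge: "\<bar>F i j\<bar> \<le> f i" if "j < m" for i j
    unfolding f_def using that by (intro Max_ge) auto
  then show "\<bar>F i j\<bar> \<le> f i" if "j < m" for i j using that .
  show f0: "0 \<le> f i" for i
    using f_ge[of 0 i] m by force
  have row: "A i i * f i \<le> e i + (\<Sum>k\<in>{..<n}-{i}. \<bar>A i k\<bar> * f k)" if i: "i < n" for i
  proof -
    \<comment> \<open>The maximum of the row is attained in some column \<open>j\<close>, and the
      equation of that single column gives the inequality for \<open>f i\<close>.\<close>
    have "f i \<in> (\<lambda>j. \<bar>F i j\<bar>) ` {..<m}"
      unfolding f_def using m by (intro Max_in) auto
    then obtain j where j: "j < m" "f i = \<bar>F i j\<bar>" by auto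
    have "(\<Sum>k<n. A i k * F k j) = A i i * F i j + (\<Sum>k\<in>{..<n}-{i}. A i k * F k j)"
      using i by (subst sum.remove[of _ i]) auto
    then have "A i i * F i j = E i j - (\<Sum>k\<in>{..<n}-{i}. A i k * F k j)"
      using eq[OF i j(1)] by simp
    moreover have "A i i * \<bar>F i j\<bar> \<le> \<bar>A i i * F i j\<bar>"
      unfolding abs_mult by (intro mult_right_mono) auto
    ultimately have "A i i * \<bar>F i j\<bar> \<le> \<bar>E i j\<bar> + \<bar>\<Sum>k\<in>{..<n}-{i}. A i k * F k j\<bar>"
      by linarith
    also have "\<bar>\<Sum>k\<in>{..<n}-{i}. A i k * F k j\<bar> \<le> (\<Sum>k\<in>{..<n}-{i}. \<bar>A i k\<bar> * f k)"
      by (rule order_trans[OF sum_abs]) (auto intro!: sum_mono mult_left_mono f_ge j simp: abs_mult)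
    finally show ?thesis using e[OF i j(1)] j by simp
  qed
  have "c * (\<Sum>k<n. f k) \<le> (\<Sum>k<n. (A k k - (\<Sum>i\<in>{..<n}-{k}. \<bar>A i k\<bar>)) * f k)"
    unfolding sum_distrib_left by (intro sum_mono mult_right_mono dom f0) auto
  also have "\<dots> = (\<Sum>k<n. A k k * f k) - (\<Sum>k<n. \<Sum>i\<in>{..<n}-{k}. \<bar>A i k\<bar> * f k)"
    by (simp add: sum_subtractf left_diff_distrib sum_distrib_right)
  \<comment> \<open>Exchanging the sums turns the column sums of the dominance hypothesis into the
    row sums that bound the diagonal terms, and these cancel.\<close>
  also have "(\<Sum>k<n. \<Sum>i\<in>{..<n}-{k}. \<bar>A i k\<bar> * f k) = (\<Sum>k<n. \<Sum>i<n. if i = k then 0 else \<bar>A i k\<bar> * f k)"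
    by (intro sum.cong refl sum.mono_neutral_cong_left) auto
  also have "\<dots> = (\<Sum>i<n. \<Sum>k<n. if i = k then 0 else \<bar>A i k\<bar> * f k)"
    by (rule sum.swap)
  also have "\<dots> = (\<Sum>i<n. \<Sum>k\<in>{..<n}-{i}. \<bar>A i k\<bar> * f k)"
    by (intro sum.cong refl sum.mono_neutral_cong_right) auto
  also have "(\<Sum>k<n. A k k * f k) \<le> (\<Sum>i<n. e i + (\<Sum>k\<in>{..<n}-{i}. \<bar>A i k\<bar> * f k))"
    by (intro sum_mono row) auto
  finally show "c * (\<Sum>i<n. f i) \<le> (\<Sum>i<n. e i)"
    by (simp add: sum.distrib)
qed

section \<open>Strict dominance of the whitened covariance for every positive step\<close>

lemma innov_var_gt: "0 < h \<Longrightarrow> 2 * innov_cov h < innov_var h"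
proof -
  assume h: "0 < h"
  \<comment> \<open>The cofactor of \<open>(1 + exp (- h))^2\<close> in
    \<open>innov_var h - 2 * innov_cov h\<close>. Monotonicity from 0 avoids any smallness
    assumption: the covariance matrix has to be invertible for every \<open>n\<close>, not only for
    large ones.\<close>
  define g where "g x = 1 - exp (- x) ^ 2 - 2 * x * exp (- x)" for x :: real
  have "\<exists>y. (g has_real_derivative y) (at x) \<and> 0 < y" if "0 < x" for x
  proof (intro exI conjI)
    show "(g has_real_derivative 2 * exp (- x) * (exp (- x) - 1 + x)) (at x)"
      unfolding g_def by (auto intro!: derivative_eq_intros simp: algebra_simps power2_eq_square)
    show "0 < 2 * exp (- x) * (exp (- x) - 1 + x)"
      using exp_minus_greater[of x] that by simp
  qed
  moreover have "continuous_on {0..h} g"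
    unfolding g_def by (intro continuous_intros)
  ultimately have "g 0 < g h"
    by (intro DERIV_pos_imp_increasing_open[OF h]) blast+
  then have "0 < (1 + exp (- h)) ^ 2 * g h"
    by (intro mult_pos_pos zero_less_power) (auto simp: g_def add_pos_pos)
  also have "\<dots> = innov_var h - 2 * innov_cov h"
    by (simp add: g_def innov_var_def innov_cov_def power2_eq_square power3_eq_cube power4_eq_xxxx algebra_simps)
  finally show ?thesis by simp
qed

text \<open>The sign removes the absolute values of the off-diagonal entries in both dominance
  arguments. After the factor \<open>exp (- h)\<close> is split off, the derivative is positive by
  \<open>1 + y < exp y\<close>.\<close>

lemma innov_cov_pos: "0 < h \<Longrightarrow> 0 < innov_cov h"
proof -
  assume h: "0 < h"
  define g where "g x = x - 1 + exp (- 2 * x) * (1 + x)" for x :: real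
  have "\<exists>y. (g has_real_derivative y) (at x) \<and> 0 < y" if "0 < x" for x
  proof (intro exI conjI)
    show "(g has_real_derivative exp (- 2 * x) * (exp (2 * x) - (1 + 2 * x))) (at x)"
      unfolding g_def by (auto intro!: derivative_eq_intros simp: algebra_simps simp flip: exp_add)
    show "0 < exp (- 2 * x) * (exp (2 * x) - (1 + 2 * x))"
      using exp_minus_greater[of "- (2 * x)"] that by simp
  qed
  moreover have "continuous_on {0..h} g"
    unfolding g_def by (intro continuous_intros)
  ultimately have "g 0 < g h"
    by (intro DERIV_pos_imp_increasing_open[OF h]) blast+
  then have "0 < exp (- h) * g h"
    by (simp add: g_def)
  also have "exp (- 2 * h) = exp (- h) ^ 2"
    by (simp add: power2_eq_square flip: exp_add)
  then have "exp (- h) * g h = innov_cov h"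
    by (simp add: g_def innov_cov_def power2_eq_square power3_eq_cube algebra_simps)
  finally show ?thesis .
qed

lemma start_var_gt: "0 < h \<Longrightarrow> innov_cov h < start_var h"
proof -
  assume h: "0 < h"
  \<comment> \<open>The gap multiplied by \<open>exp h ^ 2\<close>; with the leading exponential
    cleared, the sign of the derivative follows from \<open>1 + x \<le> exp x\<close>.\<close>
  define g where "g x = exp x ^ 2 - (1 + x) ^ 2 - (x - 1) * exp x - (1 + x) * exp (- x)" for x :: real
  have "\<exists>y. (g has_real_derivative y) (at x) \<and> 0 < y" if x: "0 < x" for x
  proof (intro exI conjI)
    show "(g has_real_derivative 2 * exp x ^ 2 - 2 * (1 + x) - x * exp x + x * exp (- x)) (at x)"
      unfolding g_def by (auto intro!: derivative_eq_intros simp: algebra_simps power2_eq_square)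
    have eq: "2 * exp x ^ 2 - 2 * (1 + x) - x * exp x + x * exp (- x)
      = (exp x * (2 * exp x - x) - (1 + x) * (2 + x)) + x * x + x + x * exp (- x)"
      by (simp add: power2_eq_square algebra_simps)
    have b: "1 + x \<le> exp x" by (rule exp_ge_add_one_self)
    have "(1 + x) * (2 + x) \<le> exp x * (2 * exp x - x)"
      using b x by (intro mult_mono) linarith+
    moreover have "0 < x * exp (- x)" "0 < x * x" using x by (simp_all add: mult_pos_pos)
    ultimately show "0 < 2 * exp x ^ 2 - 2 * (1 + x) - x * exp x + x * exp (- x)"
      unfolding eq using x by linarith
  qed
  moreover have "continuous_on {0..h} g"
    unfolding g_def by (intro continuous_intros)
  ultimately have "g 0 < g h"
    by (intro DERIV_pos_imp_increasing_open[OF h]) blast+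
  then have "0 < exp (- h) ^ 2 * g h"
    by (simp add: g_def)
  also have "\<dots> = exp (- h) ^ 2 * exp h ^ 2 - (1 + h) ^ 2 * exp (- h) ^ 2 - (h - 1) * exp (- h) * (exp (- h) * exp h) - (1 + h) * exp (- h) ^ 3"
    by (simp add: g_def power2_eq_square power3_eq_cube algebra_simps)
  also have "exp (- h) * exp h = 1" by (simp flip: exp_add)
  also have "exp (- h) ^ 2 * exp h ^ 2 = 1" by (simp flip: exp_add power_mult_distrib)
  finally show ?thesis
    unfolding innov_cov_def start_var_def power_mult_distrib by (simp add: algebra_simps)
qed

section \<open>Error analysis of the guess on a fine grid\<close>

lemma tridiagonal_sum:
  fixes g :: "nat \<Rightarrow> 'b::comm_monoid_add"
  assumes k: "k < n" and z: "\<And>i. i + 2 \<le> k \<or> k + 2 \<le> i \<Longrightarrow> g i = 0"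
  shows "(\<Sum>i<n. g i) = (if k = 0 then 0 else g (k - 1)) + g k + (if Suc k < n then g (Suc k) else 0)"
proof -
  have "(\<Sum>i<n. g i) = (\<Sum>i\<in>{i. i < n \<and> k \<le> Suc i \<and> i \<le> Suc k}. g i)"
    by (intro sum.mono_neutral_right) (auto intro!: z)
  also have "{i. i < n \<and> k \<le> Suc i \<and> i \<le> Suc k} = (if k = 0 then {} else {k - 1}) \<union> {k} \<union> (if Suc k < n then {Suc k} else {})"
    using k by auto
  finally show ?thesis using k by (auto simp: add_ac)
qed

lemma sum_wh2_cov:
  assumes i: "i < n"
  shows "(\<Sum>k<n. whiten2 h (cov_seq h) i k * g k) =
    (if i = 0 then g 0
     else if i = 1 then start_var h * g 1 + (if 2 < n then innov_cov h * g 2 else 0)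
     else innov_cov h * g (i - 1) + innov_var h * g i + (if Suc i < n then innov_cov h * g (Suc i) else 0))"
proof -
  have z: "whiten2 h (cov_seq h) i k * g k = 0" if "k + 2 \<le> i \<or> i + 2 \<le> k" for k
    using that whiten2_cov_far[of i k h] whiten2_cov_far[of k i h] whiten2_commute[of h "cov_seq h" i k] by auto
  consider "i = 0" | "i = 1" | m where "i = Suc (Suc m)"
    by (metis One_nat_def not0_implies_Suc)
  then show ?thesis
  proof cases
    case 1
    then show ?thesis
      using tridiagonal_sum[OF i, of "\<lambda>k. whiten2 h (cov_seq h) i k * g k"] z
      by (simp add: whiten2_cov_start)
  next
    case 2
    then show ?thesis
      using tridiagonal_sum[OF i, of "\<lambda>k. whiten2 h (cov_seq h) i k * g k"] z
      by (simp add: whiten2_cov_start whiten2_commute[of h _ "Suc 0" 0] whiten2_cov_adj[of h 0] numeral_2_eq_2)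
  next
    case 3
    then show ?thesis
      using tridiagonal_sum[OF i, of "\<lambda>k. whiten2 h (cov_seq h) i k * g k"] z
      by (simp add: whiten2_cov_adj whiten2_cov_diag whiten2_commute[of h _ "Suc (Suc _)" "Suc _"])
  qed
qed

text \<open>The condition \<open>C * h \<le> 1/2\<close> keeps the normalised dominance margins,
  whose limits are at least 1, above \<open>1/2\<close>; \<open>3 \<le> n\<close> makes room for the
  two border rows and one interior row.\<close>

locale fine_grid =
  fixes h C :: real and n :: nat
  assumes h_pos: "0 < h" and h_le: "h \<le> 1" and n_ge: "3 \<le> n" and C_ge: "1 \<le> C" and Ch: "C * h \<le> 1/2"
    and err: "\<forall>f\<in>error_terms. \<bar>f h\<bar> \<le> C"
begin

abbreviation "a \<equiv> exp (- h)"
text \<open>The interior rows of the tridiagonal matrix send the geometric sequence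
  \<open>a ^ i\<close> to \<open>Q * a ^ (i - 1)\<close>. As \<open>h\<close> tends to 0,
  \<open>innov_var h\<close> and \<open>innov_cov h\<close> behave like \<open>8/3 * h^3\<close> and
  \<open>2/3 * h^3\<close>, so \<open>Q\<close> behaves like \<open>4 * h^3\<close>.\<close>

abbreviation "Q \<equiv> innov_var h * a + innov_cov h * (1 + a^2)"

lemma a01: "0 < a" "a \<le> 1" "0 \<le> a ^ k" "a ^ k \<le> 1"
  using h_pos by (auto intro!: power_le_one)

lemma div_bound: "\<bar>x / h ^ k\<bar> \<le> C \<Longrightarrow> \<bar>x\<bar> \<le> C * h ^ k"
  using h_pos by (simp add: abs_divide pos_divide_le_eq)

lemma div_bound1: "\<bar>x / h\<bar> \<le> C \<Longrightarrow> \<bar>x\<bar> \<le> C * h"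
  using div_bound[of x 1] by simp

lemma a_mult_bound: "\<bar>x\<bar> \<le> y \<Longrightarrow> \<bar>a ^ k * x\<bar> \<le> y"
  using mult_mono[of "a ^ k" 1 "\<bar>x\<bar>" y] a01(3,4)[of k] by (simp add: abs_mult)

lemma error_bounds:
  "\<bar>innov_var h\<bar> \<le> C * h^3" (is ?B1) "\<bar>innov_cov h\<bar> \<le> C * h^3" (is ?B2) "\<bar>start_var h\<bar> \<le> C * h^2" (is ?B3)
  "\<bar>dinnov_var h\<bar> \<le> C * h^4" (is ?B4) "\<bar>dinnov_cov h\<bar> \<le> C * h^4" (is ?B5) "\<bar>dstart_cov h\<bar> \<le> C * h^3" (is ?B6)
  "\<bar>(1 - a^2)^2\<bar> \<le> C * h^2" (is ?B7) "\<bar>1 - (1 + h) * a ^ 2\<bar> \<le> C * h" (is ?B8)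
  "\<bar>dstart_var h / h^2 + start_var h / h^2\<bar> \<le> C * h" (is ?B9)
  "\<bar>dstart_cov h / h^3 + 2 * (start_var h / h^2) * a^2\<bar> \<le> C * h" (is ?B10)
  "\<bar>- 2 * a * (1 - (1 + h) * a ^ 2) / h + 2 * (start_var h / h^2) * a^2\<bar> \<le> C * h" (is ?B11)
  "\<bar>- 2 * a + Q / (2 * h^3)\<bar> \<le> C * h" (is ?B12)
  "\<bar>- 2 * (1 - (1 + h) * a ^ 2) + Q / (2 * h^2)\<bar> \<le> C * h^2" (is ?B13)
  "\<bar>- 2 * (1 - a^2)^2 * a / h + 2 * Q / h^2\<bar> \<le> C * h^2" (is ?B14)
  "\<bar>dinnov_cov h / h^3 + 2 * Q / h^2\<bar> \<le> C * h^2" (is ?B15)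
  "\<bar>dinnov_var h / h^3 + 2 * (innov_var h + 2 * innov_cov h * a) / h^2\<bar> \<le> C * h^2" (is ?B16)
  "\<bar>2 * h * a^2 / (1 - a^2) - 1\<bar> \<le> C * h" (is ?B17)
  "\<bar>1 - a^4\<bar> \<le> C * h" (is ?B18)
  "\<bar>(start_var h - innov_cov h) / h^2 - 1\<bar> \<le> C * h" (is ?B19)
  "\<bar>(innov_var h - 2 * innov_cov h) / h^3 - 4/3\<bar> \<le> C * h" (is ?B20)
proof -
  note e = err[unfolded error_terms_def Set.ball_simps]
  show ?B1 by (rule div_bound) (insert e, elim conjE, assumption)
  show ?B2 by (rule div_bound) (insert e, elim conjE, assumption)
  show ?B3 by (rule div_bound) (insert e, elim conjE, assumption)
  show ?B4 by (rule div_bound) (insert e, elim conjE, assumption)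
  show ?B5 by (rule div_bound) (insert e, elim conjE, assumption)
  show ?B6 by (rule div_bound) (insert e, elim conjE, assumption)
  show ?B7 by (rule div_bound) (insert e, elim conjE, assumption)
  show ?B8 by (rule div_bound1) (insert e, elim conjE, assumption)
  show ?B9 by (rule div_bound1) (insert e, elim conjE, assumption)
  show ?B10 by (rule div_bound1) (insert e, elim conjE, assumption)
  show ?B11 by (rule div_bound1) (insert e, elim conjE, assumption)
  show ?B12 by (rule div_bound1) (insert e, elim conjE, assumption)
  show ?B13 by (rule div_bound) (insert e, elim conjE, assumption)
  show ?B14 by (rule div_bound) (insert e, elim conjE, assumption)
  show ?B15 by (rule div_bound) (insert e, elim conjE, assumption)
  show ?B16 by (rule div_bound) (insert e, elim conjE, assumption)
  show ?B17 by (rule div_bound1) (insert e, elim conjE, assumption)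
  show ?B18 by (rule div_bound1) (insert e, elim conjE, assumption)
  show ?B19 by (rule div_bound1) (insert e, elim conjE, assumption)
  show ?B20 by (rule div_bound1) (insert e, elim conjE, assumption)
qed

text \<open>The rows of the whitening are, to leading order, a value, a first difference and second
  differences; the scale is \<open>h\<close> to the order of the difference.\<close>

definition "row_scale i = (if i = 0 then 1 else if i = 1 then h else h^2)" for i :: nat

text \<open>
  \<open>\<theta>\<close> times the discretisation of the integral operator with kernel \<open>- 2 exp (- \<theta> \<bar>x - y\<bar>)\<close>, bordered by two rows
  and columns for the value and the derivative of the process at \<open>0\<close>.
\<close>

definition "approx i j = (if i = 0 then (if j = 0 then - 3 else if j = 1 then 0 else - 2 * a ^ j)
   else if i = 1 then (if j = 0 then 0 else if j = 1 then - 1 else - 2 * a ^ j)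
   else if j \<le> 1 then - (h / 2) * a ^ i else - 2 * h * a ^ ndist i j)" for i j :: nat

lemma approx_le: "\<bar>approx i j\<bar> \<le> (if i = 0 then 3 else if i = 1 then 2 else 2 * h)"
proof -
  have "h * a ^ k \<le> h * 1" for k
    using h_pos by (intro mult_left_mono a01) auto
  then have "\<bar>h * a ^ k\<bar> \<le> h" for k using h_pos by (simp add: abs_mult)
  from this[of i] this[of "ndist i j"] show ?thesis using a01(3,4)[of j] h_pos
    by (auto simp: approx_def abs_mult)
qed

text \<open>The defect of the guess in the equation for \<open>\<Gamma>\<close> between the whitened
  matrices, with columns divided by \<open>row_scale\<close>. Rows other than the first are also
  divided by \<open>h\<close>, the normalisation in which the tridiagonal matrix has entries of
  order one.\<close>

definition "resid i j = (whiten2 h (dcov_seq h) i j / row_scale j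
   - (\<Sum>k<n. whiten2 h (cov_seq h) i k * (approx k j / row_scale k))) / (if i = 0 then 1 else h)" for i j :: nat

lemma ha_le: "\<bar>h * a\<bar> \<le> C * h"
proof -
  have "a \<le> C" using a01(2) C_ge by linarith
  then have "h * a \<le> h * C" using h_pos by (intro mult_left_mono) auto
  then show ?thesis using h_pos by (simp add: abs_mult mult.commute[of h])
qed

lemma resid_0: "\<bar>resid 0 j\<bar> \<le> C * h"
proof -
  have r: "resid 0 j = whiten2 h (dcov_seq h) 0 j / row_scale j - approx 0 j"
    unfolding resid_def using n_ge by (subst sum_wh2_cov) (simp_all add: row_scale_def)
  have c: "0 \<le> C * h" using C_ge h_pos by simp
  consider "j = 0" | "j = 1" | "2 \<le> j" by linarith
  then show ?thesis
  proof cases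
    case 1 then show ?thesis unfolding r using c by (simp add: whiten2_dcov_start row_scale_def approx_def)
  next
    case 2 then show ?thesis unfolding r using ha_le h_pos by (simp add: whiten2_dcov_start row_scale_def approx_def power2_eq_square)
  next
    case 3 then show ?thesis unfolding r using c h_pos by (simp add: whiten2_dcov_start row_scale_def approx_def)
  qed
qed

text \<open>Row 1 reaches row 2 only through \<open>innov_cov h / h^3\<close>, which is bounded,
  times an entry of the guess of order \<open>h\<close>. From column 1 on, the other terms cancel to
  order \<open>h\<close> because \<open>start_var h\<close> is close to \<open>h^2\<close>.\<close>

lemma resid_1: "\<bar>resid 1 j\<bar> \<le> 4 * C * h"
proof -
  have r: "resid 1 j = (whiten2 h (dcov_seq h) 1 j / row_scale j - start_var h / h * approx 1 j - innov_cov h / h^2 * approx 2 j) / h"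
    unfolding resid_def using n_ge by (subst sum_wh2_cov) (simp_all add: row_scale_def algebra_simps)
  have i1: "\<bar>innov_cov h / h ^ 3\<bar> \<le> C" using error_bounds(2) h_pos by (simp add: abs_divide pos_divide_le_eq)
  have i1': "\<bar>innov_cov h / h ^ 3 * (2 * h)\<bar> \<le> C * (2 * h)"
    unfolding abs_mult using h_pos i1 C_ge by (intro mult_mono) auto
  have i2: "\<bar>innov_cov h / h ^ 3 * (h / 2 * a^2)\<bar> \<le> C * h"
    unfolding abs_mult[of _ "h/2*a^2"]  using h_pos i1 C_ge a01(3,4)[of 2] by (intro mult_mono) auto
  note ha = ha_le
  consider "j = 0" | "j = 1" | "j = 2" | "3 \<le> j" by linarith
  then show ?thesis
  proof cases
    case 1
    then have "resid 1 j = - (h * a) + innov_cov h / h ^ 3 * (h / 2 * a^2)"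
      unfolding r using h_pos by (simp add: whiten2_commute[of h _ "Suc 0" 0] whiten2_dcov_start row_scale_def approx_def field_simps power2_eq_square power3_eq_cube)
    then show ?thesis using i2 ha h_pos C_ge by linarith
  next
    case 2
    then have "resid 1 j = dstart_var h / h^2 + start_var h / h^2 + innov_cov h / h ^ 3 * (h / 2 * a^2)"
      unfolding r using h_pos by (simp add: whiten2_dcov_start row_scale_def approx_def field_simps power2_eq_square power3_eq_cube)
    then show ?thesis using i2 error_bounds(9) h_pos C_ge by linarith
  next
    case 3
    then have "resid 1 j = (dstart_cov h / h^3 + 2 * (start_var h / h^2) * a^2) + innov_cov h / h ^ 3 * (2 * h)"
      unfolding r using h_pos by (simp add: whiten2_dcov_start row_scale_def approx_def field_simps power2_eq_square power3_eq_cube)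
    then show ?thesis using i1' error_bounds(10) h_pos C_ge by linarith
  next
    case 4
    then obtain m where j: "j = m + 3" by (metis le_add_diff_inverse2)
    then have "ndist 2 j = m + 1" by (simp add: ndist_def)
    with 4 j have "resid 1 j = a ^ (m+1) * ((- 2 * a * (1 - (1 + h) * a ^ 2) / h + 2 * (start_var h / h^2) * a^2)) + a ^ (m+1) * (innov_cov h / h ^ 3 * (2 * h))"
      unfolding r using h_pos by (simp add: whiten2_dcov_start row_scale_def approx_def field_simps power2_eq_square power3_eq_cube power_add)
    then show ?thesis using a_mult_bound[OF i1', of "m+1"] a_mult_bound[OF error_bounds(11), of "m+1"] h_pos C_ge by linarith
  qed
qed

text \<open>The coefficients \<open>2 * h\<close> and \<open>h / 2\<close> of the guess are the ones
  that make leading terms cancel: \<open>Q\<close> is close to \<open>4 * h^3\<close>, while the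
  derivative side is close to \<open>- 8 * h^4 * a ^ k\<close> at distance \<open>k\<close> from the
  diagonal and equals \<open>- 2 * h^2 * a ^ i\<close> in column 0. The next order cancels too,
  which leaves \<open>h^2\<close>.\<close>

lemma resid_interior:
  assumes i: "3 \<le> i" "Suc i < n"
  shows "\<bar>resid i j\<bar> \<le> C * h^2"
proof -
  have r: "resid i j = (whiten2 h (dcov_seq h) i j / row_scale j - (innov_cov h * approx (i-1) j + innov_var h * approx i j + innov_cov h * approx (i+1) j) / h^2) / h"
    unfolding resid_def using i by (subst sum_wh2_cov) (auto simp: row_scale_def add_divide_distrib)
  from i(1) obtain m where "i = 3 + m" using le_Suc_ex by blast
  then have m: "i = Suc (Suc (Suc m))" by simp
  consider "j = 0" | "j = 1" | "2 \<le> j" "j + 2 \<le> i" | "i = Suc j" | "j = i" | "j = Suc i" | "i + 2 \<le> j" using i by linarith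
  then show ?thesis
  proof cases
    case 1
    then have "resid i j = a ^ (i - 1) * (h * (- 2 * a + Q / (2 * h^3)))"
      unfolding r whiten2_commute[of h _ i j] using 1 h_pos m i by (simp add: whiten2_dcov_start row_scale_def approx_def field_simps power2_eq_square power3_eq_cube)
    moreover have "\<bar>h * (- 2 * a + Q / (2 * h^3))\<bar> \<le> h * (C * h)"
      unfolding abs_mult using h_pos error_bounds(12) by (intro mult_mono) auto
    ultimately have "\<bar>resid i j\<bar> \<le> h * (C * h)" by (simp only: a_mult_bound)
    then show ?thesis by (simp add: power2_eq_square mult_ac)
  next
    case 2
    have "whiten2 h (dcov_seq h) i j = - 2 * h^2 * a ^ (i - 1) * (1 - (1 + h) * a ^ 2)"
      using whiten2_dcov_start(6)[of i h] i whiten2_commute[of h _ i 1] 2 by simp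
    moreover have "approx (i - 1) j = - (h / 2) * a ^ (i - 1)" "approx i j = - (h / 2) * (a ^ (i - 1) * a)"
      "approx (i + 1) j = - (h / 2) * (a ^ (i - 1) * a * a)" "row_scale j = h"
      using 2 m by (simp_all add: approx_def row_scale_def)
    moreover have "((- 2 * h^2 * A * (1 - (1 + h) * b^2)) / h - (x * (- (h / 2) * A) + y * (- (h / 2) * (A * b)) + x * (- (h / 2) * (A * b * b))) / h^2) / h
       = A * (- 2 * (1 - (1 + h) * b^2) + (y * b + x * (1 + b^2)) / (2 * h^2))" for A b x y :: real
      using h_pos by (simp add: field_simps power2_eq_square)
    ultimately have "resid i j = a ^ (i - 1) * (- 2 * (1 - (1 + h) * a ^ 2) + Q / (2 * h^2))"
      unfolding r by simp
    then show ?thesis by (simp only: a_mult_bound[OF error_bounds(13)])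
  next
    case 3
    then obtain l where l: "i = j + l + 2" using le_Suc_ex[of "j + 2" i] by auto
    then have "ndist i j = l + 2" "ndist (i+1) j = Suc (Suc (Suc l))" "ndist (i - 1) j = l + 1" using 3 by (auto simp: ndist_def)
    with 3 l have "resid i j = a ^ (l + 1) * (- 2 * (1 - a^2)^2 * a / h + 2 * Q / h^2)"
      unfolding r whiten2_commute[of h _ i j] using h_pos m i whiten2_dcov_far[of j i h] by (simp add: row_scale_def approx_def field_simps power2_eq_square power3_eq_cube)
    then show ?thesis by (simp only: a_mult_bound[OF error_bounds(14)])
  next
    case 4
    then have e: "ndist i j = 1" "ndist (i+1) j = 2" "ndist (i - 1) j = 0"  by (auto simp: ndist_def)
    have "whiten2 h (dcov_seq h) i j = dinnov_cov h" using 4 m whiten2_dcov_adj[of h m] whiten2_commute by auto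
    with 4 e have "resid i j = dinnov_cov h / h^3 + 2 * Q / h^2"
      unfolding r using h_pos m i by (simp add: row_scale_def approx_def field_simps power2_eq_square power3_eq_cube)
    then show ?thesis using error_bounds(15) by simp
  next
    case 5
    then have e: "ndist i j = 0" "ndist (i+1) j = 1" "ndist (i - 1) j = 1" using m by (auto simp: ndist_def)
    have "whiten2 h (dcov_seq h) i j = dinnov_var h" using 5 m whiten2_dcov_diag[of h "Suc m"] by auto
    with 5 e have "resid i j = dinnov_var h / h^3 + 2 * (innov_var h + 2 * innov_cov h * a) / h^2"
      unfolding r using h_pos m i by (simp add: row_scale_def approx_def field_simps power2_eq_square power3_eq_cube)
    then show ?thesis using error_bounds(16) by simp
  next
    case 6
    then have e: "ndist i j = 1" "ndist (i+1) j = 0" "ndist (i - 1) j = 2" using m by (auto simp: ndist_def)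
    have "whiten2 h (dcov_seq h) i j = dinnov_cov h" using 6 m whiten2_dcov_adj[of h "Suc m"] by auto
    with 6 e have "resid i j = dinnov_cov h / h^3 + 2 * Q / h^2"
      unfolding r using h_pos m i by (simp add: row_scale_def approx_def field_simps power2_eq_square power3_eq_cube)
    then show ?thesis using error_bounds(15) by simp
  next
    case 7
    then obtain l where l: "j = i + l + 2" using le_Suc_ex[of "i + 2" j] by auto
    then have "ndist i j = l + 2" "ndist (i+1) j = l + 1" "ndist (i - 1) j = Suc (Suc (Suc l))" using m by (auto simp: ndist_def)
    with 7 l have "resid i j = a ^ (l + 1) * (- 2 * (1 - a^2)^2 * a / h + 2 * Q / h^2)"
      unfolding r using h_pos m i whiten2_dcov_far[of i j h] by (simp add: row_scale_def approx_def field_simps power2_eq_square power3_eq_cube)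
    then show ?thesis by (simp only: a_mult_bound[OF error_bounds(14)])
  qed
qed

lemma whiten2_dcov_bound:
  assumes i: "2 \<le> i"
  shows "\<bar>whiten2 h (dcov_seq h) i j / row_scale j\<bar> \<le> 2 * C * h^2"
proof -
  have c: "h^2 \<le> C * h^2" "0 \<le> C * h^2" using C_ge h_pos by auto
  have w: "whiten2 h (dcov_seq h) i j = whiten2 h (dcov_seq h) j i" by (rule whiten2_commute)
  obtain m where m: "i = Suc (Suc m)" using i le_Suc_ex[of 2 i] by auto
  have far: "\<bar>whiten2 h (dcov_seq h) x y / h^2\<bar> \<le> 2 * C * h^2" if "2 \<le> x" "x + 2 \<le> y" for x y
    using a_mult_bound[OF error_bounds(7), of "y - x"] h_pos whiten2_dcov_far[OF that, of h]
    by (simp add: abs_mult mult.commute)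
  have near: "\<bar>x / h^2\<bar> \<le> 2 * C * h^2" if "\<bar>x\<bar> \<le> C * h^4" for x
    using that h_pos c by (simp add: abs_divide pos_divide_le_eq power4_eq_xxxx power2_eq_square mult_ac)
  consider "j = 0" | "j = 1" "i = 2" | "j = 1" "3 \<le> i" | "2 \<le> j" "j + 2 \<le> i" | "i = Suc j" "2 \<le> j" | "j = i" | "j = Suc i" | "i + 2 \<le> j" using i by linarith
  then show ?thesis
  proof cases
    case 1
    then show ?thesis unfolding w using a_mult_bound[of "2 * h^2" "2 * h^2" i] i c
      by (auto simp: whiten2_dcov_start row_scale_def abs_mult mult_ac)
  next
    case 2
    then show ?thesis unfolding w using error_bounds(6) h_pos c
      by (simp add: whiten2_dcov_start row_scale_def abs_divide pos_divide_le_eq power3_eq_cube power2_eq_square mult_ac)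
  next
    case 3
    have "\<bar>whiten2 h (dcov_seq h) j i / row_scale j\<bar> = 2 * h * \<bar>a ^ (i - 1) * (1 - (1 + h) * a ^ 2)\<bar>"
      using 3 h_pos by (simp add: whiten2_dcov_start row_scale_def abs_mult abs_divide power2_eq_square)
    also have "\<dots> \<le> 2 * h * (C * h)"
      using a_mult_bound[OF error_bounds(8), of "i - 1"] h_pos by (intro mult_left_mono) auto
    finally show ?thesis unfolding w by (simp add: power2_eq_square mult_ac)
  next
    case 4
    then show ?thesis unfolding w using far[of j i] by (simp add: row_scale_def)
  next
    case 5
    then obtain l where "j = Suc (Suc l)" using le_Suc_ex[of 2 j] by auto
    with 5 show ?thesis unfolding w using near[OF error_bounds(5)] by (simp add: whiten2_dcov_adj row_scale_def)
  next
    case 6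
    then show ?thesis using near[OF error_bounds(4)] m by (simp add: whiten2_dcov_diag row_scale_def)
  next
    case 7
    then show ?thesis using near[OF error_bounds(5)] m by (simp add: whiten2_dcov_adj row_scale_def)
  next
    case 8
    then show ?thesis using far[of i j] i by (simp add: row_scale_def)
  qed
qed

text \<open>No cancellation is used: four terms of size at most \<open>2 * C * h^2\<close> are
  divided by \<open>h\<close>. This serves row 2, whose predecessor is a border row with another
  scale, and the last row, which has no right neighbour.\<close>

lemma resid_edge:
  assumes i: "2 \<le> i" "i < n"
  shows "\<bar>resid i j\<bar> \<le> 8 * C * h"
proof -
  let ?x1 = "innov_cov h * (approx (i - 1) j / row_scale (i - 1))" and ?x2 = "innov_var h * (approx i j / row_scale i)"
    and ?x3 = "if Suc i < n then innov_cov h * (approx (Suc i) j / row_scale (Suc i)) else 0"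
  have r: "resid i j = (whiten2 h (dcov_seq h) i j / row_scale j - (?x1 + ?x2 + ?x3)) / h"
    unfolding resid_def using i by (subst sum_wh2_cov) auto
  have C: "0 \<le> C" using C_ge by simp
  have b: "\<bar>x * (approx k j / row_scale k)\<bar> \<le> 2 * C * h^2" if "\<bar>x\<bar> \<le> C * h^3" "k \<noteq> 0" for x k
  proof -
    have "\<bar>approx k j\<bar> / row_scale k \<le> 2 / h"
      using approx_le[of k j] h_pos that by (auto simp: row_scale_def pos_divide_le_eq power2_eq_square)
    then have "\<bar>x\<bar> * (\<bar>approx k j\<bar> / row_scale k) \<le> C * h^3 * (2 / h)"
      using that h_pos C by (intro mult_mono) (auto simp: row_scale_def)
    then show ?thesis using h_pos by (auto simp: abs_mult abs_divide row_scale_def power2_eq_square power3_eq_cube mult_ac)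
  qed
  have "\<bar>?x1\<bar> \<le> 2 * C * h^2" "\<bar>?x2\<bar> \<le> 2 * C * h^2" "\<bar>?x3\<bar> \<le> 2 * C * h^2"
    using i b[OF error_bounds(2), of "i - 1"] b[OF error_bounds(1), of i] b[OF error_bounds(2), of "Suc i"] C by auto
  moreover have "\<bar>u - (x + y + z)\<bar> \<le> 4 * b" if "\<bar>x\<bar> \<le> b" "\<bar>y\<bar> \<le> b" "\<bar>z\<bar> \<le> b" "\<bar>u\<bar> \<le> b" for u x y z b :: real
    using that by linarith
  ultimately have "\<bar>whiten2 h (dcov_seq h) i j / row_scale j - (?x1 + ?x2 + ?x3)\<bar> \<le> 4 * (2 * C * h^2)"
    using whiten2_dcov_bound[OF i(1), of j] by blast
  then show ?thesis unfolding r using h_pos by (simp add: abs_divide pos_divide_le_eq power2_eq_square)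
qed

definition "norm_cov i k = whiten2 h (cov_seq h) i k / (row_scale k * (if i = 0 then 1 else h))" for i k :: nat

text \<open>Column 0 has margin 1. For the others the margin is at least
  \<open>(start_var h - innov_cov h) / h^2\<close> or
  \<open>(innov_var h - 2 * innov_cov h) / h^3\<close>, with limits 1 and \<open>4/3\<close>, and
  the error \<open>C * h\<close> costs at most \<open>1/2\<close>.\<close>

lemma norm_cov_dominant:
  assumes k: "k < n"
  shows "1/2 \<le> norm_cov k k - (\<Sum>i\<in>{..<n}-{k}. \<bar>norm_cov i k\<bar>)"
proof -
  have z: "norm_cov i k = 0" if "i + 2 \<le> k \<or> k + 2 \<le> i" for i
    using that whiten2_cov_far[of i k h] whiten2_cov_far[of k i h] whiten2_commute[of h "cov_seq h" i k]
    by (auto simp: norm_cov_def)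
  have "(\<Sum>i\<in>{..<n}-{k}. \<bar>norm_cov i k\<bar>) = (\<Sum>i<n. if i = k then 0 else \<bar>norm_cov i k\<bar>)"
    by (intro sum.mono_neutral_cong_left) auto
  also have "\<dots> = (if k = 0 then 0 else \<bar>norm_cov (k - 1) k\<bar>) + (if Suc k < n then \<bar>norm_cov (Suc k) k\<bar> else 0)"
    using k z by (subst tridiagonal_sum[OF k]) auto
  finally have s: "(\<Sum>i\<in>{..<n}-{k}. \<bar>norm_cov i k\<bar>) \<le> (if k = 0 then 0 else \<bar>norm_cov (k - 1) k\<bar>) + \<bar>norm_cov (Suc k) k\<bar>"
    by auto
  have p: "0 < innov_cov h" by (rule innov_cov_pos[OF h_pos])
  have lo: "1/2 \<le> (start_var h - innov_cov h) / h^2" "1/2 \<le> (innov_var h - 2 * innov_cov h) / h^3"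
    using error_bounds(19,20) Ch by linarith+
  consider "k = 0" | "k = 1" | m where "k = Suc (Suc m)"
    by (metis One_nat_def not0_implies_Suc)
  then show ?thesis
  proof cases
    case 1
    then show ?thesis using s by (simp add: norm_cov_def whiten2_cov_start row_scale_def whiten2_commute[of h _ "Suc 0" 0])
  next
    case 2
    have "norm_cov (Suc k) k = innov_cov h / h^2" "norm_cov (k - 1) k = 0" "norm_cov k k = start_var h / h^2"
      using 2 by (simp_all add: norm_cov_def whiten2_cov_start row_scale_def whiten2_commute[of h _ "Suc (Suc 0)" "Suc 0"] whiten2_cov_adj power2_eq_square)
    then show ?thesis using s 2 p lo(1) by (simp add: abs_divide diff_divide_distrib)
  next
    case 3
    have "norm_cov (Suc k) k = innov_cov h / h^3" "norm_cov (k - 1) k = innov_cov h / h^3" "norm_cov k k = innov_var h / h^3"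
      using 3 h_pos by (simp_all add: norm_cov_def whiten2_cov_diag row_scale_def whiten2_commute[of h _ "Suc (Suc (Suc m))"]
          whiten2_cov_adj power2_eq_square power3_eq_cube)
    then show ?thesis using s 3 p h_pos lo(2) by (simp add: abs_divide diff_divide_distrib)
  qed
qed

text \<open>
  \<open>\<Gamma>\<close> is similar to the logarithmic derivative of the covariance matrix; after rescaling by \<open>row_scale\<close> all its
  entries have the size of those of \<open>approx\<close>.
\<close>

lemma approx_error:
  assumes eq: "\<And>i j. i < n \<Longrightarrow> j < n \<Longrightarrow> (\<Sum>k<n. whiten2 h (cov_seq h) i k * \<Gamma> k j) = whiten2 h (dcov_seq h) i j"
  obtains f where "\<And>i j. i < n \<Longrightarrow> j < n \<Longrightarrow> \<bar>\<Gamma> i j * row_scale i / row_scale j - approx i j\<bar> \<le> f i"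
    "\<And>i. 0 \<le> f i" "(\<Sum>i<n. f i) \<le> 2 * C * h * (n * h + 32)"
proof -
  have nz: "row_scale k \<noteq> 0" for k using h_pos by (simp add: row_scale_def)
  have C: "0 \<le> C * h" "0 \<le> C * h^2" using C_ge h_pos by auto
  \<comment> \<open>At most four rows, 0, 1, 2 and \<open>n - 1\<close>, have a residual of order
    \<open>h\<close>; they produce the constant \<open>32 = 4 * 8\<close>. The others contribute
    \<open>n * h^2\<close> in total, again of order \<open>h\<close> when \<open>n * h\<close> is
    fixed.\<close>
  define e where "e i = (if i \<le> 2 \<or> i = n - 1 then 8 * C * h else C * h^2)" for i
  obtain f where f: "\<And>i j. i < n \<Longrightarrow> j < n \<Longrightarrow> \<bar>\<Gamma> i j * row_scale i / row_scale j - approx i j\<bar> \<le> f i"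
    "\<And>i. 0 \<le> f i" "1/2 * (\<Sum>i<n. f i) \<le> (\<Sum>i<n. e i)"
  proof (rule column_dominant_bound[where A = norm_cov and n = n and m = n and E = resid and e = e and c = "1/2"
        and F = "\<lambda>i j. \<Gamma> i j * row_scale i / row_scale j - approx i j"])
    show "0 < n" using n_ge by simp
    show "(\<Sum>k<n. norm_cov i k * (\<Gamma> k j * row_scale k / row_scale j - approx k j)) = resid i j" if "i < n" "j < n" for i j
    proof -
      let ?c = "if i = 0 then 1 else h"
      have "norm_cov i k * (\<Gamma> k j * row_scale k / row_scale j - approx k j)
        = whiten2 h (cov_seq h) i k * \<Gamma> k j / row_scale j / ?c - whiten2 h (cov_seq h) i k * (approx k j / row_scale k) / ?c" for k
        using nz[of k] nz[of j] h_pos by (auto simp: norm_cov_def field_simps)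
      then show ?thesis
        by (simp only: sum_subtractf flip: sum_divide_distrib) (simp only: eq[OF that] resid_def diff_divide_distrib)
    qed
    show "\<bar>resid i j\<bar> \<le> e i" if "i < n" "j < n" for i j
    proof -
      have "i = 0 \<or> i = 1 \<or> (2 \<le> i \<and> (i \<le> 2 \<or> i = n - 1)) \<or> (3 \<le> i \<and> Suc i < n)"
        using that by auto
      then consider "i = 0" | "i = 1" | "2 \<le> i" "i \<le> 2 \<or> i = n - 1" | "3 \<le> i" "Suc i < n"
        by blast
      then show ?thesis
      proof cases
        case 1 then show ?thesis using resid_0[of j] C by (simp add: e_def)
      next
        case 2 then show ?thesis using resid_1[of j] C by (simp add: e_def)
      next
        case 3 then show ?thesis using resid_edge[of i j] that by (simp add: e_def)
      next
        case 4 then show ?thesis using resid_interior[of i j] that by (auto simp: e_def)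
      qed
    qed
    show "1/2 \<le> norm_cov k k - (\<Sum>i\<in>{..<n}-{k}. \<bar>norm_cov i k\<bar>)" if "k < n" for k
      by (rule norm_cov_dominant[OF that])
  qed (use that in auto)
  have "(\<Sum>i<n. e i) \<le> (\<Sum>i<n. C * h^2 + (if i = 0 then 8 * C * h else 0) + (if i = 1 then 8 * C * h else 0)
      + (if i = 2 then 8 * C * h else 0) + (if i = n - 1 then 8 * C * h else 0))"
    using C by (intro sum_mono) (auto simp: e_def)
  also have "\<dots> = n * (C * h^2) + 32 * C * h"
    using n_ge by (simp add: sum.distrib)
  finally have "(\<Sum>i<n. f i) \<le> 2 * C * h * (n * h + 32)"
    using f(3) by (simp add: power2_eq_square algebra_simps)
  with f that show ?thesis by blast
qed

section \<open>Traces of the guess and of its square\<close>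

lemma sum_lessThan_Suc_Suc_shift:
  fixes f :: "nat \<Rightarrow> real"
  shows "(\<Sum>i<Suc (Suc m). f i) = f 0 + f 1 + (\<Sum>i<m. f (Suc (Suc i)))"
  by (simp add: sum.lessThan_Suc_shift del: sum.lessThan_Suc)

lemma sum_approx: "(\<Sum>i<n. approx i i) = - 4 - 2 * h * n + 4 * h"
proof -
  obtain m where m: "n = Suc (Suc m)" using n_ge le_Suc_ex[of 2 n] by auto
  show ?thesis
    unfolding m sum_lessThan_Suc_Suc_shift by (simp add: approx_def algebra_simps)
qed

text \<open>In the limit the kernel part is \<open>4 * n * h - 2 * (1 - exp (- 2 * n * h))\<close>,
  and the products of border rows with border columns add exactly the missing
  \<open>2 * (1 - exp (- 2 * n * h))\<close>. The proof sees this as increments: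
  \<open>D (Suc k) - D k\<close> is \<open>4 * h\<close> up to order \<open>h^2\<close>, so no
  exponential has to be summed to the end.\<close>

lemma sum_approx_square:
  "\<bar>(\<Sum>i<n. \<Sum>j<n. approx i j * approx j i) - (10 + 4 * n * h)\<bar> \<le> 16 * C * n * h^2 + 8 * h"
proof -
  obtain m where m: "n = Suc (Suc m)" using n_ge le_Suc_ex[of 2 n] by auto
  define q where "q = a^2"
  have qk: "(a ^ k)^2 = q ^ k" for k by (simp add: q_def power_mult[symmetric] mult.commute)
  have q01: "0 < q" "q < 1" using h_pos by (auto simp: q_def power_less_one_iff)
  define S where "S m = (\<Sum>i<m. \<Sum>j<m. q ^ ndist i j)" for m
  define D where "D m = 10 + 4 * h * (\<Sum>i<m. q ^ (i + 2)) + 4 * h^2 * S m" for m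
  have "(\<Sum>i<n. \<Sum>j<n. approx i j * approx j i) = 10 + 2 * (\<Sum>i<m. 2 * (h * (a ^ (i+2))^2)) + (\<Sum>i<m. \<Sum>j<m. 4 * h^2 * (a ^ ndist i j)^2)"
    unfolding m sum_lessThan_Suc_Suc_shift by (simp add: approx_def sum.distrib ndist_commute power2_eq_square sum_distrib_left mult_ac)
  also have "\<dots> = D m"
    unfolding qk by (simp add: D_def S_def sum_distrib_left mult_ac)
  finally have D: "(\<Sum>i<n. \<Sum>j<n. approx i j * approx j i) = D m" .
  have geo: "(\<Sum>i<k. q ^ (k - i)) = q * (1 - q ^ k) / (1 - q)" for k
  proof -
    have "(\<Sum>i<k. q ^ (k - i)) = (\<Sum>i<k. q ^ Suc i)"
      by (rule sum.reindex_bij_witness[of _ "\<lambda>i. k - Suc i" "\<lambda>i. k - Suc i"]) (auto simp: Suc_diff_Suc)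
    also have "\<dots> = q * (\<Sum>i<k. q ^ i)" by (simp add: sum_distrib_left)
    finally show ?thesis using q01 by (simp add: sum_gp_strict)
  qed
  have S: "S (Suc k) = S k + 1 + 2 * (\<Sum>i<k. q ^ (k - i))" for k
  proof -
    have "ndist i k = k - i" "ndist k i = k - i" if "i < k" for i using that by (auto simp: ndist_def)
    then show ?thesis by (simp add: S_def sum.distrib)
  qed
  \<comment> \<open>A Riemann sum, \<open>2 * h\<close> times the sum of \<open>q ^ k\<close> over
    \<open>k \<ge> 1\<close>, for twice the integral of \<open>exp (- 2 * x)\<close> over the
    half-line, which is 1.\<close>
  define w where "w = 2 * h * q / (1 - q)"
  have w: "\<bar>w - 1\<bar> \<le> C * h" and q2: "\<bar>1 - q^2\<bar> \<le> C * h"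
    using error_bounds(17,18) by (simp_all add: w_def q_def power_mult[symmetric])
  have step: "\<bar>D (Suc k) - D k - 4 * h\<bar> \<le> 16 * C * h^2" for k
  proof -
    have q': "0 \<le> q ^ k" "q ^ k \<le> 1" using q01 by (auto intro!: power_le_one)
    have "\<bar>(w - 1) * (1 - q ^ k)\<bar> \<le> (C * h) * 1"
      unfolding abs_mult using w q' h_pos C_ge by (intro mult_mono) auto
    moreover have "\<bar>q ^ k * (1 - q^2)\<bar> \<le> 1 * (C * h)"
      unfolding abs_mult using q2 q' h_pos C_ge by (intro mult_mono) auto
    moreover have "h \<le> C * h" using C_ge h_pos by simp
    ultimately have b: "\<bar>h + (w - 1) * (1 - q ^ k) - q ^ k * (1 - q^2)\<bar> \<le> 4 * C * h"
      using h_pos by linarith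
    have "4 * h^2 * (2 * (q * (1 - q ^ k) / (1 - q))) = 4 * h * (w * (1 - q ^ k))"
      by (simp add: w_def power2_eq_square)
    then have "D (Suc k) - D k - 4 * h = 4 * h * (h + (w - 1) * (1 - q ^ k) - q ^ k * (1 - q^2))"
      unfolding D_def S geo by (simp add: power_add power2_eq_square algebra_simps)
    also have "\<bar>\<dots>\<bar> = 4 * h * \<bar>h + (w - 1) * (1 - q ^ k) - q ^ k * (1 - q^2)\<bar>"
      using h_pos by (simp add: abs_mult)
    also have "\<dots> \<le> 4 * h * (4 * C * h)"
      using b h_pos by (intro mult_left_mono) auto
    also have "4 * h * (4 * C * h) = 16 * C * h^2" by (simp add: power2_eq_square)
    finally show ?thesis .
  qed
  have "\<bar>D k - 10 - 4 * h * k\<bar> \<le> 16 * C * h^2 * k" for k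
  proof (induction k)
    case 0 show ?case by (simp add: D_def S_def)
  next
    case (Suc k)
    then show ?case using step[of k] by (simp add: algebra_simps)
  qed
  from this[of m] have "\<bar>D m - 10 - 4 * h * m\<bar> \<le> 16 * C * h^2 * m" .
  moreover have "16 * C * h^2 * m \<le> 16 * C * h^2 * n" using C_ge m by (intro mult_left_mono) auto
  moreover have "4 * h * n = 4 * h * m + 8 * h" using m by (simp add: algebra_simps)
  ultimately show ?thesis unfolding D using h_pos by (simp add: mult_ac)
qed

lemma trace_bounds:
  assumes eq: "\<And>i j. i < n \<Longrightarrow> j < n \<Longrightarrow> (\<Sum>k<n. whiten2 h (cov_seq h) i k * \<Gamma> k j) = whiten2 h (dcov_seq h) i j"
  shows "\<bar>(\<Sum>i<n. \<Gamma> i i) - (- 4 - 2 * (n * h))\<bar> \<le> h * (4 + 2 * C * (n * h + 32))"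
    and "\<bar>(\<Sum>i<n. \<Sum>j<n. \<Gamma> i j * \<Gamma> j i) - (10 + 4 * (n * h))\<bar>
      \<le> h * (16 * C * (n * h) + 8 + (2 * (5 + 2 * (n * h)) + 2 * C * (n * h + 32)) * (2 * C * (n * h + 32)))"
proof -
  obtain f where f: "\<And>i j. i < n \<Longrightarrow> j < n \<Longrightarrow> \<bar>\<Gamma> i j * row_scale i / row_scale j - approx i j\<bar> \<le> f i"
    "\<And>i. 0 \<le> f i" "(\<Sum>i<n. f i) \<le> 2 * C * h * (n * h + 32)"
    using approx_error[OF eq] by blast
  let ?K = "2 * C * (n * h + 32)"
  have K: "(\<Sum>i<n. f i) \<le> h * ?K" "0 \<le> (\<Sum>i<n. f i)" using f by (auto simp: mult_ac intro: sum_nonneg)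
  have K0: "0 \<le> ?K" using C_ge h_pos by simp
  have nz: "row_scale k \<noteq> 0" for k using h_pos by (simp add: row_scale_def)
  define F where "F i j = \<Gamma> i j * row_scale i / row_scale j - approx i j" for i j
  have \<Gamma>: "\<Gamma> i j * row_scale i / row_scale j = approx i j + F i j" for i j by (simp add: F_def)
  have F: "\<bar>F i j\<bar> \<le> f i" if "i < n" "j < n" for i j using f(1)[OF that] by (simp add: F_def)
  \<comment> \<open>Conjugation by the diagonal matrix of \<open>row_scale\<close> changes neither
    this trace nor the trace of the square below.\<close>
  have "(\<Sum>i<n. \<Gamma> i i) = (\<Sum>i<n. approx i i + F i i)"
    unfolding \<Gamma>[symmetric] using nz by simp
  then have "(\<Sum>i<n. \<Gamma> i i) = - 4 - 2 * h * n + 4 * h + (\<Sum>i<n. F i i)"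
    by (simp add: sum.distrib sum_approx)
  moreover have "\<bar>\<Sum>i<n. F i i\<bar> \<le> (\<Sum>i<n. f i)"
    by (rule order_trans[OF sum_abs]) (auto intro!: sum_mono F)
  ultimately show "\<bar>(\<Sum>i<n. \<Gamma> i i) - (- 4 - 2 * (n * h))\<bar> \<le> h * (4 + ?K)"
    using K h_pos by (simp add: algebra_simps)
  define g where "g i = (if i = 0 then 3 else if i = 1 then 2 else 2 * h)" for i :: nat
  have g: "\<bar>approx i j\<bar> \<le> g i" "0 \<le> g i" for i j using approx_le[of i j] h_pos by (auto simp: g_def)
  obtain m where m: "n = Suc (Suc m)" using n_ge le_Suc_ex[of 2 n] by auto
  have G: "(\<Sum>i<n. g i) \<le> 5 + 2 * (n * h)" "0 \<le> (\<Sum>i<n. g i)"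
    using h_pos g unfolding m sum_lessThan_Suc_Suc_shift by (auto simp: g_def algebra_simps intro!: sum_nonneg)
  have prod: "\<bar>\<Sum>i<n. \<Sum>j<n. X i j * Y j i\<bar> \<le> (\<Sum>i<n. x i) * (\<Sum>i<n. y i)"
    if "\<And>i j. i < n \<Longrightarrow> j < n \<Longrightarrow> \<bar>X i j\<bar> \<le> x i" "\<And>i j. i < n \<Longrightarrow> j < n \<Longrightarrow> \<bar>Y i j\<bar> \<le> y i"
      "\<And>i. 0 \<le> x i" for X Y :: "nat \<Rightarrow> nat \<Rightarrow> real" and x y
  proof -
    have "\<bar>\<Sum>i<n. \<Sum>j<n. X i j * Y j i\<bar> \<le> (\<Sum>i<n. \<Sum>j<n. \<bar>X i j * Y j i\<bar>)"
      by (intro order_trans[OF sum_abs] sum_mono) auto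
    also have "\<dots> \<le> (\<Sum>i<n. \<Sum>j<n. x i * y j)"
      unfolding abs_mult using that by (intro sum_mono mult_mono) auto
    finally show ?thesis by (simp add: sum_product)
  qed
  have "(\<Sum>i<n. \<Sum>j<n. \<Gamma> i j * \<Gamma> j i) = (\<Sum>i<n. \<Sum>j<n. (approx i j + F i j) * (approx j i + F j i))"
    unfolding \<Gamma>[symmetric] using nz by (intro sum.cong refl) simp
  also have "\<dots> = (\<Sum>i<n. \<Sum>j<n. approx i j * approx j i) + (\<Sum>i<n. \<Sum>j<n. approx i j * F j i)
     + (\<Sum>i<n. \<Sum>j<n. F i j * approx j i) + (\<Sum>i<n. \<Sum>j<n. F i j * F j i)"
    by (simp add: algebra_simps sum.distrib)
  finally have e: "(\<Sum>i<n. \<Sum>j<n. \<Gamma> i j * \<Gamma> j i) = \<dots>" .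
  have "(\<Sum>i<n. g i) * (\<Sum>i<n. f i) \<le> (5 + 2 * (n * h)) * (h * ?K)"
    using G K h_pos by (intro mult_mono) auto
  moreover have "(\<Sum>i<n. f i) * (\<Sum>i<n. f i) \<le> (1 * ?K) * (h * ?K)"
  proof (intro mult_mono)
    have "h * ?K \<le> 1 * ?K" using h_le K0 by (intro mult_right_mono) auto
    then show "(\<Sum>i<n. f i) \<le> 1 * ?K" using K by linarith
  qed (use K K0 in auto)
  moreover have "\<bar>\<Sum>i<n. \<Sum>j<n. approx i j * F j i\<bar> \<le> (\<Sum>i<n. g i) * (\<Sum>i<n. f i)"
    by (intro prod g F)
  moreover have "\<bar>\<Sum>i<n. \<Sum>j<n. F i j * approx j i\<bar> \<le> (\<Sum>i<n. g i) * (\<Sum>i<n. f i)"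
    unfolding mult.commute[of "\<Sum>i<n. g i"] by (intro prod g F f(2))
  moreover have "\<bar>\<Sum>i<n. \<Sum>j<n. F i j * F j i\<bar> \<le> (\<Sum>i<n. f i) * (\<Sum>i<n. f i)"
    by (intro prod F f(2))
  ultimately have "\<bar>(\<Sum>i<n. \<Sum>j<n. \<Gamma> i j * \<Gamma> j i) - (\<Sum>i<n. \<Sum>j<n. approx i j * approx j i)\<bar>
     \<le> 2 * ((5 + 2 * (n * h)) * (h * ?K)) + (1 * ?K) * (h * ?K)"
    unfolding e by linarith
  also have "\<dots> = h * ((2 * (5 + 2 * (n * h)) + ?K) * ?K)"
    by (simp add: algebra_simps)
  finally have "\<bar>(\<Sum>i<n. \<Sum>j<n. \<Gamma> i j * \<Gamma> j i) - (10 + 4 * n * h)\<bar> \<le> (16 * C * n * h^2 + 8 * h) + h * ((2 * (5 + 2 * (n * h)) + ?K) * ?K)"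
    using sum_approx_square by linarith
  also have "\<dots> = h * (16 * C * (n * h) + 8 + (2 * (5 + 2 * (n * h)) + ?K) * ?K)"
    by (simp only: distrib_left power2_eq_square mult_ac)
  also have "4 * n * h = 4 * (n * h)" by simp
  finally show "\<bar>(\<Sum>i<n. \<Sum>j<n. \<Gamma> i j * \<Gamma> j i) - (10 + 4 * (n * h))\<bar>
      \<le> h * (16 * C * (n * h) + 8 + (2 * (5 + 2 * (n * h)) + ?K) * ?K)" .
qed

end

subsection \<open>Matrix calculus\<close>

lemma times_mat_entry:
  assumes "A \<in> carrier_mat n m" "B \<in> carrier_mat m k" "i < n" "j < k"
  shows "(A * B) $$ (i, j) = (\<Sum>l<m. A $$ (i, l) * B $$ (l, j))"
  using assms by (auto simp: scalar_prod_def atLeast0LessThan intro!: sum.cong)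

lemma inverse_mat_correct:
  fixes A :: "'a::field mat"
  assumes A: "A \<in> carrier_mat n n" and d: "Determinant.det A \<noteq> 0"
  shows "inverse_mat A \<in> carrier_mat n n" "inverse_mat A * A = 1\<^sub>m n" "A * inverse_mat A = 1\<^sub>m n"
proof -
  obtain B where "mat_inverse A = Some B"
    using det_non_zero_imp_unit[OF A d, of "()"] mat_inverse(1)[OF A, of "()"] by (cases "mat_inverse A") auto
  with mat_inverse(2)[OF A this] show "inverse_mat A \<in> carrier_mat n n" "inverse_mat A * A = 1\<^sub>m n" "A * inverse_mat A = 1\<^sub>m n"
    by (auto simp: inverse_mat_def)
qed

lemma left_inverse_unique:
  fixes A :: "'a::field mat"
  assumes A: "A \<in> carrier_mat n n" and B: "B \<in> carrier_mat n n" and C: "C \<in> carrier_mat n n"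
    and CA: "C * A = 1\<^sub>m n" and AB: "A * B = 1\<^sub>m n"
  shows "B = C"
proof -
  have "B = (C * A) * B" using B CA by simp
  also have "\<dots> = C * (A * B)" using A B C by simp
  finally show ?thesis using C AB by simp
qed

lemma inverse_mat_unique:
  fixes A :: "'a::field mat"
  assumes A: "A \<in> carrier_mat n n" and B: "B \<in> carrier_mat n n" and AB: "A * B = 1\<^sub>m n"
  shows "inverse_mat A = B"
proof -
  have "Determinant.det A * Determinant.det B = 1"
    using det_mult[OF A B] AB by simp
  then have d: "Determinant.det A \<noteq> 0" by auto
  show ?thesis
    using left_inverse_unique[OF A B inverse_mat_correct(1)[OF A d] inverse_mat_correct(2)[OF A d] AB] by simp
qed

text \<open>Cramer's rule. It exhibits the entries of the inverse as quotients of determinants, from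
  which their differentiability follows.\<close>

lemma inverse_mat_entry:
  fixes A :: "'a::field mat"
  assumes A: "A \<in> carrier_mat n n" and d: "Determinant.det A \<noteq> 0" and ij: "i < n" "j < n"
  shows "inverse_mat A $$ (i, j) = cofactor A j i / Determinant.det A"
proof -
  have "A * ((1 / Determinant.det A) \<cdot>\<^sub>m adj_mat A) = (1 / Determinant.det A) \<cdot>\<^sub>m (A * adj_mat A)"
    using adj_mat(1)[OF A] A by (intro mult_smult_distrib) auto
  also have "\<dots> = 1\<^sub>m n"
    using d unfolding adj_mat(2)[OF A] by (intro eq_matI) auto
  finally have "inverse_mat A = (1 / Determinant.det A) \<cdot>\<^sub>m adj_mat A"
    using adj_mat(1)[OF A] by (intro inverse_mat_unique[OF A]) auto
  then show ?thesis
    using A ij by (simp add: adj_mat_def)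
qed

text \<open>Scaling the off-diagonal entries by \<open>s \<in> [0, 1]\<close> joins \<open>A\<close> to its diagonal through invertible matrices.\<close>

lemma det_column_dominant_pos:
  fixes A :: "real mat"
  assumes A: "A \<in> carrier_mat n n"
    and dom: "\<And>k. k < n \<Longrightarrow> (\<Sum>i\<in>{..<n}-{k}. \<bar>A $$ (i, k)\<bar>) < A $$ (k, k)"
  shows "0 < Determinant.det A"
proof (cases "n = 0")
  case True
  then show ?thesis using A by (simp add: Determinant.det_def)
next
  case n: False
  define B where "B s = mat n n (\<lambda>(i, j). if i = j then A $$ (i, j) else s * A $$ (i, j))" for s :: real
  have B: "B s \<in> carrier_mat n n" for s by (simp add: B_def)
  have nz: "Determinant.det (B s) \<noteq> 0" if s: "0 \<le> s" "s \<le> 1" for s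
  proof
    assume "Determinant.det (B s) = 0"
    then obtain v where v: "v \<in> carrier_vec n" "v \<noteq> 0\<^sub>v n" "B s *\<^sub>v v = 0\<^sub>v n"
      using det_0_iff_vec_prod_zero_field[OF B] by blast
    define gap where "gap k = A $$ (k, k) - (\<Sum>i\<in>{..<n}-{k}. \<bar>A $$ (i, k)\<bar>)" for k
    define c where "c = Min (gap ` {..<n})"
    have "c \<in> gap ` {..<n}" unfolding c_def using n by (intro Min_in) auto
    then have c: "0 < c" "\<And>k. k < n \<Longrightarrow> c \<le> gap k"
      using dom unfolding c_def by (auto simp: gap_def)
    \<comment> \<open>A vector in the kernel is a solution with one column and right-hand side 0, so
      the bound forces it to vanish.\<close>
    obtain f where f: "\<And>i j. i < n \<Longrightarrow> j < (1::nat) \<Longrightarrow> \<bar>v $ i\<bar> \<le> f i" "\<And>i. 0 \<le> f i" "c * (\<Sum>i<n. f i) \<le> (\<Sum>i<n. (0::real))"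
    proof (rule column_dominant_bound[where n = n and m = 1 and A = "\<lambda>i k. B s $$ (i, k)" and c = c
          and F = "\<lambda>i _. v $ i" and E = "\<lambda>_ _. 0" and e = "\<lambda>_. 0"])
      show "(\<Sum>k<n. B s $$ (i, k) * v $ k) = 0" if "i < n" for i
      proof -
        have "(B s *\<^sub>v v) $ i = 0" using v(3) that by simp
        then show ?thesis using v(1) that B[of s] by (simp add: scalar_prod_def atLeast0LessThan)
      qed
      fix k assume k: "k < n"
      have "(\<Sum>i\<in>{..<n}-{k}. \<bar>B s $$ (i, k)\<bar>) \<le> (\<Sum>i\<in>{..<n}-{k}. \<bar>A $$ (i, k)\<bar>)"
        using s k by (intro sum_mono) (auto simp: B_def abs_mult intro!: mult_left_le_one_le)
      then show "c \<le> B s $$ (k, k) - (\<Sum>i\<in>{..<n}-{k}. \<bar>B s $$ (i, k)\<bar>)"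
        using c(2)[OF k] k by (simp add: gap_def B_def)
    qed (use that in auto)
    have "(\<Sum>i<n. f i) = 0"
      using f(2,3) c(1) sum_nonneg[of "{..<n}" f] by (simp add: mult_le_0_iff)
    then have "f i = 0" if "i < n" for i
      using that f(2) by (simp add: sum_nonneg_eq_0_iff)
    then have "v $ i = 0" if "i < n" for i using f(1)[of i 0] that by force
    then show False using v(1,2) by (auto intro: eq_vecI)
  qed
  have cont: "continuous_on UNIV (\<lambda>s. Determinant.det (B s))"
  proof -
    have "continuous_on UNIV (\<lambda>s. B s $$ (i, p i))" if "p permutes {0..<n}" "i \<in> {0..<n}" for p i
    proof -
      have "p i < n" using permutes_in_image[OF that(1)] that(2) by simp
      then show ?thesis using that by (cases "i = p i") (auto simp: B_def intro!: continuous_intros)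
    qed
    then show ?thesis
      unfolding det_def'[OF B] by (intro continuous_intros) auto
  qed
  have "Determinant.det (B 0) = prod_list (diag_mat (B 0))"
    by (rule det_upper_triangular[OF _ B]) (auto simp: B_def)
  also have "\<dots> > 0"
  proof -
    have "0 < A $$ (k, k)" if "k < n" for k
      using dom[OF that] by (meson abs_ge_zero order_le_less_trans sum_nonneg)
    then show ?thesis
      unfolding prod_list_diag_prod by (intro prod_pos) (auto simp: B_def)
  qed
  finally have pos0: "0 < Determinant.det (B 0)" .
  have "\<not> Determinant.det (B 1) \<le> 0"
  proof
    assume "Determinant.det (B 1) \<le> 0"
    then obtain s where "0 \<le> s" "s \<le> 1" "Determinant.det (B s) = 0"
      using IVT2'[of "\<lambda>s. Determinant.det (B s)" 1 0 0] pos0 continuous_on_subset[OF cont] by auto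
    with nz show False by blast
  qed
  moreover have "B 1 = A" using A by (auto simp: B_def intro!: eq_matI)
  ultimately show ?thesis by simp
qed

text \<open>The dimension is required only near \<open>u\<close>, because
  \<open>inverse_mat (F v)\<close> is known to be an \<open>n\<close> by \<open>n\<close> matrix
  only where \<open>F v\<close> is invertible.\<close>

definition has_mat_derivative :: "nat \<Rightarrow> (real \<Rightarrow> real mat) \<Rightarrow> real mat \<Rightarrow> real \<Rightarrow> bool" where
  "has_mat_derivative n F D u \<longleftrightarrow> (\<forall>\<^sub>F v in nhds u. F v \<in> carrier_mat n n) \<and> D \<in> carrier_mat n n \<and>
     (\<forall>i<n. \<forall>j<n. ((\<lambda>v. F v $$ (i, j)) has_real_derivative D $$ (i, j)) (at u))"

lemma has_mat_derivative_entry: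
  "has_mat_derivative n F D u \<Longrightarrow> i < n \<Longrightarrow> j < n \<Longrightarrow> ((\<lambda>v. F v $$ (i, j)) has_real_derivative D $$ (i, j)) (at u)"
  by (simp add: has_mat_derivative_def)

lemma has_mat_derivative_carrier:
  "has_mat_derivative n F D u \<Longrightarrow> D \<in> carrier_mat n n"
  "has_mat_derivative n F D u \<Longrightarrow> F u \<in> carrier_mat n n"
  "has_mat_derivative n F D u \<Longrightarrow> \<forall>\<^sub>F v in nhds u. F v \<in> carrier_mat n n"
  using eventually_nhds_x_imp_x by (auto simp: has_mat_derivative_def)

lemma has_mat_derivative_cong:
  assumes "has_mat_derivative n F D u" "\<forall>\<^sub>F v in nhds u. F v = G v"
  shows "has_mat_derivative n G D u"
  unfolding has_mat_derivative_def
proof (intro conjI allI impI)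
  show "\<forall>\<^sub>F v in nhds u. G v \<in> carrier_mat n n"
    using has_mat_derivative_carrier(3)[OF assms(1)] assms(2) by eventually_elim simp
  show "D \<in> carrier_mat n n" by (rule has_mat_derivative_carrier(1)[OF assms(1)])
  fix i j assume "i < n" "j < n"
  have "\<forall>\<^sub>F v in nhds u. F v $$ (i, j) = G v $$ (i, j)"
    using assms(2) by eventually_elim simp
  from DERIV_cong_ev[OF refl this refl] has_mat_derivative_entry[OF assms(1) \<open>i < n\<close> \<open>j < n\<close>]
  show "((\<lambda>v. G v $$ (i, j)) has_real_derivative D $$ (i, j)) (at u)" by blast
qed

lemma has_mat_derivative_unique:
  assumes "has_mat_derivative n F D u" "has_mat_derivative n F E u"
  shows "D = E"
proof (rule eq_matI)
  note c = has_mat_derivative_carrier(1)[OF assms(1)] has_mat_derivative_carrier(1)[OF assms(2)]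
  show "dim_row D = dim_row E" "dim_col D = dim_col E" using c by auto
  fix i j assume "i < dim_row E" "j < dim_col E"
  then have ij: "i < n" "j < n" using c by auto
  show "D $$ (i, j) = E $$ (i, j)"
    by (rule DERIV_unique[OF has_mat_derivative_entry[OF assms(1) ij] has_mat_derivative_entry[OF assms(2) ij]])
qed

lemma has_mat_derivative_const: "A \<in> carrier_mat n n \<Longrightarrow> has_mat_derivative n (\<lambda>_. A) (0\<^sub>m n n) u"
  by (simp add: has_mat_derivative_def)

lemma has_mat_derivative_times:
  assumes F: "has_mat_derivative n F D u" and G: "has_mat_derivative n G E u"
  shows "has_mat_derivative n (\<lambda>v. F v * G v) (D * G u + F u * E) u"
  unfolding has_mat_derivative_def
proof (intro conjI allI impI)
  note cF = has_mat_derivative_carrier[OF F] and cG = has_mat_derivative_carrier[OF G]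
  show "\<forall>\<^sub>F v in nhds u. F v * G v \<in> carrier_mat n n"
    using cF(3) cG(3) by eventually_elim auto
  show "D * G u + F u * E \<in> carrier_mat n n" using cF cG by auto
  fix i j assume ij: "i < n" "j < n"
  have ev: "\<forall>\<^sub>F v in nhds u. (F v * G v) $$ (i, j) = (\<Sum>k<n. F v $$ (i, k) * G v $$ (k, j))"
    using cF(3) cG(3) by eventually_elim (rule times_mat_entry[OF _ _ ij])
  have "((\<lambda>v. \<Sum>k<n. F v $$ (i, k) * G v $$ (k, j)) has_real_derivative
      (\<Sum>k<n. D $$ (i, k) * G u $$ (k, j) + E $$ (k, j) * F u $$ (i, k))) (at u)"
    using ij by (intro DERIV_sum DERIV_mult has_mat_derivative_entry[OF F] has_mat_derivative_entry[OF G]) auto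
  moreover have "(\<Sum>k<n. D $$ (i, k) * G u $$ (k, j) + E $$ (k, j) * F u $$ (i, k)) = (D * G u + F u * E) $$ (i, j)"
  proof -
    have "(D * G u + F u * E) $$ (i, j) = (D * G u) $$ (i, j) + (F u * E) $$ (i, j)"
      using ij cF cG by (intro index_add_mat) auto
    also have "(D * G u) $$ (i, j) = (\<Sum>k<n. D $$ (i, k) * G u $$ (k, j))"
      by (rule times_mat_entry[OF cF(1) cG(2) ij])
    also have "(F u * E) $$ (i, j) = (\<Sum>k<n. F u $$ (i, k) * E $$ (k, j))"
      by (rule times_mat_entry[OF cF(2) cG(1) ij])
    finally show ?thesis by (simp add: sum.distrib mult.commute)
  qed
  ultimately show "((\<lambda>v. (F v * G v) $$ (i, j)) has_real_derivative (D * G u + F u * E) $$ (i, j)) (at u)"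
    using DERIV_cong_ev[OF refl ev refl] by auto
qed

lemma has_mat_derivative_uminus:
  assumes "has_mat_derivative n F D u"
  shows "has_mat_derivative n (\<lambda>v. - F v) (- D) u"
  unfolding has_mat_derivative_def
proof (intro conjI allI impI)
  note c = has_mat_derivative_carrier[OF assms]
  show "\<forall>\<^sub>F v in nhds u. - F v \<in> carrier_mat n n" using c(3) by eventually_elim auto
  show "- D \<in> carrier_mat n n" using c by auto
  fix i j assume ij: "i < n" "j < n"
  have ev: "\<forall>\<^sub>F v in nhds u. (- F v) $$ (i, j) = - (F v $$ (i, j))"
    using c(3) by eventually_elim (use ij in auto)
  have "((\<lambda>v. - (F v $$ (i, j))) has_real_derivative - (D $$ (i, j))) (at u)"
    by (intro DERIV_minus has_mat_derivative_entry[OF assms] ij)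
  then show "((\<lambda>v. (- F v) $$ (i, j)) has_real_derivative (- D) $$ (i, j)) (at u)"
    using DERIV_cong_ev[OF refl ev refl] c(1) ij by auto
qed

lemma det_has_derivative_Leibniz:
  assumes F: "has_mat_derivative n F D u"
  shows "((\<lambda>v. Determinant.det (F v)) has_real_derivative
    (\<Sum>p | p permutes {0..<n}. signof p * (\<Sum>i\<in>{0..<n}. D $$ (i, p i) * (\<Prod>k\<in>{0..<n}-{i}. F u $$ (k, p k))))) (at u)"
proof -
  have ev: "\<forall>\<^sub>F v in nhds u. Determinant.det (F v) = (\<Sum>p | p permutes {0..<n}. signof p * (\<Prod>i=0..<n. F v $$ (i, p i)))"
    using has_mat_derivative_carrier(3)[OF F] by eventually_elim (rule det_def')
  have "((\<lambda>v. \<Sum>p | p permutes {0..<n}. signof p * (\<Prod>i=0..<n. F v $$ (i, p i))) has_real_derivative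
    (\<Sum>p | p permutes {0..<n}. signof p * (\<Sum>i\<in>{0..<n}. D $$ (i, p i) * (\<Prod>k\<in>{0..<n}-{i}. F u $$ (k, p k))))) (at u)"
    by (intro DERIV_sum DERIV_cmult has_field_derivative_prod has_mat_derivative_entry[OF F])
       (auto simp: permutes_in_image)
  then show ?thesis using DERIV_cong_ev[OF refl ev refl] by auto
qed

text \<open>A permutation other than the identity moves at least two points. Differentiating one
  factor of its Leibniz product therefore leaves an off-diagonal entry of the identity matrix, and
  only the identity permutation contributes.\<close>

lemma det_has_derivative_at_one:
  assumes F: "has_mat_derivative n F D u" and one: "F u = 1\<^sub>m n"
  shows "((\<lambda>v. Determinant.det (F v)) has_real_derivative (\<Sum>i<n. D $$ (i, i))) (at u)"
proof -
  let ?t = "\<lambda>p. signof p * (\<Sum>i\<in>{0..<n}. D $$ (i, p i) * (\<Prod>k\<in>{0..<n}-{i}. F u $$ (k, p k)))"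
  have z: "?t p = 0" if p: "p permutes {0..<n}" "p \<noteq> id" for p
  proof -
    have "(\<Prod>k\<in>{0..<n}-{i}. F u $$ (k, p k)) = 0" if i: "i \<in> {0..<n}" for i
    proof -
      obtain k where k: "p k \<noteq> k" using p(2) by (auto simp: fun_eq_iff)
      then have kn: "k \<in> {0..<n}" using permutes_not_in[OF p(1)] by blast
      have "p (p k) \<noteq> p k" using k permutes_inj[OF p(1)] by (auto dest: injD)
      moreover have pn: "p l \<in> {0..<n} \<longleftrightarrow> l \<in> {0..<n}" for l by (rule permutes_in_image[OF p(1)])
      ultimately obtain l where l: "l \<in> {0..<n}-{i}" "p l \<noteq> l"
        using k kn by (cases "k = i") auto
      then have "F u $$ (l, p l) = 0" using pn[of l] by (auto simp: one)
      then show ?thesis using l by (intro prod_zero) auto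
    qed
    then show ?thesis by (simp del: prod_zero_iff)
  qed
  have "(\<Sum>p | p permutes {0..<n}. ?t p) = (\<Sum>p\<in>{id}. ?t p)"
  proof (rule sum.mono_neutral_right)
    show "finite {p. p permutes {0..<n}}" by (rule finite_permutations) simp
    show "{id} \<subseteq> {p. p permutes {0..<n}}" using permutes_id by simp
    show "\<forall>p\<in>{p. p permutes {0..<n}} - {id}. ?t p = 0" using z by (intro ballI) simp
  qed
  also have "\<dots> = (\<Sum>i<n. D $$ (i, i))"
    by (auto simp: one atLeast0LessThan intro!: sum.cong prod.neutral)
  finally show ?thesis using det_has_derivative_Leibniz[OF F] by simp
qed

text \<open>Multiplication by the constant inverse \<open>J\<close> of \<open>F u\<close> moves the
  base point to the identity matrix.\<close>

lemma Jacobi_formula: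
  assumes F: "has_mat_derivative n F D u" and J: "J \<in> carrier_mat n n" "J * F u = 1\<^sub>m n"
  shows "((\<lambda>v. Determinant.det (F v)) has_real_derivative
    Determinant.det (F u) * (\<Sum>i<n. (J * D) $$ (i, i))) (at u)"
proof -
  note c = has_mat_derivative_carrier[OF F]
  have JF: "has_mat_derivative n (\<lambda>v. J * F v) (J * D) u"
    using has_mat_derivative_times[OF has_mat_derivative_const[OF J(1), of u] F] J c by simp
  have dJ: "Determinant.det J * Determinant.det (F u) = 1"
    using det_mult[OF J(1) c(2)] J(2) by simp
  have ev: "\<forall>\<^sub>F v in nhds u. Determinant.det (F v) = Determinant.det (F u) * Determinant.det (J * F v)"
    using c(3)
  proof eventually_elim
    case (elim v)
    then show ?case using det_mult[OF J(1) elim] dJ by (simp add: mult.commute mult.left_commute)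
  qed
  have "((\<lambda>v. Determinant.det (F u) * Determinant.det (J * F v)) has_real_derivative
    Determinant.det (F u) * (\<Sum>i<n. (J * D) $$ (i, i))) (at u)"
    by (intro DERIV_cmult det_has_derivative_at_one[OF JF J(2)])
  then show ?thesis using DERIV_cong_ev[OF refl ev refl] by auto
qed

lemma eventually_det_nonzero:
  assumes F: "has_mat_derivative n F D u" and d: "Determinant.det (F u) \<noteq> 0"
  shows "\<forall>\<^sub>F v in nhds u. Determinant.det (F v) \<noteq> 0"
proof -
  have "isCont (\<lambda>v. Determinant.det (F v)) u"
    by (rule DERIV_isCont[OF det_has_derivative_Leibniz[OF F]])
  then have "((\<lambda>v. Determinant.det (F v)) \<longlongrightarrow> Determinant.det (F u)) (nhds u)"
    using tendsto_at_iff_tendsto_nhds[of "\<lambda>v. Determinant.det (F v)" u] by (simp add: isCont_def)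
  then show ?thesis by (rule tendsto_imp_eventually_ne[OF _ d])
qed

text \<open>Only existence is extracted here. The cofactor expression for the derivative would be
  unwieldy; its closed form comes next by differentiating
  \<open>inverse_mat (F v) * F v = 1\<close>.\<close>

lemma inverse_mat_differentiable:
  assumes F: "has_mat_derivative n F D u" and d: "Determinant.det (F u) \<noteq> 0"
  obtains E where "has_mat_derivative n (\<lambda>v. inverse_mat (F v)) E u"
proof -
  note c = has_mat_derivative_carrier[OF F]
  have det: "((\<lambda>v. Determinant.det (F v)) has_real_derivative
    (\<Sum>p | p permutes {0..<n}. signof p * (\<Sum>i\<in>{0..<n}. D $$ (i, p i) * (\<Prod>k\<in>{0..<n}-{i}. F u $$ (k, p k))))) (at u)"
    by (rule det_has_derivative_Leibniz[OF F])
  note ev = eventually_det_nonzero[OF F d]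
  have "\<exists>e. ((\<lambda>v. inverse_mat (F v) $$ (i, j)) has_real_derivative e) (at u)" if ij: "i < n" "j < n" for i j
  proof -
    have md: "has_mat_derivative (n - 1) (\<lambda>v. mat_delete (F v) j i) (mat_delete D j i) u"
      unfolding has_mat_derivative_def
    proof (intro conjI allI impI)
      show "\<forall>\<^sub>F v in nhds u. mat_delete (F v) j i \<in> carrier_mat (n - 1) (n - 1)"
        using c(3) by eventually_elim (rule mat_delete_carrier)
      show "mat_delete D j i \<in> carrier_mat (n - 1) (n - 1)" using c(1) by (rule mat_delete_carrier)
      fix k l assume kl: "k < n - 1" "l < n - 1"
      let ?k = "if k < j then k else Suc k" and ?l = "if l < i then l else Suc l"
      have e: "mat_delete A j i $$ (k, l) = A $$ (?k, ?l)" if "A \<in> carrier_mat n n" for A :: "real mat"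
        using that kl by (simp add: mat_delete_def)
      have ev: "\<forall>\<^sub>F v in nhds u. mat_delete (F v) j i $$ (k, l) = F v $$ (?k, ?l)"
        using c(3) by eventually_elim (rule e)
      have "((\<lambda>v. F v $$ (?k, ?l)) has_real_derivative D $$ (?k, ?l)) (at u)"
        using kl by (intro has_mat_derivative_entry[OF F]) auto
      then show "((\<lambda>v. mat_delete (F v) j i $$ (k, l)) has_real_derivative mat_delete D j i $$ (k, l)) (at u)"
        using DERIV_cong_ev[OF refl ev refl] e[OF c(1)] by auto
    qed
    have ev': "\<forall>\<^sub>F v in nhds u. inverse_mat (F v) $$ (i, j)
        = (- 1) ^ (j + i) * Determinant.det (mat_delete (F v) j i) / Determinant.det (F v)"
      using ev c(3) by eventually_elim (use ij in \<open>simp add: inverse_mat_entry cofactor_def\<close>)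
    note D = DERIV_divide[OF DERIV_cmult[OF det_has_derivative_Leibniz[OF md], of "(-1) ^ (j + i)"] det d]
    show ?thesis
      using D DERIV_cong_ev[OF refl ev' refl] by blast
  qed
  then obtain e where e: "\<And>i j. i < n \<Longrightarrow> j < n \<Longrightarrow> ((\<lambda>v. inverse_mat (F v) $$ (i, j)) has_real_derivative e i j) (at u)"
    by metis
  have "has_mat_derivative n (\<lambda>v. inverse_mat (F v)) (mat n n (\<lambda>(i, j). e i j)) u"
    unfolding has_mat_derivative_def
  proof (intro conjI allI impI)
    show "\<forall>\<^sub>F v in nhds u. inverse_mat (F v) \<in> carrier_mat n n"
      using ev c(3) by eventually_elim (rule inverse_mat_correct)
  qed (use e in auto)
  then show ?thesis by (rule that)
qed

lemma inverse_mat_has_derivative: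
  assumes F: "has_mat_derivative n F D u" and d: "Determinant.det (F u) \<noteq> 0"
  shows "has_mat_derivative n (\<lambda>v. inverse_mat (F v)) (- (inverse_mat (F u) * D * inverse_mat (F u))) u"
proof -
  note c = has_mat_derivative_carrier[OF F]
  let ?J = "inverse_mat (F u)"
  note J = inverse_mat_correct[OF c(2) d]
  obtain E where E: "has_mat_derivative n (\<lambda>v. inverse_mat (F v)) E u"
    using inverse_mat_differentiable[OF F d] .
  note cE = has_mat_derivative_carrier[OF E]
  note ev = eventually_det_nonzero[OF F d]
  have "\<forall>\<^sub>F v in nhds u. inverse_mat (F v) * F v = 1\<^sub>m n"
    using ev c(3) by eventually_elim (rule inverse_mat_correct)
  from has_mat_derivative_cong[OF has_mat_derivative_times[OF E F] this]
  have z: "E * F u + ?J * D = 0\<^sub>m n n"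
    using has_mat_derivative_unique has_mat_derivative_const[of "1\<^sub>m n" n u] by auto
  have "E = E * (F u * ?J)" using cE J by simp
  also have "\<dots> = (E * F u) * ?J" using cE c J by simp
  also have "E * F u = - (?J * D)"
  proof (rule eq_matI)
    fix i j assume "i < dim_row (- (?J * D))" "j < dim_col (- (?J * D))"
    then have ij: "i < n" "j < n" using c J by auto
    then have "(E * F u + ?J * D) $$ (i, j) = 0" using z by simp
    moreover have "(E * F u + ?J * D) $$ (i, j) = (E * F u) $$ (i, j) + (?J * D) $$ (i, j)"
      using ij c J cE by (intro index_add_mat) auto
    ultimately show "(E * F u) $$ (i, j) = (- (?J * D)) $$ (i, j)"
      using ij c J cE by (subst index_uminus_mat) auto
  qed (use c J cE in auto)
  also have "- (?J * D) * ?J = - (?J * D * ?J)"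
    using c J by (intro uminus_mult_left_mat) auto
  finally show ?thesis using E by simp
qed

subsection \<open>Kronecker products\<close>

lemma sum_div_mod:
  fixes f :: "nat \<Rightarrow> nat \<Rightarrow> 'a::comm_monoid_add"
  shows "(\<Sum>l<n * m. f (l div m) (l mod m)) = (\<Sum>p<n. \<Sum>q<m. f p q)"
proof (cases "m = 0")
  case False
  have "(\<Sum>p<n. \<Sum>q<m. f p q) = (\<Sum>(p, q)\<in>{..<n} \<times> {..<m}. f p q)"
    by (rule sum.cartesian_product)
  also have "\<dots> = (\<Sum>l<n * m. f (l div m) (l mod m))"
  proof (rule sum.reindex_bij_witness[of _ "\<lambda>l. (l div m, l mod m)" "\<lambda>(p, q). p * m + q"])
    fix x assume "x \<in> {..<n} \<times> {..<m}"
    then obtain p q where x: "x = (p, q)" "p < n" "q < m" by auto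
    have "p * m + q < Suc p * m" using x by simp
    also have "\<dots> \<le> n * m" using x by (intro mult_right_mono) auto
    finally show "(case x of (p, q) \<Rightarrow> p * m + q) \<in> {..<n * m}" using x by simp
  qed (use False in \<open>auto simp: less_mult_imp_div_less\<close>)
  finally show ?thesis by simp
qed simp

lemma kronecker_carrier [simp]:
  "A \<in> carrier_mat a b \<Longrightarrow> B \<in> carrier_mat c d \<Longrightarrow> kronecker A B \<in> carrier_mat (a * c) (b * d)"
  by (auto simp: kronecker_def)

lemma kronecker_entry:
  assumes "A \<in> carrier_mat n n" "B \<in> carrier_mat m m" "i < n * m" "j < n * m"
  shows "kronecker A B $$ (i, j) = A $$ (i div m, j div m) * B $$ (i mod m, j mod m)"
  using assms by (auto simp: kronecker_def)

lemma kronecker_times: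
  fixes A B C D :: "'a::comm_semiring_1 mat"
  assumes A: "A \<in> carrier_mat n n" and B: "B \<in> carrier_mat m m"
    and C: "C \<in> carrier_mat n n" and D: "D \<in> carrier_mat m m"
  shows "kronecker A B * kronecker C D = kronecker (A * C) (B * D)"
proof (rule eq_matI)
  have AC: "A * C \<in> carrier_mat n n" and BD: "B * D \<in> carrier_mat m m" using A B C D by auto
  fix i j assume "i < dim_row (kronecker (A * C) (B * D))" "j < dim_col (kronecker (A * C) (B * D))"
  then have ij: "i < n * m" "j < n * m" using A B C D by (auto simp: kronecker_def)
  then have m: "0 < m" by (cases m) auto
  have ij': "i div m < n" "j div m < n" "i mod m < m" "j mod m < m"
    using ij m by (auto simp: less_mult_imp_div_less)
  have "(kronecker A B * kronecker C D) $$ (i, j) = (\<Sum>l<n * m. kronecker A B $$ (i, l) * kronecker C D $$ (l, j))"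
    using A B C D ij by (intro times_mat_entry) auto
  also have "\<dots> = (\<Sum>l<n * m. (A $$ (i div m, l div m) * C $$ (l div m, j div m)) * (B $$ (i mod m, l mod m) * D $$ (l mod m, j mod m)))"
    using ij by (intro sum.cong refl) (simp add: kronecker_entry[OF A B] kronecker_entry[OF C D] mult_ac)
  also have "\<dots> = (\<Sum>p<n. A $$ (i div m, p) * C $$ (p, j div m)) * (\<Sum>q<m. B $$ (i mod m, q) * D $$ (q, j mod m))"
    by (subst sum_div_mod[where f = "\<lambda>p q. (A $$ (i div m, p) * C $$ (p, j div m)) * (B $$ (i mod m, q) * D $$ (q, j mod m))"])
       (simp add: sum_product)
  also have "\<dots> = kronecker (A * C) (B * D) $$ (i, j)"
    by (simp only: kronecker_entry[OF AC BD ij] times_mat_entry[OF A C ij'(1,2)] times_mat_entry[OF B D ij'(3,4)])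
  finally show "(kronecker A B * kronecker C D) $$ (i, j) = kronecker (A * C) (B * D) $$ (i, j)" .
qed (use A B C D in \<open>auto simp: kronecker_def\<close>)

text \<open>The sign of \<open>p\<close> enters once for the rows and once for the columns.\<close>

lemma det_permute_rows_cols:
  fixes A :: "'a::comm_ring_1 mat"
  assumes A: "A \<in> carrier_mat n n" and p: "p permutes {0..<n}"
  shows "Determinant.det (mat n n (\<lambda>(i, j). A $$ (p i, p j))) = Determinant.det A"
proof -
  have pn: "p i < n" if "i < n" for i using permutes_in_image[OF p, of i] that by simp
  define X where "X = mat n n (\<lambda>(i, j). A $$ (i, p j))"
  have X: "X \<in> carrier_mat n n" by (simp add: X_def)
  have "Determinant.det X = Determinant.det (transpose_mat X)" by (simp add: Determinant.det_transpose[OF X])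
  also have "transpose_mat X = mat n n (\<lambda>(i, j). transpose_mat A $$ (p i, j))"
    using A pn by (intro eq_matI) (auto simp: X_def)
  also have "Determinant.det \<dots> = signof p * Determinant.det A"
    using det_permute_rows[of "transpose_mat A" n p] p A by (simp add: Determinant.det_transpose[OF A])
  finally have dX: "Determinant.det X = signof p * Determinant.det A" .
  have "mat n n (\<lambda>(i, j). A $$ (p i, p j)) = mat n n (\<lambda>(i, j). X $$ (p i, j))"
    using pn by (intro eq_matI) (auto simp: X_def)
  then have "Determinant.det (mat n n (\<lambda>(i, j). A $$ (p i, p j))) = signof p * (signof p * Determinant.det A)"
    by (simp only: det_permute_rows[OF X p] dX)
  also have "\<dots> = Determinant.det A" by (simp add: sign_def)
  finally show ?thesis .
qed

text \<open>The matrix is block diagonal with \<open>n\<close> copies of \<open>B\<close>; the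
  induction splits off the upper left copy.\<close>

lemma det_kronecker_one_left:
  fixes B :: "'a::idom mat"
  assumes B: "B \<in> carrier_mat m m"
  shows "Determinant.det (kronecker (1\<^sub>m n) B) = Determinant.det B ^ n"
proof (induction n)
  case 0
  have "dim_row (kronecker (1\<^sub>m 0) B) = 0" "dim_col (kronecker (1\<^sub>m 0) B) = 0" by (auto simp: kronecker_def)
  then show ?case by (simp add: Determinant.det_def)
next
  case (Suc n)
  let ?K = "kronecker (1\<^sub>m n) B"
  have K: "?K \<in> carrier_mat (n * m) (n * m)" using B by simp
  have "kronecker (1\<^sub>m (Suc n)) B = four_block_mat B (0\<^sub>m m (n * m)) (0\<^sub>m (n * m) m) ?K"
  proof (rule eq_matI)
    fix i j assume "i < dim_row (four_block_mat B (0\<^sub>m m (n * m)) (0\<^sub>m (n * m) m) ?K)"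
      "j < dim_col (four_block_mat B (0\<^sub>m m (n * m)) (0\<^sub>m (n * m) m) ?K)"
    then have ij: "i < Suc n * m" "j < Suc n * m" using B K by auto
    then have m: "0 < m" by (cases m) auto
    have lt: "k div m < Suc n" if "k < Suc n * m" for k
      using that by (rule less_mult_imp_div_less)
    have sh: "k div m = Suc ((k - m) div m)" "k mod m = (k - m) mod m" if "\<not> k < m" for k
      using that m by (auto simp: le_div_geq le_mod_geq)
    have e: "kronecker (1\<^sub>m (Suc n)) B $$ (i, j) = (if i div m = j div m then B $$ (i mod m, j mod m) else 0)"
      using kronecker_entry[OF _ B ij, of "1\<^sub>m (Suc n)"] lt[OF ij(1)] lt[OF ij(2)] by simp
    have e': "?K $$ (i - m, j - m) = (if (i - m) div m = (j - m) div m then B $$ ((i - m) mod m, (j - m) mod m) else 0)"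
      if "\<not> i < m" "\<not> j < m"
    proof -
      have l: "i - m < n * m" "j - m < n * m" using ij that by auto
      show ?thesis
        using kronecker_entry[OF _ B l, of "1\<^sub>m n"] less_mult_imp_div_less[OF l(1)] less_mult_imp_div_less[OF l(2)] by simp
    qed
    show "kronecker (1\<^sub>m (Suc n)) B $$ (i, j) = four_block_mat B (0\<^sub>m m (n * m)) (0\<^sub>m (n * m) m) ?K $$ (i, j)"
    proof -
      have "four_block_mat B (0\<^sub>m m (n * m)) (0\<^sub>m (n * m) m) ?K $$ (i, j)
          = (if i < m then if j < m then B $$ (i, j) else 0 else if j < m then 0 else ?K $$ (i - m, j - m))"
        using ij B carrier_matD[OF K] by (subst index_mat_four_block) auto
      then show ?thesis using m by (cases "i < m"; cases "j < m") (simp_all add: e e' sh)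
    qed
  qed (use B K in \<open>auto simp: kronecker_def\<close>)
  then show ?case
    using det_four_block_mat_lower_left_zero[OF B, of "0\<^sub>m m (n * m)" "n * m" "0\<^sub>m (n * m) m" ?K] K Suc by simp
qed

text \<open>The index permutation exchanging the two digits turns \<open>A \<otimes> 1\<close> into \<open>1 \<otimes> A\<close>.\<close>

lemma det_kronecker_one_right:
  fixes A :: "'a::idom mat"
  assumes A: "A \<in> carrier_mat n n"
  shows "Determinant.det (kronecker A (1\<^sub>m m)) = Determinant.det A ^ m"
proof (cases "n = 0 \<or> m = 0")
  case True
  then have "dim_row (kronecker A (1\<^sub>m m)) = 0" "dim_col (kronecker A (1\<^sub>m m)) = 0" using A by (auto simp: kronecker_def)
  then have "Determinant.det (kronecker A (1\<^sub>m m)) = 1" by (simp add: Determinant.det_def)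
  moreover have "Determinant.det A = 1" if "n = 0" using A that by (simp add: Determinant.det_def)
  ultimately show ?thesis using True by auto
next
  case False
  then have pos: "0 < n" "0 < m" by auto
  define p where "p i = (if i < n * m then (i mod n) * m + i div n else i)" for i
  have dm: "i div n < m" "i mod n < n" if "i < n * m" for i
    using that pos by (auto simp: less_mult_imp_div_less mult.commute)
  have pdm: "p i div m = i mod n" "p i mod m = i div n" if "i < n * m" for i
    using that dm[OF that] by (auto simp: p_def)
  have plt: "p i < n * m" if "i < n * m" for i
  proof -
    have "p i < Suc (i mod n) * m" using dm[OF that] that by (simp add: p_def)
    also have "\<dots> \<le> n * m" using dm[OF that] by (intro mult_right_mono) auto
    finally show ?thesis .
  qed
  have "inj_on p {0..<n * m}"
  proof
    fix i j assume ij: "i \<in> {0..<n * m}" "j \<in> {0..<n * m}" "p i = p j"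
    then have "i div n = j div n" "i mod n = j mod n" using pdm[of i] pdm[of j] by auto
    then show "i = j" by (metis div_mult_mod_eq)
  qed
  moreover have "p ` {0..<n * m} \<subseteq> {0..<n * m}" using plt by auto
  ultimately have "bij_betw p {0..<n * m} {0..<n * m}"
    by (simp add: bij_betw_def endo_inj_surj)
  then have p: "p permutes {0..<n * m}" by (intro bij_imp_permutes) (auto simp: p_def)
  let ?K = "kronecker A (1\<^sub>m m)"
  have K: "?K \<in> carrier_mat (n * m) (n * m)" using A by simp
  have "kronecker (1\<^sub>m m) A = mat (n * m) (n * m) (\<lambda>(i, j). ?K $$ (p i, p j))"
  proof (rule eq_matI)
    fix i j assume "i < dim_row (mat (n * m) (n * m) (\<lambda>(i, j). ?K $$ (p i, p j)))"
      "j < dim_col (mat (n * m) (n * m) (\<lambda>(i, j). ?K $$ (p i, p j)))"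
    then have ij: "i < n * m" "j < n * m" by auto
    then have ij': "i < m * n" "j < m * n" by (auto simp: mult.commute)
    show "kronecker (1\<^sub>m m) A $$ (i, j) = mat (n * m) (n * m) (\<lambda>(i, j). ?K $$ (p i, p j)) $$ (i, j)"
      using ij dm[OF ij(1)] dm[OF ij(2)] kronecker_entry[OF _ A ij', of "1\<^sub>m m"]
        kronecker_entry[OF A _ plt[OF ij(1)] plt[OF ij(2)], of "1\<^sub>m m"] pdm[OF ij(1)] pdm[OF ij(2)]
      by simp
  qed (use A in \<open>auto simp: kronecker_def mult.commute\<close>)
  then have "Determinant.det (kronecker (1\<^sub>m m) A) = Determinant.det ?K"
    by (simp only: det_permute_rows_cols[OF K p])
  then show ?thesis using det_kronecker_one_left[OF A] by simp
qed

lemma det_kronecker: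
  fixes A B :: "'a::idom mat"
  assumes A: "A \<in> carrier_mat n n" and B: "B \<in> carrier_mat m m"
  shows "Determinant.det (kronecker A B) = Determinant.det A ^ m * Determinant.det B ^ n"
proof -
  have "kronecker A B = kronecker A (1\<^sub>m m) * kronecker (1\<^sub>m n) B"
    using kronecker_times[OF A one_carrier_mat one_carrier_mat B] A B by simp
  moreover have "kronecker A (1\<^sub>m m) \<in> carrier_mat (n * m) (n * m)" "kronecker (1\<^sub>m n) B \<in> carrier_mat (n * m) (n * m)"
    using A B by auto
  ultimately have "Determinant.det (kronecker A B) = Determinant.det (kronecker A (1\<^sub>m m)) * Determinant.det (kronecker (1\<^sub>m n) B)"
    using det_mult by metis
  then show ?thesis
    by (simp add: det_kronecker_one_left[OF B] det_kronecker_one_right[OF A])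
qed

section \<open>Base-n digits as multi-indices for iterated Kronecker products\<close>

definition digit :: "nat \<Rightarrow> nat \<Rightarrow> nat \<Rightarrow> nat \<Rightarrow> nat" where
  "digit n d t I = I div n ^ (d - t) mod n"

lemma digit_less: "0 < n \<Longrightarrow> digit n d t I < n"
  by (simp add: digit_def)

text \<open>Digit 1 is the most significant one, in accordance with the lexicographic order of the
  observations. An index below \<open>n ^ Suc m\<close> has digit \<open>d - m\<close> on top, so
  its quotient needs no reduction modulo \<open>n\<close>.\<close>

lemma digit_leading:
  assumes "I < n ^ Suc m" "m < d"
  shows "digit n d (d - m) I = I div n ^ m"
proof -
  have "I div n ^ m < n" using assms by (intro less_mult_imp_div_less) simp
  then show ?thesis using assms by (simp add: digit_def)
qed

lemma digit_mod:
  assumes "d - m < t" "t \<le> d" "m < d"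
  shows "digit n d t (I mod n ^ m) = digit n d t I"
proof -
  have "0 < m" "m = (d - t) + Suc (m - Suc (d - t))" using assms by simp_all
  then have "n ^ m = n ^ (d - t) * (n * n ^ (m - Suc (d - t)))" by (metis power_add power_Suc)
  with \<open>0 < m\<close> have "I mod n ^ m div n ^ (d - t) = I div n ^ (d - t) mod (n * n ^ (m - Suc (d - t)))"
    by (cases "n = 0") (auto simp: mod_mult2_eq zero_power)
  then show ?thesis by (simp add: digit_def mod_mod_cancel)
qed

lemma atLeastAtMost_digits: "m < d \<Longrightarrow> {Suc d - Suc m..d} = insert (d - m) {Suc d - m..d}"
  by auto

text \<open>The distributive law over multi-indices, the source of every factorisation into
  one-dimensional traces. The induction runs over the last \<open>m\<close> digits because
  \<open>kronecker_list\<close> folds from the right and prepends the leading factor.\<close>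

lemma sum_prod_digits_upto:
  fixes f :: "nat \<Rightarrow> nat \<Rightarrow> 'a::comm_semiring_1"
  assumes "m \<le> d"
  shows "(\<Sum>I<n ^ m. \<Prod>t\<in>{Suc d - m..d}. f t (digit n d t I)) = (\<Prod>t\<in>{Suc d - m..d}. \<Sum>i<n. f t i)"
  using assms
proof (induction m)
  case (Suc m)
  then have m: "m < d" by simp
  let ?T = "{Suc d - m..d}"
  have "(\<Sum>I<n ^ Suc m. \<Prod>t\<in>{Suc d - Suc m..d}. f t (digit n d t I))
      = (\<Sum>I<n * n ^ m. f (d - m) (I div n ^ m) * (\<Prod>t\<in>?T. f t (digit n d t (I mod n ^ m))))"
    unfolding atLeastAtMost_digits[OF m] power_Suc
  proof (intro sum.cong refl)
    fix I assume "I \<in> {..<n * n ^ m}"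
    then have I: "I < n ^ Suc m" by simp
    show "(\<Prod>t\<in>insert (d - m) ?T. f t (digit n d t I)) = f (d - m) (I div n ^ m) * (\<Prod>t\<in>?T. f t (digit n d t (I mod n ^ m)))"
      using m digit_leading[OF I m] by (subst prod.insert) (auto simp: digit_mod intro!: prod.cong arg_cong2[where f = "(*)"])
  qed
  also have "\<dots> = (\<Sum>i<n. \<Sum>r<n ^ m. f (d - m) i * (\<Prod>t\<in>?T. f t (digit n d t r)))"
    by (rule sum_div_mod)
  also have "\<dots> = (\<Sum>i<n. f (d - m) i) * (\<Sum>r<n ^ m. \<Prod>t\<in>?T. f t (digit n d t r))"
    by (simp add: sum_product)
  also have "\<dots> = (\<Sum>i<n. f (d - m) i) * (\<Prod>t\<in>?T. \<Sum>i<n. f t i)"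
    using Suc by simp
  also have "\<dots> = (\<Prod>t\<in>{Suc d - Suc m..d}. \<Sum>i<n. f t i)"
    unfolding atLeastAtMost_digits[OF m] using m by (subst prod.insert) auto
  finally show ?case .
qed simp

lemma sum_prod_digits:
  fixes f :: "nat \<Rightarrow> nat \<Rightarrow> 'a::comm_semiring_1"
  shows "(\<Sum>I<n ^ d. \<Prod>t\<in>{1..d}. f t (digit n d t I)) = (\<Prod>t\<in>{1..d}. \<Sum>i<n. f t i)"
  using sum_prod_digits_upto[of d d f n] by simp

lemma digits_inject:
  assumes "I < n ^ d" "J < n ^ d" "\<And>t. t \<in> {1..d} \<Longrightarrow> digit n d t I = digit n d t J"
  shows "I = J"
proof -
  have "I = J" if "m \<le> d" "I < n ^ m" "J < n ^ m" "\<And>t. t \<in> {Suc d - m..d} \<Longrightarrow> digit n d t I = digit n d t J" for m I J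
    using that
  proof (induction m arbitrary: I J)
    case (Suc m)
    then have m: "m < d" by simp
    have n: "0 < n ^ m" using Suc.prems(2) by (cases "n = 0") auto
    have dig: "digit n d t I = digit n d t J" if "t \<in> insert (d - m) {Suc d - m..d}" for t
      using Suc.prems(4) that unfolding atLeastAtMost_digits[OF m] by blast
    have "I div n ^ m = J div n ^ m"
      using dig[of "d - m"] digit_leading[OF Suc.prems(2) m] digit_leading[OF Suc.prems(3) m] by simp
    moreover have "I mod n ^ m = J mod n ^ m"
    proof (rule Suc.IH)
      fix t assume t: "t \<in> {Suc d - m..d}"
      then have "d - m < t" "t \<le> d" using m by auto
      then show "digit n d t (I mod n ^ m) = digit n d t (J mod n ^ m)"
        using dig[of t] t by (simp add: digit_mod[OF _ _ m])
    qed (use m n in auto)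
    ultimately show ?case by (metis div_mult_mod_eq)
  qed simp
  from this[of d] assms show ?thesis by simp
qed

lemma kronecker_list_digits_upto:
  fixes A :: "nat \<Rightarrow> 'a::comm_semiring_1 mat"
  assumes A: "\<And>t. A t \<in> carrier_mat n n" and "m \<le> d"
  shows "kronecker_list (map A [Suc d - m..<Suc d]) \<in> carrier_mat (n ^ m) (n ^ m)"
    and "I < n ^ m \<Longrightarrow> J < n ^ m \<Longrightarrow> kronecker_list (map A [Suc d - m..<Suc d]) $$ (I, J)
      = (\<Prod>t\<in>{Suc d - m..d}. A t $$ (digit n d t I, digit n d t J))"
proof -
  let ?K = "\<lambda>m. kronecker_list (map A [Suc d - m..<Suc d])"
  have "?K m \<in> carrier_mat (n ^ m) (n ^ m) \<and> (\<forall>I J. I < n ^ m \<longrightarrow> J < n ^ m \<longrightarrow>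
    ?K m $$ (I, J) = (\<Prod>t\<in>{Suc d - m..d}. A t $$ (digit n d t I, digit n d t J)))"
    using \<open>m \<le> d\<close>
  proof (induction m)
    case 0
    then show ?case by (simp add: kronecker_list_def)
  next
    case (Suc m)
    then have m: "m < d" and IH: "?K m \<in> carrier_mat (n ^ m) (n ^ m)"
      "\<And>I J. I < n ^ m \<Longrightarrow> J < n ^ m \<Longrightarrow> ?K m $$ (I, J) = (\<Prod>t\<in>{Suc d - m..d}. A t $$ (digit n d t I, digit n d t J))"
      by auto
    have "[Suc d - Suc m..<Suc d] = (d - m) # [Suc d - m..<Suc d]"
      using m by (subst upt_rec) (auto simp: Suc_diff_le)
    then have K: "?K (Suc m) = kronecker (A (d - m)) (?K m)"
      by (simp add: kronecker_list_def)
    have "?K (Suc m) $$ (I, J) = (\<Prod>t\<in>{Suc d - Suc m..d}. A t $$ (digit n d t I, digit n d t J))"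
      if I: "I < n ^ Suc m" and J: "J < n ^ Suc m" for I J
    proof -
      have IJ: "I < n * n ^ m" "J < n * n ^ m" using I J by auto
      have "0 < n ^ m" using IJ by (cases "n ^ m") auto
      then have r: "I mod n ^ m < n ^ m" "J mod n ^ m < n ^ m" by auto
      show ?thesis
        unfolding K kronecker_entry[OF A IH(1) IJ] IH(2)[OF r] atLeastAtMost_digits[OF m]
        using m digit_leading[OF I m] digit_leading[OF J m]
        by (subst prod.insert) (auto simp: digit_mod intro!: prod.cong arg_cong2[where f = "(*)"])
    qed
    moreover have "?K (Suc m) \<in> carrier_mat (n ^ Suc m) (n ^ Suc m)"
      unfolding K using kronecker_carrier[OF A IH(1)] by simp
    ultimately show ?case by blast
  qed
  then show "?K m \<in> carrier_mat (n ^ m) (n ^ m)"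
    and "I < n ^ m \<Longrightarrow> J < n ^ m \<Longrightarrow> ?K m $$ (I, J) = (\<Prod>t\<in>{Suc d - m..d}. A t $$ (digit n d t I, digit n d t J))"
    by blast+
qed

lemma kronecker_list_carrier:
  fixes A :: "nat \<Rightarrow> 'a::comm_semiring_1 mat"
  assumes "\<And>t. A t \<in> carrier_mat n n"
  shows "kronecker_list (map A [1..<Suc d]) \<in> carrier_mat (n ^ d) (n ^ d)"
  using kronecker_list_digits_upto(1)[of A n d d] assms by (simp del: upt_Suc)

lemma kronecker_list_entry:
  fixes A :: "nat \<Rightarrow> 'a::comm_semiring_1 mat"
  assumes "\<And>t. A t \<in> carrier_mat n n" "I < n ^ d" "J < n ^ d"
  shows "kronecker_list (map A [1..<Suc d]) $$ (I, J) = (\<Prod>t\<in>{1..d}. A t $$ (digit n d t I, digit n d t J))"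
  using kronecker_list_digits_upto(2)[of A n d d I J] assms by (simp del: upt_Suc)

lemma det_kronecker_list:
  fixes A :: "nat \<Rightarrow> 'a::idom mat"
  assumes A: "\<And>t. A t \<in> carrier_mat n n"
  shows "Determinant.det (kronecker_list (map A [1..<Suc d])) = (\<Prod>t\<in>{1..d}. Determinant.det (A t) ^ n ^ (d - 1))"
proof -
  have "Determinant.det (kronecker_list (map A [Suc d - m..<Suc d])) = (\<Prod>t\<in>{Suc d - m..d}. Determinant.det (A t) ^ n ^ (m - 1))"
    if "m \<le> d" for m
    using that
  proof (induction m)
    case 0
    then show ?case by (simp add: kronecker_list_def)
  next
    case (Suc m)
    then have m: "m < d" by simp
    have l: "[Suc d - Suc m..<Suc d] = (d - m) # [Suc d - m..<Suc d]"
      using m by (subst upt_rec) (auto simp: Suc_diff_le)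
    let ?K = "kronecker_list (map A [Suc d - m..<Suc d])"
    have K: "?K \<in> carrier_mat (n ^ m) (n ^ m)" using kronecker_list_digits_upto(1)[OF A] m by simp
    have "Determinant.det (kronecker_list (map A [Suc d - Suc m..<Suc d])) = Determinant.det (A (d - m)) ^ n ^ m * Determinant.det ?K ^ n"
      unfolding l using det_kronecker[OF A K] by (simp add: kronecker_list_def)
    also have "Determinant.det ?K ^ n = (\<Prod>t\<in>{Suc d - m..d}. (Determinant.det (A t) ^ n ^ (m - 1)) ^ n)"
      using Suc by (simp add: prod_power_distrib)
    also have "\<dots> = (\<Prod>t\<in>{Suc d - m..d}. Determinant.det (A t) ^ n ^ m)"
    proof (intro prod.cong refl)
      fix t assume "t \<in> {Suc d - m..d}"
      \<comment> \<open>The range of the product is empty for \<open>m = 0\<close>, so the truncated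
        difference \<open>m - 1\<close> is never evaluated there.\<close>
      then have "m \<noteq> 0" by (cases m) auto
      then show "(Determinant.det (A t) ^ n ^ (m - 1)) ^ n = Determinant.det (A t) ^ n ^ m"
        by (cases m) (auto simp: power_mult[symmetric] mult.commute)
    qed
    also have "Determinant.det (A (d - m)) ^ n ^ m * \<dots> = (\<Prod>t\<in>{Suc d - Suc m..d}. Determinant.det (A t) ^ n ^ m)"
      unfolding atLeastAtMost_digits[OF m] using m by (subst prod.insert) auto
    finally show ?case by simp
  qed
  from this[of d] show ?thesis by (simp del: upt_Suc)
qed

subsection \<open>Traces for the one-dimensional covariance matrices\<close>

definition cov_mat :: "nat \<Rightarrow> (nat \<Rightarrow> real) \<Rightarrow> real mat" where
  "cov_mat n s = mat n n (\<lambda>(i, j). s (ndist i j))"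

definition whiten_mat :: "real \<Rightarrow> nat \<Rightarrow> real mat" where
  "whiten_mat h n = mat n n (\<lambda>(i, k). if k = i then 1
     else if i = 1 then (if k = 0 then - (1 + h) * exp (- h) else 0)
     else if Suc k = i then - 2 * exp (- h) else if Suc (Suc k) = i then exp (- h) ^ 2 else 0)"

lemma cov_mat_carrier [simp]: "cov_mat n s \<in> carrier_mat n n"
  by (simp add: cov_mat_def)

lemma whiten_mat_carrier [simp]: "whiten_mat h n \<in> carrier_mat n n"
  by (simp add: whiten_mat_def)

lemma det_whiten_mat: "Determinant.det (whiten_mat h n) = 1"
proof -
  have "Determinant.det (whiten_mat h n) = prod_list (diag_mat (whiten_mat h n))"
    by (rule det_lower_triangular[of n]) (auto simp: whiten_mat_def)
  also have "\<dots> = 1"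
    unfolding prod_list_diag_prod by (rule prod.neutral) (auto simp: whiten_mat_def)
  finally show ?thesis .
qed

lemma sum_whiten_mat:
  assumes "i < n"
  shows "(\<Sum>k<n. whiten_mat h n $$ (i, k) * f k) = whiten h f i"
proof -
  have s: "(\<Sum>k<n. whiten_mat h n $$ (i, k) * f k) = (\<Sum>k<Suc i. whiten_mat h n $$ (i, k) * f k)"
    using assms by (intro sum.mono_neutral_right) (auto simp: whiten_mat_def)
  consider "i = 0" | "i = 1" | m where "i = Suc (Suc m)" by (metis One_nat_def not0_implies_Suc)
  then show ?thesis
  proof cases
    case 3
    have "(\<Sum>k<m. whiten_mat h n $$ (i, k) * f k) = 0"
      using 3 assms by (intro sum.neutral) (auto simp: whiten_mat_def)
    then show ?thesis
      unfolding s using 3 assms by (simp add: whiten_mat_def whiten_def)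
  qed (use assms s in \<open>auto simp: whiten_mat_def whiten_def algebra_simps\<close>)
qed

lemma whiten_cov_mat:
  assumes ij: "i < n" "j < n"
  shows "(whiten_mat h n * cov_mat n s * transpose_mat (whiten_mat h n)) $$ (i, j) = whiten2 h s i j"
proof -
  let ?W = "whiten_mat h n"
  have c: "?W * cov_mat n s \<in> carrier_mat n n" "transpose_mat ?W \<in> carrier_mat n n"
    by (auto intro: mult_carrier_mat[OF whiten_mat_carrier cov_mat_carrier])
  have "(?W * cov_mat n s * transpose_mat ?W) $$ (i, j) = (\<Sum>l<n. (?W * cov_mat n s) $$ (i, l) * ?W $$ (j, l))"
    using ij by (subst times_mat_entry[OF c ij]) (auto intro!: sum.cong simp: whiten_mat_def)
  also have "\<dots> = (\<Sum>l<n. (\<Sum>k<n. ?W $$ (i, k) * s (ndist k l)) * ?W $$ (j, l))"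
    using ij by (intro sum.cong refl) (subst times_mat_entry, auto simp: cov_mat_def)
  also have "\<dots> = (\<Sum>l<n. \<Sum>k<n. ?W $$ (j, l) * (?W $$ (i, k) * s (ndist k l)))"
    by (simp add: sum_distrib_left mult.commute)
  also have "\<dots> = (\<Sum>k<n. \<Sum>l<n. ?W $$ (j, l) * (?W $$ (i, k) * s (ndist k l)))"
    by (rule sum.swap)
  also have "\<dots> = (\<Sum>k<n. ?W $$ (i, k) * (\<Sum>l<n. ?W $$ (j, l) * s (ndist k l)))"
    by (simp add: sum_distrib_left mult_ac)
  also have "\<dots> = whiten2 h s i j"
    by (simp add: sum_whiten_mat ij whiten2_def)
  finally show ?thesis .
qed

text \<open>The exact inequalities between the coefficients give dominance for every
  \<open>h > 0\<close>, with a margin that may depend on \<open>h\<close>; the uniform margin of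
  \<open>norm_cov_dominant\<close> is available on fine grids only.\<close>

lemma whiten2_cov_dominant:
  assumes k: "k < n" and h: "0 < h"
  shows "(\<Sum>i\<in>{..<n}-{k}. \<bar>whiten2 h (cov_seq h) i k\<bar>) < whiten2 h (cov_seq h) k k"
proof -
  let ?T = "whiten2 h (cov_seq h)"
  have z: "?T i k = 0" if "i + 2 \<le> k \<or> k + 2 \<le> i" for i
    using that whiten2_cov_far[of i k h] whiten2_cov_far[of k i h] whiten2_commute[of h "cov_seq h" i k] by auto
  have "(\<Sum>i\<in>{..<n}-{k}. \<bar>?T i k\<bar>) = (\<Sum>i<n. if i = k then 0 else \<bar>?T i k\<bar>)"
    by (intro sum.mono_neutral_cong_left) auto
  also have "\<dots> = (if k = 0 then 0 else \<bar>?T (k - 1) k\<bar>) + (if Suc k < n then \<bar>?T (Suc k) k\<bar> else 0)"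
    using k z by (subst tridiagonal_sum[OF k]) auto
  finally have s: "(\<Sum>i\<in>{..<n}-{k}. \<bar>?T i k\<bar>) \<le> (if k = 0 then 0 else \<bar>?T (k - 1) k\<bar>) + \<bar>?T (Suc k) k\<bar>"
    by auto
  note p = innov_cov_pos[OF h] innov_var_gt[OF h] start_var_gt[OF h]
  consider "k = 0" | "k = 1" | m where "k = Suc (Suc m)"
    by (metis One_nat_def not0_implies_Suc)
  then show ?thesis
  proof cases
    case 1
    then show ?thesis using s by (simp add: whiten2_cov_start whiten2_commute[of h _ "Suc 0" 0])
  next
    case 2
    have "?T (Suc k) k = innov_cov h" "?T (k - 1) k = 0" "?T k k = start_var h"
      using 2 by (simp_all add: whiten2_cov_start whiten2_commute[of h _ "Suc (Suc 0)" "Suc 0"] whiten2_cov_adj)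
    then show ?thesis using s 2 p by simp
  next
    case 3
    have "?T (Suc k) k = innov_cov h" "?T (k - 1) k = innov_cov h" "?T k k = innov_var h"
      using 3 by (simp_all add: whiten2_cov_diag whiten2_commute[of h _ "Suc (Suc (Suc m))"] whiten2_cov_adj)
    then show ?thesis using s 3 p by simp
  qed
qed

text \<open>Congruence with a unit triangular matrix preserves the determinant, and the whitened
  matrix is strictly column dominant.\<close>

lemma det_cov_mat_pos:
  assumes h: "0 < h"
  shows "0 < Determinant.det (cov_mat n (cov_seq h))"
proof -
  let ?W = "whiten_mat h n" and ?R = "cov_mat n (cov_seq h)"
  have c: "?W * ?R \<in> carrier_mat n n" "transpose_mat ?W \<in> carrier_mat n n"
    by (auto intro: mult_carrier_mat[OF whiten_mat_carrier cov_mat_carrier])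
  have "0 < Determinant.det (?W * ?R * transpose_mat ?W)"
  proof (rule det_column_dominant_pos[of _ n])
    show "?W * ?R * transpose_mat ?W \<in> carrier_mat n n" by (rule mult_carrier_mat[OF c])
    fix k assume k: "k < n"
    have "(\<Sum>i\<in>{..<n}-{k}. \<bar>(?W * ?R * transpose_mat ?W) $$ (i, k)\<bar>) = (\<Sum>i\<in>{..<n}-{k}. \<bar>whiten2 h (cov_seq h) i k\<bar>)"
      using k by (intro sum.cong refl) (simp add: whiten_cov_mat del: index_mult_mat)
    then show "(\<Sum>i\<in>{..<n}-{k}. \<bar>(?W * ?R * transpose_mat ?W) $$ (i, k)\<bar>) < (?W * ?R * transpose_mat ?W) $$ (k, k)"
      using whiten2_cov_dominant[OF k h] by (simp only: whiten_cov_mat[OF k k])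
  qed
  also have "Determinant.det (?W * ?R * transpose_mat ?W) = Determinant.det ?R"
    by (simp add: det_mult[OF c] det_mult[of ?W n ?R] Determinant.det_transpose[of ?W n] det_whiten_mat)
  finally show ?thesis .
qed

lemma smult_smult_mat:
  fixes A :: "'a::comm_semiring_1 mat"
  shows "a \<cdot>\<^sub>m (b \<cdot>\<^sub>m A) = (a * b) \<cdot>\<^sub>m A" "1 \<cdot>\<^sub>m A = A"
  by (rule eq_matI; simp add: mult.assoc)+

lemma trace_times_commute:
  fixes A B :: "real mat"
  assumes "A \<in> carrier_mat n n" "B \<in> carrier_mat n n"
  shows "(\<Sum>i<n. (A * B) $$ (i, i)) = (\<Sum>i<n. (B * A) $$ (i, i))"
proof -
  have "(\<Sum>i<n. (A * B) $$ (i, i)) = (\<Sum>i<n. \<Sum>k<n. A $$ (i, k) * B $$ (k, i))"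
    using assms by (intro sum.cong refl times_mat_entry) auto
  also have "\<dots> = (\<Sum>k<n. \<Sum>i<n. A $$ (i, k) * B $$ (k, i))" by (rule sum.swap)
  also have "\<dots> = (\<Sum>k<n. (B * A) $$ (k, k))"
    using assms by (intro sum.cong refl) (subst times_mat_entry[of B n n A n], auto simp: mult.commute)
  finally show ?thesis .
qed

lemma (in fine_grid) trace_bounds_mat:
  assumes G: "G \<in> carrier_mat n n" and eq: "cov_mat n (cov_seq h) * G = cov_mat n (dcov_seq h)"
  shows "\<bar>(\<Sum>i<n. G $$ (i, i)) - (- 4 - 2 * (n * h))\<bar> \<le> h * (4 + 2 * C * (n * h + 32))"
    and "\<bar>(\<Sum>i<n. (G * G) $$ (i, i)) - (10 + 4 * (n * h))\<bar>
      \<le> h * (16 * C * (n * h) + 8 + (2 * (5 + 2 * (n * h)) + 2 * C * (n * h + 32)) * (2 * C * (n * h + 32)))"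
proof -
  let ?W = "whiten_mat h n" and ?R = "cov_mat n (cov_seq h)" and ?V = "cov_mat n (dcov_seq h)"
  let ?Wt = "transpose_mat ?W"
  have Wt: "?Wt \<in> carrier_mat n n" by auto
  have "Determinant.det ?Wt \<noteq> 0" by (simp add: Determinant.det_transpose[of ?W n] det_whiten_mat)
  note X = inverse_mat_correct[OF Wt this]
  let ?X = "inverse_mat ?Wt"
  \<comment> \<open>Applying the same congruence to both covariance matrices conjugates their
    quotient \<open>G\<close> by the transposed whitening, so the traces of \<open>G\<close> and
    \<open>G * G\<close> are unchanged.\<close>
  define \<Gamma> where "\<Gamma> = ?X * G * ?Wt"
  have c: "\<Gamma> \<in> carrier_mat n n" "?W * ?R * ?Wt \<in> carrier_mat n n" "?W * ?R \<in> carrier_mat n n" "?X * G \<in> carrier_mat n n"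
    "G * ?Wt \<in> carrier_mat n n" "G * G \<in> carrier_mat n n" "?X * (G * G) \<in> carrier_mat n n"
    unfolding \<Gamma>_def using X(1) G Wt whiten_mat_carrier cov_mat_carrier by (blast intro: mult_carrier_mat)+
  have \<Gamma>': "\<Gamma> = ?X * (G * ?Wt)" unfolding \<Gamma>_def by (rule assoc_mult_mat[OF X(1) G Wt])
  have "(?W * ?R * ?Wt) * \<Gamma> = (?W * ?R) * (?Wt * \<Gamma>)"
    by (rule assoc_mult_mat[OF c(3) Wt c(1)])
  also have "?Wt * \<Gamma> = (?Wt * ?X) * (G * ?Wt)"
    unfolding \<Gamma>' by (rule assoc_mult_mat[OF Wt X(1) c(5), symmetric])
  also have "\<dots> = G * ?Wt" by (simp only: X(3) left_mult_one_mat[OF c(5)])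
  also have "(?W * ?R) * (G * ?Wt) = ?W * ?R * G * ?Wt"
    by (rule assoc_mult_mat[OF c(3) G Wt, symmetric])
  also have "?W * ?R * G = ?W * ?V"
    using assoc_mult_mat[OF whiten_mat_carrier cov_mat_carrier G] eq by simp
  finally have e: "(?W * ?R * ?Wt) * \<Gamma> = ?W * ?V * ?Wt" .
  have "(\<Sum>k<n. whiten2 h (cov_seq h) i k * \<Gamma> $$ (k, j)) = whiten2 h (dcov_seq h) i j" if ij: "i < n" "j < n" for i j
  proof -
    have "(\<Sum>k<n. whiten2 h (cov_seq h) i k * \<Gamma> $$ (k, j)) = (\<Sum>k<n. (?W * ?R * ?Wt) $$ (i, k) * \<Gamma> $$ (k, j))"
      using ij by (intro sum.cong refl) (simp add: whiten_cov_mat del: index_mult_mat)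
    also have "\<dots> = ((?W * ?R * ?Wt) * \<Gamma>) $$ (i, j)"
      by (rule times_mat_entry[OF c(2,1) ij, symmetric])
    finally show ?thesis by (simp only: e whiten_cov_mat[OF ij])
  qed
  note b = trace_bounds[of "\<lambda>i j. \<Gamma> $$ (i, j)", OF this]
  have "(\<Sum>i<n. \<Gamma> $$ (i, i)) = (\<Sum>i<n. ((G * ?Wt) * ?X) $$ (i, i))"
    unfolding \<Gamma>' by (rule trace_times_commute[OF X(1) c(5)])
  also have "(G * ?Wt) * ?X = G"
    by (simp only: assoc_mult_mat[OF G Wt X(1)] X(3) right_mult_one_mat[OF G])
  finally show "\<bar>(\<Sum>i<n. G $$ (i, i)) - (- 4 - 2 * (n * h))\<bar> \<le> h * (4 + 2 * C * (n * h + 32))"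
    using b(1) by simp
  have "(\<Sum>i<n. \<Sum>j<n. \<Gamma> $$ (i, j) * \<Gamma> $$ (j, i)) = (\<Sum>i<n. (\<Gamma> * \<Gamma>) $$ (i, i))"
    by (intro sum.cong refl times_mat_entry[OF c(1) c(1), symmetric]) auto
  also have "\<Gamma> * \<Gamma> = ?X * (G * G) * ?Wt"
  proof -
    have "\<Gamma> * \<Gamma> = (?X * G) * (?Wt * \<Gamma>)"
      unfolding \<Gamma>_def[THEN arg_cong[of _ _ "\<lambda>x. x * \<Gamma>"]] by (rule assoc_mult_mat[OF c(4) Wt c(1)])
    also have "?Wt * \<Gamma> = (?Wt * ?X) * (G * ?Wt)"
      unfolding \<Gamma>' by (rule assoc_mult_mat[OF Wt X(1) c(5), symmetric])
    also have "\<dots> = G * ?Wt" by (simp only: X(3) left_mult_one_mat[OF c(5)])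
    also have "(?X * G) * (G * ?Wt) = ?X * G * G * ?Wt"
      by (rule assoc_mult_mat[OF c(4) G Wt, symmetric])
    also have "?X * G * G = ?X * (G * G)" by (rule assoc_mult_mat[OF X(1) G G])
    finally show ?thesis .
  qed
  also have "?X * (G * G) * ?Wt = ?X * ((G * G) * ?Wt)" by (rule assoc_mult_mat[OF X(1) c(6) Wt])
  also have "(\<Sum>i<n. (?X * ((G * G) * ?Wt)) $$ (i, i)) = (\<Sum>i<n. (((G * G) * ?Wt) * ?X) $$ (i, i))"
    by (rule trace_times_commute[OF X(1)]) (use c Wt in auto)
  also have "((G * G) * ?Wt) * ?X = G * G"
    by (simp only: assoc_mult_mat[OF c(6) Wt X(1)] X(3) right_mult_one_mat[OF c(6)])
  finally show "\<bar>(\<Sum>i<n. (G * G) $$ (i, i)) - (10 + 4 * (n * h))\<bar>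
      \<le> h * (16 * C * (n * h) + 8 + (2 * (5 + 2 * (n * h)) + 2 * C * (n * h + 32)) * (2 * C * (n * h + 32)))"
    using b(2) by simp
qed

section \<open>The scaled Matern matrix and its logarithmic derivative\<close>

definition matern_mat :: "nat \<Rightarrow> real \<Rightarrow> real mat" where
  "matern_mat n u = (1 / u ^ 3) \<cdot>\<^sub>m R_mat u n"

definition matern_mat' :: "nat \<Rightarrow> real \<Rightarrow> real mat" where
  "matern_mat' n u = mat n n (\<lambda>(i, j). let r = \<bar>real i - real j\<bar> / real n in
     - (3 * (1 + u * r) / u ^ 4 + r\<^sup>2 / u\<^sup>2) * exp (- (u * r)))"

definition matern_mat'' :: "nat \<Rightarrow> real \<Rightarrow> real mat" where
  "matern_mat'' n u = mat n n (\<lambda>(i, j). let r = \<bar>real i - real j\<bar> / real n in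
     (12 * (1 + u * r) / u ^ 5 + 5 * r\<^sup>2 / u ^ 3 + r ^ 3 / u\<^sup>2) * exp (- (u * r)))"

lemma matern_mat_entry:
  "i < n \<Longrightarrow> j < n \<Longrightarrow> matern_mat n u $$ (i, j)
    = (1 + u * (\<bar>real i - real j\<bar> / real n)) / u ^ 3 * exp (- (u * (\<bar>real i - real j\<bar> / real n)))"
  by (simp add: matern_mat_def R_mat_def)

lemma matern_mat_carrier [simp]:
  "matern_mat n u \<in> carrier_mat n n" "matern_mat' n u \<in> carrier_mat n n" "matern_mat'' n u \<in> carrier_mat n n"
  by (auto simp: matern_mat_def matern_mat'_def matern_mat''_def R_mat_def)

lemma matern_mat_symmetric: "i < n \<Longrightarrow> j < n \<Longrightarrow> matern_mat n u $$ (i, j) = matern_mat n u $$ (j, i)"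
  by (simp add: matern_mat_entry abs_minus_commute)

lemma matern_mat'_entry:
  "i < n \<Longrightarrow> j < n \<Longrightarrow> matern_mat' n u $$ (i, j)
    = - (3 * (1 + u * (\<bar>real i - real j\<bar> / real n)) / u ^ 4 + (\<bar>real i - real j\<bar> / real n)\<^sup>2 / u\<^sup>2)
      * exp (- (u * (\<bar>real i - real j\<bar> / real n)))"
  "i < n \<Longrightarrow> j < n \<Longrightarrow> matern_mat'' n u $$ (i, j)
    = (12 * (1 + u * (\<bar>real i - real j\<bar> / real n)) / u ^ 5 + 5 * (\<bar>real i - real j\<bar> / real n)\<^sup>2 / u ^ 3
       + (\<bar>real i - real j\<bar> / real n) ^ 3 / u\<^sup>2) * exp (- (u * (\<bar>real i - real j\<bar> / real n)))"
  by (simp_all only: matern_mat'_def matern_mat''_def Let_def index_mat split)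

lemma matern_mat_derivative:
  assumes u: "0 < u"
  shows "has_mat_derivative n (matern_mat n) (matern_mat' n u) u"
    and "has_mat_derivative n (matern_mat' n) (matern_mat'' n u) u"
proof -
  have "((\<lambda>u. (1 + u * r) / u ^ 3 * exp (- (u * r))) has_real_derivative
      - (3 * (1 + u * r) / u ^ 4 + r\<^sup>2 / u\<^sup>2) * exp (- (u * r))) (at u)" for r
    using u by (auto intro!: derivative_eq_intros simp: field_simps power2_eq_square power3_eq_cube power4_eq_xxxx)
  then show "has_mat_derivative n (matern_mat n) (matern_mat' n u) u"
    unfolding has_mat_derivative_def
    by (intro conjI allI impI) (simp_all only: matern_mat_entry matern_mat'_entry matern_mat_carrier eventually_True)
  have "((\<lambda>u. - (3 * (1 + u * r) / u ^ 4 + r\<^sup>2 / u\<^sup>2) * exp (- (u * r))) has_real_derivative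
      (12 * (1 + u * r) / u ^ 5 + 5 * r\<^sup>2 / u ^ 3 + r ^ 3 / u\<^sup>2) * exp (- (u * r))) (at u)" for r
  proof -
    have "u ^ 5 = u * u * u * u * u" by (simp add: numeral_eq_Suc)
    then show ?thesis
      using u by (auto intro!: derivative_eq_intros simp: field_simps power2_eq_square power3_eq_cube power4_eq_xxxx)
  qed
  then show "has_mat_derivative n (matern_mat' n) (matern_mat'' n u) u"
    unfolding has_mat_derivative_def
    by (intro conjI allI impI) (simp_all only: matern_mat'_entry matern_mat_carrier eventually_True)
qed

lemma matern_mat_eq_cov_mat:
  assumes "0 < u" "0 < n"
  shows "matern_mat n u = (1 / u ^ 3) \<cdot>\<^sub>m cov_mat n (cov_seq (u / n))"
    and "matern_mat' n u = (1 / u ^ 4) \<cdot>\<^sub>m cov_mat n (dcov_seq (u / n))"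
proof -
  have e: "exp (- (u / n)) ^ k = exp (- (u * (real k / n)))" "real k * (u / n) = u * (real k / n)" for k
    by (simp_all flip: exp_of_nat_mult)
  show "matern_mat n u = (1 / u ^ 3) \<cdot>\<^sub>m cov_mat n (cov_seq (u / n))"
  proof (rule eq_matI)
    fix i j assume "i < dim_row ((1 / u ^ 3) \<cdot>\<^sub>m cov_mat n (cov_seq (u / n)))"
      "j < dim_col ((1 / u ^ 3) \<cdot>\<^sub>m cov_mat n (cov_seq (u / n)))"
    then have ij: "i < n" "j < n" by (auto simp: cov_mat_def)
    let ?r = "\<bar>real i - real j\<bar> / n"
    have "((1 / u ^ 3) \<cdot>\<^sub>m cov_mat n (cov_seq (u / n))) $$ (i, j) = 1 / u ^ 3 * cov_seq (u / n) (ndist i j)"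
      using ij by (simp add: cov_mat_def)
    also have "cov_seq (u / n) (ndist i j) = (1 + u * ?r) * exp (- (u * ?r))"
      unfolding cov_seq_def e by (simp only: real_ndist)
    also have "1 / u ^ 3 * (x * y) = x / u ^ 3 * y" for x y :: real
      by simp
    finally show "matern_mat n u $$ (i, j) = ((1 / u ^ 3) \<cdot>\<^sub>m cov_mat n (cov_seq (u / n))) $$ (i, j)"
      by (simp only: matern_mat_entry[OF ij])
  qed (auto simp: matern_mat_def R_mat_def cov_mat_def)
  show "matern_mat' n u = (1 / u ^ 4) \<cdot>\<^sub>m cov_mat n (dcov_seq (u / n))"
  proof (rule eq_matI)
    fix i j assume "i < dim_row ((1 / u ^ 4) \<cdot>\<^sub>m cov_mat n (dcov_seq (u / n)))"
      "j < dim_col ((1 / u ^ 4) \<cdot>\<^sub>m cov_mat n (dcov_seq (u / n)))"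
    then have ij: "i < n" "j < n" by (auto simp: cov_mat_def)
    let ?r = "\<bar>real i - real j\<bar> / n"
    have "((1 / u ^ 4) \<cdot>\<^sub>m cov_mat n (dcov_seq (u / n))) $$ (i, j) = 1 / u ^ 4 * dcov_seq (u / n) (ndist i j)"
      using ij by (simp add: cov_mat_def)
    also have "dcov_seq (u / n) (ndist i j) = - (3 + 3 * (u * ?r) + (u * ?r)\<^sup>2) * exp (- (u * ?r))"
      unfolding dcov_seq_def mult.assoc[of 3] e by (simp only: real_ndist)
    also have "1 / u ^ 4 * (- (3 + 3 * (u * r) + (u * r)\<^sup>2) * x) = - (3 * (1 + u * r) / u ^ 4 + r\<^sup>2 / u\<^sup>2) * x" for r x :: real
      using assms by (simp add: field_simps power2_eq_square power4_eq_xxxx)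
    finally show "matern_mat' n u $$ (i, j) = ((1 / u ^ 4) \<cdot>\<^sub>m cov_mat n (dcov_seq (u / n))) $$ (i, j)"
      by (simp only: matern_mat'_entry[OF ij])
  qed (auto simp: matern_mat'_def cov_mat_def)
qed

lemma det_matern_mat_pos:
  assumes "0 < u"
  shows "0 < Determinant.det (matern_mat n u)"
proof (cases "n = 0")
  case True
  then show ?thesis by (simp add: matern_mat_def R_mat_def Determinant.det_def)
next
  case False
  then have "0 < u / n" using assms by simp
  from det_cov_mat_pos[OF this, of n] show ?thesis
    using assms False by (simp add: matern_mat_eq_cov_mat cov_mat_def)
qed

definition log_deriv_mat :: "nat \<Rightarrow> real \<Rightarrow> real mat" where
  "log_deriv_mat n u = inverse_mat (matern_mat n u) * matern_mat' n u"

lemma log_deriv_mat_carrier: "0 < u \<Longrightarrow> log_deriv_mat n u \<in> carrier_mat n n"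
  unfolding log_deriv_mat_def using inverse_mat_correct(1)[of "matern_mat n u" n] det_matern_mat_pos[of u n]
  by (intro mult_carrier_mat) auto

lemma trace_log_deriv_mat:
  assumes u: "0 < u"
  shows "(\<lambda>n. (\<Sum>i<n. log_deriv_mat n u $$ (i, i)) + 2 * (u + 2) / u) \<in> O(\<lambda>n. 1 / real n)"
    and "(\<lambda>n. (\<Sum>i<n. (log_deriv_mat n u * log_deriv_mat n u) $$ (i, i)) - 2 * (2 * u + 5) / u\<^sup>2) \<in> O(\<lambda>n. 1 / real n)"
proof -
  have fin: "finite error_terms" by (simp add: error_terms_def)
  obtain C0 where C0: "\<forall>\<^sub>F h in at_right 0. \<forall>f\<in>error_terms. \<bar>f h\<bar> \<le> C0"
    using uniform_bound_at_right[OF fin error_terms_bigo] by auto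
  define C where "C = max 1 C0"
  have lim: "filterlim (\<lambda>n. u / real n) (at_right 0) sequentially"
    using u by real_asymp
  have err: "\<forall>\<^sub>F n in sequentially. \<forall>f\<in>error_terms. \<bar>f (u / real n)\<bar> \<le> C"
    using filterlim_iff[THEN iffD1, OF lim, rule_format, OF C0] by eventually_elim (auto simp: C_def intro: order_trans)
  have "\<forall>\<^sub>F n in sequentially. u / real n < min 1 (1 / (2 * C))"
    by (rule order_tendstoD(2)[of _ 0]) (auto simp: C_def intro!: tendsto_divide_0[OF tendsto_const] filterlim_real_sequentially filterlim_at_top_imp_at_infinity)
  with err have ev: "\<forall>\<^sub>F n in sequentially. fine_grid (u / real n) C n"
    using eventually_ge_at_top[of 3]
  proof eventually_elim
    case (elim n)
    have C: "0 < C" by (simp add: C_def)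
    then have "C * (u / real n) \<le> 1 / 2" using elim(2) by (simp add: field_simps)
    moreover have "u / real n \<le> 1" using elim(2) by simp
    ultimately show ?case using elim(1,3) u by unfold_locales (auto simp: C_def)
  qed
  define K where "K = (4 + 2 * C * (u + 32)) + (16 * C * u + 8 + (2 * (5 + 2 * u) + 2 * C * (u + 32)) * (2 * C * (u + 32)))"
  have C1: "1 \<le> C" by (simp add: C_def)
  then have K: "4 + 2 * C * (u + 32) \<le> K" "16 * C * u + 8 + (2 * (5 + 2 * u) + 2 * C * (u + 32)) * (2 * C * (u + 32)) \<le> K"
    using u by (auto simp: K_def)
  have main: "\<forall>\<^sub>F n in sequentially. \<bar>(\<Sum>i<n. log_deriv_mat n u $$ (i, i)) + 2 * (u + 2) / u\<bar> \<le> K * (1 / real n) \<and>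
    \<bar>(\<Sum>i<n. (log_deriv_mat n u * log_deriv_mat n u) $$ (i, i)) - 2 * (2 * u + 5) / u\<^sup>2\<bar> \<le> (K / u) * (1 / real n)"
    using ev
  proof eventually_elim
    case (elim n)
    then interpret fine_grid "u / real n" C n .
    have n: "0 < n" using n_ge by simp
    let ?L = "log_deriv_mat n u" and ?h = "u / real n"
    \<comment> \<open>The factor \<open>u\<close> balances the scalings: \<open>matern_mat\<close>
      is the grid covariance over \<open>u ^ 3\<close> and its derivative is the
      \<open>dcov_seq\<close> matrix over \<open>u ^ 4\<close>.\<close>
    let ?G = "u \<cdot>\<^sub>m ?L"
    note J = inverse_mat_correct[OF matern_mat_carrier(1)[of n u]]
    have d: "Determinant.det (matern_mat n u) \<noteq> 0" using det_matern_mat_pos[OF u, of n] by simp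
    have L: "?L \<in> carrier_mat n n" by (rule log_deriv_mat_carrier[OF u])
    have "matern_mat n u * ?L = matern_mat' n u"
      unfolding log_deriv_mat_def
      by (subst assoc_mult_mat[OF matern_mat_carrier(1) J(1)[OF d] matern_mat_carrier(2), symmetric])
        (simp only: J(3)[OF d] left_mult_one_mat[OF matern_mat_carrier(2)])
    then have "(1 / u ^ 3) \<cdot>\<^sub>m (cov_mat n (cov_seq ?h) * ?L) = (1 / u ^ 4) \<cdot>\<^sub>m cov_mat n (dcov_seq ?h)"
      using mult_smult_assoc_mat[OF cov_mat_carrier L] u n by (simp add: matern_mat_eq_cov_mat)
    then have *: "u ^ 4 \<cdot>\<^sub>m ((1 / u ^ 3) \<cdot>\<^sub>m (cov_mat n (cov_seq ?h) * ?L)) = u ^ 4 \<cdot>\<^sub>m ((1 / u ^ 4) \<cdot>\<^sub>m cov_mat n (dcov_seq ?h))"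
      by simp
    have "u \<cdot>\<^sub>m (cov_mat n (cov_seq ?h) * ?L) = cov_mat n (dcov_seq ?h)"
    proof -
      have "u ^ 4 * (1 / u ^ 3) = u" "u ^ 4 * (1 / u ^ 4) = 1"
        using u by (simp_all add: power4_eq_xxxx power3_eq_cube)
      with * show ?thesis by (simp only: smult_smult_mat)
    qed
    then have eq: "cov_mat n (cov_seq ?h) * ?G = cov_mat n (dcov_seq ?h)"
      using mult_smult_distrib[OF cov_mat_carrier L] by simp
    have G: "?G \<in> carrier_mat n n" using L by simp
    \<comment> \<open>Since \<open>n * h = u\<close> is fixed, the brackets in the trace bounds are
      constants, and the factor \<open>h\<close> in front is the claimed order
      \<open>1 / n\<close>.\<close>
    have nh: "real n * ?h = u" using n by simp
    have "?G * ?G = u\<^sup>2 \<cdot>\<^sub>m (?L * ?L)"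
      using mult_smult_assoc_mat[OF L G] mult_smult_distrib[OF L L, of u] by (simp add: power2_eq_square smult_smult_mat)
    then have t2: "(\<Sum>i<n. (?G * ?G) $$ (i, i)) = u\<^sup>2 * (\<Sum>i<n. (?L * ?L) $$ (i, i))"
      using carrier_matD[OF mult_carrier_mat[OF L L]] by (simp add: sum_distrib_left del: index_mult_mat)
    have t1: "(\<Sum>i<n. ?G $$ (i, i)) = u * (\<Sum>i<n. ?L $$ (i, i))"
      using L by (simp add: sum_distrib_left)
    note b = trace_bounds_mat[OF G eq, unfolded nh t1 t2]
    have "u * \<bar>(\<Sum>i<n. ?L $$ (i, i)) + 2 * (u + 2) / u\<bar> = \<bar>u * ((\<Sum>i<n. ?L $$ (i, i)) + 2 * (u + 2) / u)\<bar>"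
      using u by (simp add: abs_mult)
    also have "u * ((\<Sum>i<n. ?L $$ (i, i)) + 2 * (u + 2) / u) = u * (\<Sum>i<n. ?L $$ (i, i)) - (- 4 - 2 * u)"
      using u by (simp add: field_simps)
    also have "\<bar>\<dots>\<bar> \<le> ?h * K"
      using b(1) mult_left_mono[OF K(1), of ?h] u by simp
    finally have 1: "\<bar>(\<Sum>i<n. ?L $$ (i, i)) + 2 * (u + 2) / u\<bar> \<le> K * (1 / real n)"
      using u by (simp add: field_simps)
    have "u\<^sup>2 * \<bar>(\<Sum>i<n. (?L * ?L) $$ (i, i)) - 2 * (2 * u + 5) / u\<^sup>2\<bar> = \<bar>u\<^sup>2 * ((\<Sum>i<n. (?L * ?L) $$ (i, i)) - 2 * (2 * u + 5) / u\<^sup>2)\<bar>"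
      using u by (simp add: abs_mult del: index_mult_mat)
    also have "u\<^sup>2 * ((\<Sum>i<n. (?L * ?L) $$ (i, i)) - 2 * (2 * u + 5) / u\<^sup>2) = u\<^sup>2 * (\<Sum>i<n. (?L * ?L) $$ (i, i)) - (10 + 4 * u)"
      using u by (simp add: right_diff_distrib del: index_mult_mat)
    also have "\<bar>\<dots>\<bar> \<le> ?h * K"
      using b(2) mult_left_mono[OF K(2), of ?h] u by (simp del: index_mult_mat)
    finally have *: "u\<^sup>2 * \<bar>(\<Sum>i<n. (?L * ?L) $$ (i, i)) - 2 * (2 * u + 5) / u\<^sup>2\<bar> \<le> ?h * K" .
    have div_le: "x \<le> y / c" if "c * x \<le> y" "0 < c" for c x y :: real
      using that by (simp add: pos_le_divide_eq mult.commute)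
    have "\<bar>(\<Sum>i<n. (?L * ?L) $$ (i, i)) - 2 * (2 * u + 5) / u\<^sup>2\<bar> \<le> ?h * K / u\<^sup>2"
      by (rule div_le[OF *]) (use u in simp)
    also have "?h * K / u\<^sup>2 = (K / u) * (1 / real n)"
      using u by (simp add: power2_eq_square)
    finally show ?case using 1 by blast
  qed
  show "(\<lambda>n. (\<Sum>i<n. log_deriv_mat n u $$ (i, i)) + 2 * (u + 2) / u) \<in> O(\<lambda>n. 1 / real n)"
    by (rule bigoI[of _ K]) (use main in eventually_elim, simp)
  show "(\<lambda>n. (\<Sum>i<n. (log_deriv_mat n u * log_deriv_mat n u) $$ (i, i)) - 2 * (2 * u + 5) / u\<^sup>2) \<in> O(\<lambda>n. 1 / real n)"
    by (rule bigoI[of _ "K / u"]) (use main in \<open>eventually_elim, simp del: index_mult_mat\<close>)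
qed

subsection \<open>Second moments of the multivariate normal law\<close>

lemma normal_law_second_moment:
  assumes "0 \<le> v"
  shows "integrable (normal_law 0 v) (\<lambda>x. x\<^sup>2)" "(\<integral>x. x\<^sup>2 \<partial>normal_law 0 v) = v"
proof -
  have "integrable (normal_law 0 v) (\<lambda>x. x\<^sup>2) \<and> (\<integral>x. x\<^sup>2 \<partial>normal_law 0 v) = v"
  proof (cases "v = 0")
    case True
    then show ?thesis
      by (auto simp: normal_law_def integral_return integrable_iff_bounded nn_integral_return)
  next
    case False
    then have s: "0 < sqrt v" using assms by simp
    have i: "integrable lborel (\<lambda>x. normal_density 0 (sqrt v) x * x\<^sup>2)"
      using integrable_normal_moment[OF s, of 0 2] by simp
    have e: "(\<integral>x. normal_density 0 (sqrt v) x * x\<^sup>2 \<partial>lborel) = v"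
      using integral_normal_moment_even[OF s, of 0 1] s by (simp add: numeral_2_eq_2[symmetric])
    have l: "normal_law 0 v = density lborel (\<lambda>x. ennreal (normal_density 0 (sqrt v) x))"
      using False by (simp add: normal_law_def)
    show ?thesis
      unfolding l using i e by (simp add: integrable_density integral_density)
  qed
  then show "integrable (normal_law 0 v) (\<lambda>x. x\<^sup>2)" "(\<integral>x. x\<^sup>2 \<partial>normal_law 0 v) = v" by auto
qed

lemma multivariate_normal_linear_second_moment:
  assumes X: "multivariate_normal M X (0\<^sub>v N) S" and a: "a \<in> carrier_vec N"
    and v: "0 \<le> scalar_prod a (S *\<^sub>v a)"
  shows "integrable M (\<lambda>\<omega>. (scalar_prod a (X \<omega>))\<^sup>2)"
    and "(\<integral>\<omega>. (scalar_prod a (X \<omega>))\<^sup>2 \<partial>M) = scalar_prod a (S *\<^sub>v a)"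
proof -
  let ?Y = "\<lambda>\<omega>. scalar_prod a (X \<omega>)"
  have Y: "?Y \<in> borel_measurable M" and
    d: "distr M borel ?Y = normal_law 0 (scalar_prod a (S *\<^sub>v a))"
    using X a unfolding multivariate_normal_def by auto
  note m = normal_law_second_moment[OF v, folded d]
  show "integrable M (\<lambda>\<omega>. (?Y \<omega>)\<^sup>2)"
    using m(1) Y by (simp add: integrable_distr_eq)
  show "(\<integral>\<omega>. (?Y \<omega>)\<^sup>2 \<partial>M) = scalar_prod a (S *\<^sub>v a)"
    using m(2) Y by (simp add: integral_distr)
qed

text \<open>Polarisation with the linear forms of \<open>unit_vec N I\<close>,
  \<open>unit_vec N J\<close> and their sum. Entrywise nonnegativity makes the variances of these
  forms nonnegative, and for the Matern covariance it is visible from the entries.\<close>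

lemma multivariate_normal_second_moment:
  fixes X :: "'a \<Rightarrow> real Matrix.vec"
  assumes X: "multivariate_normal M X (0\<^sub>v N) S" and S: "S \<in> carrier_mat N N"
    and sym: "\<And>I J. I < N \<Longrightarrow> J < N \<Longrightarrow> S $$ (I, J) = S $$ (J, I)"
    and nonneg: "\<And>I J. I < N \<Longrightarrow> J < N \<Longrightarrow> 0 \<le> S $$ (I, J)"
    and IJ: "I < N" "J < N"
  shows "integrable M (\<lambda>\<omega>. X \<omega> $ I * X \<omega> $ J)" and "(\<integral>\<omega>. X \<omega> $ I * X \<omega> $ J \<partial>M) = S $$ (I, J)"
proof -
  have XM: "X \<omega> \<in> carrier_vec N" if "\<omega> \<in> space M" for \<omega>
    using X that unfolding multivariate_normal_def by auto
  have uu: "scalar_prod (unit_vec N I) (S *\<^sub>v unit_vec N J) = S $$ (I, J)" if "I < N" "J < N" for I J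
    using S that by (simp add: scalar_prod_right_unit scalar_prod_left_unit)
  have u: "integrable M (\<lambda>\<omega>. (X \<omega> $ I)\<^sup>2)" "(\<integral>\<omega>. (X \<omega> $ I)\<^sup>2 \<partial>M) = S $$ (I, I)" if I: "I < N" for I
  proof -
    have e: "scalar_prod (unit_vec N I) (X \<omega>) = X \<omega> $ I" if "\<omega> \<in> space M" for \<omega>
      using XM[OF that] I by simp
    have a: "unit_vec N I \<in> carrier_vec N" by simp
    have "0 \<le> scalar_prod (unit_vec N I) (S *\<^sub>v unit_vec N I)" using uu[OF I I] nonneg[OF I I] by simp
    note m = multivariate_normal_linear_second_moment[OF X a this]
    show "integrable M (\<lambda>\<omega>. (X \<omega> $ I)\<^sup>2)"
      using m(1) by (rule Bochner_Integration.integrable_cong[THEN iffD1, rotated 2]) (auto simp: e)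
    have "(\<integral>\<omega>. (X \<omega> $ I)\<^sup>2 \<partial>M) = (\<integral>\<omega>. (scalar_prod (unit_vec N I) (X \<omega>))\<^sup>2 \<partial>M)"
      by (rule Bochner_Integration.integral_cong) (auto simp: e)
    then show "(\<integral>\<omega>. (X \<omega> $ I)\<^sup>2 \<partial>M) = S $$ (I, I)" using m(2) uu[OF I I] by simp
  qed
  let ?a = "unit_vec N I + unit_vec N J"
  have a: "?a \<in> carrier_vec N" by simp
  have q: "scalar_prod ?a (S *\<^sub>v ?a) = S $$ (I, I) + 2 * S $$ (I, J) + S $$ (J, J)"
  proof -
    have c: "S *\<^sub>v unit_vec N K \<in> carrier_vec N" for K using S by simp
    have "S *\<^sub>v ?a = S *\<^sub>v unit_vec N I + S *\<^sub>v unit_vec N J"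
      by (rule mult_add_distrib_mat_vec[OF S]) auto
    then have "scalar_prod ?a (S *\<^sub>v ?a) = scalar_prod ?a (S *\<^sub>v unit_vec N I) + scalar_prod ?a (S *\<^sub>v unit_vec N J)"
      using scalar_prod_add_distrib[OF a c c] by simp
    also have "\<dots> = S $$ (I, I) + S $$ (J, I) + (S $$ (I, J) + S $$ (J, J))"
      using add_scalar_prod_distrib[of "unit_vec N I" N "unit_vec N J", OF _ _ c] uu IJ by simp
    finally show ?thesis using sym[OF IJ] by simp
  qed
  have q0: "0 \<le> scalar_prod ?a (S *\<^sub>v ?a)" unfolding q using nonneg IJ by (simp add: add_nonneg_nonneg)
  have e: "X \<omega> $ I * X \<omega> $ J = ((scalar_prod ?a (X \<omega>))\<^sup>2 - (X \<omega> $ I)\<^sup>2 - (X \<omega> $ J)\<^sup>2) / 2" if "\<omega> \<in> space M" for \<omega>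
  proof -
    have "scalar_prod ?a (X \<omega>) = X \<omega> $ I + X \<omega> $ J"
      using add_scalar_prod_distrib[of "unit_vec N I" N "unit_vec N J", OF _ _ XM[OF that]] XM[OF that] IJ by simp
    then show ?thesis by (simp add: power2_eq_square algebra_simps)
  qed
  note m = multivariate_normal_linear_second_moment[OF X a q0]
  have i: "integrable M (\<lambda>\<omega>. ((scalar_prod ?a (X \<omega>))\<^sup>2 - (X \<omega> $ I)\<^sup>2 - (X \<omega> $ J)\<^sup>2) / 2)"
    using m(1) u(1)[OF IJ(1)] u(1)[OF IJ(2)] by simp
  then show "integrable M (\<lambda>\<omega>. X \<omega> $ I * X \<omega> $ J)"
    by (rule Bochner_Integration.integrable_cong[THEN iffD1, rotated 2]) (auto simp: e)
  have "(\<integral>\<omega>. X \<omega> $ I * X \<omega> $ J \<partial>M) = (\<integral>\<omega>. ((scalar_prod ?a (X \<omega>))\<^sup>2 - (X \<omega> $ I)\<^sup>2 - (X \<omega> $ J)\<^sup>2) / 2 \<partial>M)"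
    by (rule Bochner_Integration.integral_cong) (auto simp: e)
  also have "\<dots> = (scalar_prod ?a (S *\<^sub>v ?a) - S $$ (I, I) - S $$ (J, J)) / 2"
    using m u[OF IJ(1)] u[OF IJ(2)] by simp
  finally show "(\<integral>\<omega>. X \<omega> $ I * X \<omega> $ J \<partial>M) = S $$ (I, J)" unfolding q by simp
qed

subsection \<open>The log-likelihood and its Fisher information\<close>

text \<open>The multi-index \<open>\<mu>\<close> records how often each coordinate has been
  differentiated, so the same rule applies again to its own result.\<close>

lemma has_derivative_prod_coordinate:
  fixes H :: "nat \<Rightarrow> nat \<Rightarrow> real \<Rightarrow> real"
  assumes T: "finite T" "j \<in> T" and H: "(H j (\<mu> j) has_real_derivative H j (Suc (\<mu> j)) (q j)) (at (q j))"
  shows "((\<lambda>u. \<Prod>t\<in>T. H t (\<mu> t) ((q(j := u)) t)) has_real_derivative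
    (\<Prod>t\<in>T. H t ((\<mu>(j := Suc (\<mu> j))) t) (q t))) (at (q j))"
proof -
  have "(\<Prod>t\<in>T. H t (\<mu> t) ((q(j := u)) t)) = H j (\<mu> j) u * (\<Prod>t\<in>T - {j}. H t (\<mu> t) (q t))" for u
    using T by (subst prod.remove[of _ j]) (auto intro!: prod.cong)
  moreover have "(\<Prod>t\<in>T. H t ((\<mu>(j := Suc (\<mu> j))) t) (q t)) = H j (Suc (\<mu> j)) (q j) * (\<Prod>t\<in>T - {j}. H t (\<mu> t) (q t))"
    using T by (subst prod.remove[of _ j]) (auto intro!: prod.cong)
  ultimately show ?thesis by (simp add: DERIV_cmult_right[OF H])
qed

lemma has_derivative_sum_coordinate:
  fixes a :: "nat \<Rightarrow> real \<Rightarrow> real"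
  assumes T: "finite T" "j \<in> T" and a: "(a j has_real_derivative D) (at (q j))"
  shows "((\<lambda>u. \<Sum>t\<in>T. a t ((q(j := u)) t)) has_real_derivative D) (at (q j))"
proof -
  have "(\<Sum>t\<in>T. a t ((q(j := u)) t)) = a j u + (\<Sum>t\<in>T - {j}. a t (q t))" for u
    using T by (subst sum.remove[of _ j]) (auto intro!: sum.cong)
  then show ?thesis by (simp add: DERIV_add[OF a DERIV_const, simplified])
qed

text \<open>\<open>H k t m\<close> is the derivative of order \<open>m\<close> of the factor
  depending on coordinate \<open>t\<close>, and \<open>a\<close> collects the additive terms. The
  formula for \<open>f\<close> is assumed on the positive orthant only; that set is open, so all
  derivatives can be taken there.\<close>

lemma second_partial_sum_of_products:
  fixes f :: "(nat \<Rightarrow> real) \<Rightarrow> real" and a a' a'' :: "nat \<Rightarrow> real \<Rightarrow> real"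
    and H :: "'k \<Rightarrow> nat \<Rightarrow> nat \<Rightarrow> real \<Rightarrow> real"
  assumes T: "finite T" "i \<in> T" "j \<in> T"
    and f: "\<And>q. (\<And>t. t \<in> T \<Longrightarrow> 0 < q t) \<Longrightarrow> f q = c + (\<Sum>t\<in>T. a t (q t)) + (\<Sum>k\<in>S. w k * (\<Prod>t\<in>T. H k t 0 (q t)))"
    and a': "\<And>t u. t \<in> T \<Longrightarrow> 0 < u \<Longrightarrow> (a t has_real_derivative a' t u) (at u)"
    and a'': "\<And>t u. t \<in> T \<Longrightarrow> 0 < u \<Longrightarrow> (a' t has_real_derivative a'' t u) (at u)"
    and H: "\<And>k t m u. k \<in> S \<Longrightarrow> t \<in> T \<Longrightarrow> m < 2 \<Longrightarrow> 0 < u \<Longrightarrow> (H k t m has_real_derivative H k t (Suc m) u) (at u)"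
    and p: "\<And>t. t \<in> T \<Longrightarrow> 0 < p t"
  defines "\<mu> \<equiv> \<lambda>t. (if t = i then 1 else 0) + (if t = j then 1 else 0 :: nat)"
  shows "second_partial_exists i j f p"
    and "partial_deriv i (partial_deriv j f) p = (if i = j then a'' i (p i) else 0) + (\<Sum>k\<in>S. w k * (\<Prod>t\<in>T. H k t (\<mu> t) (p t)))"
proof -
  \<comment> \<open>The multi-index after the first differentiation, in direction \<open>j\<close>;
    raising its entry \<open>i\<close> by one gives \<open>\<mu>\<close>.\<close>
  define e where "e t = (if t = j then 1 else 0 :: nat)" for t
  have ev: "\<forall>\<^sub>F u in nhds (q l). \<forall>t\<in>T. 0 < (q(l := u)) t" if q: "\<And>t. t \<in> T \<Longrightarrow> 0 < q t" and l: "l \<in> T" for q :: "nat \<Rightarrow> real" and l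
  proof -
    have "\<forall>\<^sub>F u in nhds (q l). u \<in> {0<..}"
      using q[OF l] by (intro eventually_nhds_in_open) auto
    then show ?thesis by eventually_elim (use q in auto)
  qed
  have first: "((\<lambda>u. f (q(j := u))) has_real_derivative a' j (q j) + (\<Sum>k\<in>S. w k * (\<Prod>t\<in>T. H k t (e t) (q t)))) (at (q j))"
    if q: "\<And>t. t \<in> T \<Longrightarrow> 0 < q t" for q
  proof -
    have "((\<lambda>u. c + (\<Sum>t\<in>T. a t ((q(j := u)) t)) + (\<Sum>k\<in>S. w k * (\<Prod>t\<in>T. H k t ((\<lambda>_. 0) t) ((q(j := u)) t)))) has_real_derivative
        0 + a' j (q j) + (\<Sum>k\<in>S. w k * (\<Prod>t\<in>T. H k t (((\<lambda>_. 0)(j := Suc ((\<lambda>_. 0) j))) t) (q t)))) (at (q j))"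
      using T q by (intro DERIV_add DERIV_const has_derivative_sum_coordinate DERIV_sum DERIV_cmult has_derivative_prod_coordinate a' H) auto
    moreover have "((\<lambda>_. 0)(j := Suc ((\<lambda>_. 0) j))) = e" by (auto simp: e_def)
    moreover have "\<forall>\<^sub>F u in nhds (q j). \<forall>t\<in>T. 0 < (q(j := u)) t"
      by (rule ev) (use q T in auto)
    then have "\<forall>\<^sub>F u in nhds (q j). f (q(j := u)) = c + (\<Sum>t\<in>T. a t ((q(j := u)) t)) + (\<Sum>k\<in>S. w k * (\<Prod>t\<in>T. H k t 0 ((q(j := u)) t)))"
      by eventually_elim (rule f, blast)
    ultimately show ?thesis by (simp add: DERIV_cong_ev)
  qed
  have pd: "partial_deriv j f q = a' j (q j) + (\<Sum>k\<in>S. w k * (\<Prod>t\<in>T. H k t (e t) (q t)))"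
    if q: "\<And>t. t \<in> T \<Longrightarrow> 0 < q t" for q
    unfolding partial_deriv_def by (rule DERIV_imp_deriv[OF first[OF q]])
  have evp: "\<forall>\<^sub>F u in nhds (p i). \<forall>t\<in>T. 0 < (p(i := u)) t"
    by (rule ev) (use p T in auto)
  have second: "((\<lambda>u. partial_deriv j f (p(i := u))) has_real_derivative
      (if i = j then a'' i (p i) else 0) + (\<Sum>k\<in>S. w k * (\<Prod>t\<in>T. H k t (\<mu> t) (p t)))) (at (p i))"
  proof -
    have "((\<lambda>u. a' j ((p(i := u)) j)) has_real_derivative (if i = j then a'' i (p i) else 0)) (at (p i))"
      using a''[OF T(2) p[OF T(2)]] by (cases "i = j") auto
    moreover have "((\<lambda>u. \<Sum>k\<in>S. w k * (\<Prod>t\<in>T. H k t (e t) ((p(i := u)) t))) has_real_derivative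
        (\<Sum>k\<in>S. w k * (\<Prod>t\<in>T. H k t ((e(i := Suc (e i))) t) (p t)))) (at (p i))"
      using T p by (intro DERIV_sum DERIV_cmult has_derivative_prod_coordinate H) (auto simp: e_def)
    ultimately have "((\<lambda>u. a' j ((p(i := u)) j) + (\<Sum>k\<in>S. w k * (\<Prod>t\<in>T. H k t (e t) ((p(i := u)) t)))) has_real_derivative
        (if i = j then a'' i (p i) else 0) + (\<Sum>k\<in>S. w k * (\<Prod>t\<in>T. H k t ((e(i := Suc (e i))) t) (p t)))) (at (p i))"
      by (rule DERIV_add)
    moreover have "e(i := Suc (e i)) = \<mu>" by (auto simp: e_def \<mu>_def)
    moreover have "\<forall>\<^sub>F u in nhds (p i). partial_deriv j f (p(i := u))
        = a' j ((p(i := u)) j) + (\<Sum>k\<in>S. w k * (\<Prod>t\<in>T. H k t (e t) ((p(i := u)) t)))"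
      using evp by eventually_elim (rule pd, blast)
    ultimately show ?thesis by (simp add: DERIV_cong_ev)
  qed
  show "partial_deriv i (partial_deriv j f) p = (if i = j then a'' i (p i) else 0) + (\<Sum>k\<in>S. w k * (\<Prod>t\<in>T. H k t (\<mu> t) (p t)))"
    unfolding partial_deriv_def[of i] by (rule DERIV_imp_deriv[OF second])
  have "\<forall>\<^sub>F u in nhds (p i). partially_differentiable j f (p(i := u))"
    using evp
  proof eventually_elim
    case (elim u)
    then show ?case
      unfolding partially_differentiable_def real_differentiable_def using first[of "p(i := u)"] by blast
  qed
  moreover have "partially_differentiable i (partial_deriv j f) p"
    unfolding partially_differentiable_def real_differentiable_def using second by blast
  ultimately show "second_partial_exists i j f p" by (simp add: second_partial_exists_def)
qed

section \<open>One-parameter derivatives of the inverse and of the log-determinant\<close>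

definition matern_inv :: "nat \<Rightarrow> nat \<Rightarrow> real \<Rightarrow> real mat" where
  "matern_inv n m u = (let J = inverse_mat (matern_mat n u); L = log_deriv_mat n u; J' = - (L * J) in
     if m = 0 then J else if m = 1 then J'
     else - ((J' * matern_mat' n u + J * matern_mat'' n u) * J + L * J'))"

definition log_deriv_mat' :: "nat \<Rightarrow> real \<Rightarrow> real mat" where
  "log_deriv_mat' n u = matern_inv n 1 u * matern_mat' n u + matern_inv n 0 u * matern_mat'' n u"

lemma matern_inv_0:
  assumes "0 < u"
  shows "matern_inv n 0 u \<in> carrier_mat n n" "matern_inv n 0 u * matern_mat n u = 1\<^sub>m n"
    "matern_mat n u * matern_inv n 0 u = 1\<^sub>m n"
  using inverse_mat_correct[OF matern_mat_carrier(1), of n u] det_matern_mat_pos[OF assms, of n]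
  by (auto simp: matern_inv_def)

lemma matern_inv_1: "matern_inv n 1 u = - (log_deriv_mat n u * matern_inv n 0 u)"
  by (simp add: matern_inv_def Let_def)

lemma matern_inv_2: "matern_inv n (Suc 1) u = - (log_deriv_mat' n u * matern_inv n 0 u + log_deriv_mat n u * matern_inv n 1 u)"
  by (simp add: matern_inv_def log_deriv_mat'_def Let_def)

lemma matern_inv_1_carrier: "0 < u \<Longrightarrow> matern_inv n 1 u \<in> carrier_mat n n"
  unfolding matern_inv_1 by (intro uminus_carrier_mat mult_carrier_mat[of _ n n _ n] matern_inv_0 log_deriv_mat_carrier)

lemma log_deriv_mat'_carrier: "0 < u \<Longrightarrow> log_deriv_mat' n u \<in> carrier_mat n n"
  unfolding log_deriv_mat'_def
  by (intro add_carrier_mat mult_carrier_mat[of _ n n _ n] matern_inv_0 matern_inv_1_carrier matern_mat_carrier)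

lemma matern_inv_2_carrier: "0 < u \<Longrightarrow> matern_inv n (Suc 1) u \<in> carrier_mat n n"
  unfolding matern_inv_2
  by (intro uminus_carrier_mat add_carrier_mat mult_carrier_mat[of _ n n _ n] matern_inv_0 matern_inv_1_carrier log_deriv_mat_carrier log_deriv_mat'_carrier)

text \<open>\<open>matern_inv n m\<close> is the derivative of order \<open>m \<le> 2\<close> of the
  inverse \<open>J\<close>. With the logarithmic derivative \<open>L\<close> these are
  \<open>J' = - L J\<close> and \<open>J'' = - (L' J + L J')\<close>, so that multiplying by the
  matrix itself on the right cancels every trailing \<open>J\<close>.\<close>

lemma matern_inv_derivative:
  assumes u: "0 < u" and m: "m < 2"
  shows "has_mat_derivative n (matern_inv n m) (matern_inv n (Suc m) u) u"
    and "has_mat_derivative n (log_deriv_mat n) (log_deriv_mat' n u) u"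
proof -
  have J: "matern_inv n 0 = (\<lambda>v. inverse_mat (matern_mat n v))"
    by (auto simp: matern_inv_def)
  have "Determinant.det (matern_mat n u) \<noteq> 0" using det_matern_mat_pos[OF u, of n] by simp
  from inverse_mat_has_derivative[OF matern_mat_derivative(1)[OF u] this]
  have D0: "has_mat_derivative n (matern_inv n 0) (matern_inv n 1 u) u"
    by (simp only: J matern_inv_1 log_deriv_mat_def)
  have L: "log_deriv_mat n = (\<lambda>v. matern_inv n 0 v * matern_mat' n v)"
    by (auto simp: log_deriv_mat_def J)
  show DL: "has_mat_derivative n (log_deriv_mat n) (log_deriv_mat' n u) u"
    unfolding L log_deriv_mat'_def by (rule has_mat_derivative_times[OF D0 matern_mat_derivative(2)[OF u]])
  have D1: "has_mat_derivative n (matern_inv n 1) (matern_inv n (Suc 1) u) u"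
    unfolding matern_inv_2
    using has_mat_derivative_uminus[OF has_mat_derivative_times[OF DL D0]] by (simp only: matern_inv_1[abs_def])
  show "has_mat_derivative n (matern_inv n m) (matern_inv n (Suc m) u) u"
    using D0 D1 m by (cases m) (auto simp: less_Suc_eq numeral_2_eq_2)
qed

text \<open>These traces are the expectations of the quadratic form and its derivatives. The trace
  of \<open>log_deriv_mat'\<close> in the second one will cancel against the second derivative of
  the log-determinant.\<close>

lemma trace_matern_inv:
  assumes u: "0 < u"
  shows "(\<Sum>i<n. (matern_inv n 0 u * matern_mat n u) $$ (i, i)) = n"
    and "(\<Sum>i<n. (matern_inv n 1 u * matern_mat n u) $$ (i, i)) = - (\<Sum>i<n. log_deriv_mat n u $$ (i, i))"
    and "(\<Sum>i<n. (matern_inv n (Suc 1) u * matern_mat n u) $$ (i, i))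
      = (\<Sum>i<n. (log_deriv_mat n u * log_deriv_mat n u) $$ (i, i)) - (\<Sum>i<n. log_deriv_mat' n u $$ (i, i))"
proof -
  let ?J = "matern_inv n 0 u" and ?J1 = "matern_inv n 1 u" and ?K = "matern_mat n u"
    and ?L = "log_deriv_mat n u" and ?L' = "log_deriv_mat' n u"
  note J = matern_inv_0[OF u, of n]
  note c = J(1) matern_inv_1_carrier[OF u, of n] matern_mat_carrier(1)[of n u]
    log_deriv_mat_carrier[OF u, of n] log_deriv_mat'_carrier[OF u, of n]
  show "(\<Sum>i<n. (?J * ?K) $$ (i, i)) = n" by (simp add: J(2) del: index_mult_mat)
  have "?J1 * ?K = - (?L * ?J * ?K)"
    unfolding matern_inv_1 by (rule uminus_mult_left_mat) (use carrier_matD[OF c(1)] carrier_matD[OF c(3)] in simp)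
  also have "?L * ?J * ?K = ?L"
    by (simp only: assoc_mult_mat[OF c(4,1,3)] J(2) right_mult_one_mat[OF c(4)])
  finally have J1K: "?J1 * ?K = - ?L" .
  show "(\<Sum>i<n. (?J1 * ?K) $$ (i, i)) = - (\<Sum>i<n. ?L $$ (i, i))"
    unfolding J1K using carrier_matD[OF c(4)] by (simp add: sum_negf)
  have m: "?L' * ?J \<in> carrier_mat n n" "?L * ?J1 \<in> carrier_mat n n" "?L * ?L \<in> carrier_mat n n"
    using c by (auto intro: mult_carrier_mat[of _ n n _ n])
  have "matern_inv n (Suc 1) u * ?K = - ((?L' * ?J + ?L * ?J1) * ?K)"
    unfolding matern_inv_2 by (rule uminus_mult_left_mat) (use carrier_matD[OF m(2)] carrier_matD[OF c(3)] in simp)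
  also have "(?L' * ?J + ?L * ?J1) * ?K = ?L' * ?J * ?K + ?L * ?J1 * ?K"
    by (rule add_mult_distrib_mat[OF m(1,2) c(3)])
  also have "?L' * ?J * ?K = ?L'"
    by (simp only: assoc_mult_mat[OF c(5,1,3)] J(2) right_mult_one_mat[OF c(5)])
  also have "?L * ?J1 * ?K = ?L * (- ?L)"
    by (simp only: assoc_mult_mat[OF c(4,2,3)] J1K)
  also have "\<dots> = - (?L * ?L)"
    by (rule uminus_mult_right_mat) (use carrier_matD[OF c(4)] in simp)
  finally have "matern_inv n (Suc 1) u * ?K = - (?L' + - (?L * ?L))" .
  then show "(\<Sum>i<n. (matern_inv n (Suc 1) u * ?K) $$ (i, i)) = (\<Sum>i<n. (?L * ?L) $$ (i, i)) - (\<Sum>i<n. ?L' $$ (i, i))"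
    using carrier_matD[OF m(3)] carrier_matD[OF c(5)] by (simp add: sum_subtractf del: index_mult_mat)
qed

lemma ln_det_matern_mat_derivative:
  assumes u: "0 < u"
  shows "((\<lambda>v. ln (Determinant.det (matern_mat n v))) has_real_derivative (\<Sum>i<n. log_deriv_mat n u $$ (i, i))) (at u)"
    and "((\<lambda>v. \<Sum>i<n. log_deriv_mat n v $$ (i, i)) has_real_derivative (\<Sum>i<n. log_deriv_mat' n u $$ (i, i))) (at u)"
proof -
  note p = det_matern_mat_pos[OF u, of n]
  have "((\<lambda>v. Determinant.det (matern_mat n v)) has_real_derivative
      Determinant.det (matern_mat n u) * (\<Sum>i<n. (matern_inv n 0 u * matern_mat' n u) $$ (i, i))) (at u)"
    by (rule Jacobi_formula[OF matern_mat_derivative(1)[OF u] matern_inv_0(1,2)[OF u]])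
  also have "matern_inv n 0 u * matern_mat' n u = log_deriv_mat n u"
    by (simp add: log_deriv_mat_def matern_inv_def)
  finally have d: "((\<lambda>v. Determinant.det (matern_mat n v)) has_real_derivative
      Determinant.det (matern_mat n u) * (\<Sum>i<n. log_deriv_mat n u $$ (i, i))) (at u)" .
  show "((\<lambda>v. ln (Determinant.det (matern_mat n v))) has_real_derivative (\<Sum>i<n. log_deriv_mat n u $$ (i, i))) (at u)"
    using DERIV_chain2[OF DERIV_ln_divide[OF p] d] p by simp
  show "((\<lambda>v. \<Sum>i<n. log_deriv_mat n v $$ (i, i)) has_real_derivative (\<Sum>i<n. log_deriv_mat' n u $$ (i, i))) (at u)"
    by (intro DERIV_sum has_mat_derivative_entry[OF matern_inv_derivative(2)[OF u, of 0]]) auto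
qed

lemma Sigma_mat_eq_kronecker_list:
  assumes pos: "\<forall>t\<in>{1..d}. 0 < \<theta> t"
  shows "Sigma_mat d n \<phi> \<theta> = ((pi / 2) ^ d * \<phi> ^ d) \<cdot>\<^sub>m kronecker_list (map (\<lambda>t. matern_mat n (\<theta> t)) [1..<Suc d])"
proof -
  have R: "R_mat (\<theta> t) n \<in> carrier_mat n n" for t by (simp add: R_mat_def)
  let ?A = "kronecker_list (map (\<lambda>t. R_mat (\<theta> t) n) [1..<Suc d])"
    and ?B = "kronecker_list (map (\<lambda>t. matern_mat n (\<theta> t)) [1..<Suc d])"
  have A: "?A \<in> carrier_mat (n ^ d) (n ^ d)" by (rule kronecker_list_carrier[OF R])
  have B: "?B \<in> carrier_mat (n ^ d) (n ^ d)" by (rule kronecker_list_carrier[OF matern_mat_carrier(1)])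
  show ?thesis
    unfolding Sigma_mat_def
  proof (rule eq_matI)
    fix I J assume "I < dim_row (((pi / 2) ^ d * \<phi> ^ d) \<cdot>\<^sub>m ?B)" "J < dim_col (((pi / 2) ^ d * \<phi> ^ d) \<cdot>\<^sub>m ?B)"
    then have IJ: "I < n ^ d" "J < n ^ d" using carrier_matD[OF B] by (simp_all del: upt_Suc)
    have dig: "digit n d t K < n" if "K < n ^ d" "t \<in> {1..d}" for t K
    proof -
      have "0 < n" using that by (cases n) (auto simp: zero_power)
      then show ?thesis by (rule digit_less)
    qed
    have e: "matern_mat n (\<theta> t) $$ (digit n d t I, digit n d t J)
        = R_mat (\<theta> t) n $$ (digit n d t I, digit n d t J) / \<theta> t ^ 3" if "t \<in> {1..d}" for t
      using dig[OF IJ(1) that] dig[OF IJ(2) that] carrier_matD[OF R, of t] by (simp add: matern_mat_def)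
    have "?B $$ (I, J) = (\<Prod>t\<in>{1..d}. matern_mat n (\<theta> t) $$ (digit n d t I, digit n d t J))"
      by (rule kronecker_list_entry[OF matern_mat_carrier(1) IJ])
    also have "\<dots> = (\<Prod>t\<in>{1..d}. R_mat (\<theta> t) n $$ (digit n d t I, digit n d t J) / \<theta> t ^ 3)"
      by (intro prod.cong refl e)
    also have "\<dots> = ?A $$ (I, J) / (\<Prod>t\<in>{1..d}. \<theta> t ^ 3)"
      unfolding prod_dividef kronecker_list_entry[OF R IJ] ..
    finally show "((pi ^ d * \<phi> ^ d / (2 ^ d * (\<Prod>t=1..d. \<theta> t ^ 3))) \<cdot>\<^sub>m ?A) $$ (I, J) = (((pi / 2) ^ d * \<phi> ^ d) \<cdot>\<^sub>m ?B) $$ (I, J)"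
      using IJ carrier_matD[OF A] carrier_matD[OF B] by (simp add: power_divide del: upt_Suc)
  qed (use carrier_matD[OF A] carrier_matD[OF B] in \<open>simp_all del: upt_Suc\<close>)
qed

section \<open>Factorisation of the Gaussian model over the parameters\<close>

context
  fixes d n :: nat
  assumes n: "0 < n"
begin

abbreviation (input) "cst \<equiv> (pi / 2 :: real) ^ d"

lemma digit_lt: "digit n d t I < n"
  using n by (rule digit_less)

lemma Sigma_mat_carrier:
  assumes pos: "\<forall>t\<in>{1..d}. 0 < \<theta> t"
  shows "Sigma_mat d n \<phi> \<theta> \<in> carrier_mat (n ^ d) (n ^ d)"
  unfolding Sigma_mat_eq_kronecker_list[OF pos]
  by (rule smult_carrier_mat[OF kronecker_list_carrier[OF matern_mat_carrier(1)]])

lemma Sigma_mat_entry: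
  assumes pos: "\<forall>t\<in>{1..d}. 0 < \<theta> t" and IJ: "I < n ^ d" "J < n ^ d"
  shows "Sigma_mat d n \<phi> \<theta> $$ (I, J)
    = cst * \<phi> ^ d * (\<Prod>t\<in>{1..d}. matern_mat n (\<theta> t) $$ (digit n d t I, digit n d t J))"
proof -
  let ?B = "kronecker_list (map (\<lambda>t. matern_mat n (\<theta> t)) [1..<Suc d])"
  have B: "?B \<in> carrier_mat (n ^ d) (n ^ d)" by (rule kronecker_list_carrier[OF matern_mat_carrier(1)])
  show ?thesis
    unfolding Sigma_mat_eq_kronecker_list[OF pos]
    using kronecker_list_entry[OF matern_mat_carrier(1) IJ, of \<theta>] IJ carrier_matD[OF B] by (simp del: upt_Suc)
qed

lemma det_Sigma_mat:
  assumes pos: "\<forall>t\<in>{1..d}. 0 < \<theta> t"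
  shows "Determinant.det (Sigma_mat d n \<phi> \<theta>)
    = (cst * \<phi> ^ d) ^ n ^ d * (\<Prod>t\<in>{1..d}. Determinant.det (matern_mat n (\<theta> t)) ^ n ^ (d - 1))"
proof -
  let ?B = "kronecker_list (map (\<lambda>t. matern_mat n (\<theta> t)) [1..<Suc d])"
  have B: "?B \<in> carrier_mat (n ^ d) (n ^ d)" by (rule kronecker_list_carrier[OF matern_mat_carrier(1)])
  show ?thesis
    unfolding Sigma_mat_eq_kronecker_list[OF pos] det_smult carrier_matD(2)[OF B]
    by (simp only: det_kronecker_list[OF matern_mat_carrier(1)])
qed

text \<open>The candidate is checked by multiplication: the sum over the middle index factors into
  one sum per digit, each a Kronecker delta, and two indices with equal digits are equal.\<close>

lemma inverse_Sigma_mat: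
  assumes pos: "\<forall>t\<in>{1..d}. 0 < \<theta> t" and \<phi>: "0 < \<phi>"
  shows "inverse_mat (Sigma_mat d n \<phi> \<theta>) = mat (n ^ d) (n ^ d) (\<lambda>(I, J). 1 / (cst * \<phi> ^ d)
    * (\<Prod>t\<in>{1..d}. matern_inv n 0 (\<theta> t) $$ (digit n d t I, digit n d t J)))" (is "_ = ?V")
proof (rule inverse_mat_unique[OF Sigma_mat_carrier[OF pos]])
  show V: "?V \<in> carrier_mat (n ^ d) (n ^ d)" by simp
  let ?K = "\<lambda>t. matern_mat n (\<theta> t)" and ?J = "\<lambda>t. matern_inv n 0 (\<theta> t)" and ?g = "digit n d"
  show "Sigma_mat d n \<phi> \<theta> * ?V = 1\<^sub>m (n ^ d)"
  proof (rule eq_matI)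
    fix I J assume "I < dim_row (1\<^sub>m (n ^ d) :: real mat)" "J < dim_col (1\<^sub>m (n ^ d) :: real mat)"
    then have IJ: "I < n ^ d" "J < n ^ d" by auto
    have "(Sigma_mat d n \<phi> \<theta> * ?V) $$ (I, J) = (\<Sum>L<n ^ d. Sigma_mat d n \<phi> \<theta> $$ (I, L) * ?V $$ (L, J))"
      by (rule times_mat_entry[OF Sigma_mat_carrier[OF pos] V IJ])
    also have "\<dots> = (\<Sum>L<n ^ d. \<Prod>t\<in>{1..d}. ?K t $$ (?g t I, ?g t L) * ?J t $$ (?g t L, ?g t J))"
      using IJ \<phi> by (intro sum.cong refl) (simp add: Sigma_mat_entry[OF pos] prod.distrib)
    also have "\<dots> = (\<Prod>t\<in>{1..d}. \<Sum>l<n. ?K t $$ (?g t I, l) * ?J t $$ (l, ?g t J))"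
      by (rule sum_prod_digits)
    also have "\<dots> = (\<Prod>t\<in>{1..d}. if ?g t I = ?g t J then 1 else 0)"
    proof (intro prod.cong refl)
      fix t assume t: "t \<in> {1..d}"
      note J = matern_inv_0[OF bspec[OF pos t], of n]
      have "(\<Sum>l<n. ?K t $$ (?g t I, l) * ?J t $$ (l, ?g t J)) = (?K t * ?J t) $$ (?g t I, ?g t J)"
        by (rule times_mat_entry[OF matern_mat_carrier(1) J(1) digit_lt digit_lt, symmetric])
      then show "(\<Sum>l<n. ?K t $$ (?g t I, l) * ?J t $$ (l, ?g t J)) = (if ?g t I = ?g t J then 1 else 0)"
        using digit_lt by (simp add: J(3) del: index_mult_mat)
    qed
    also have "\<dots> = (if I = J then 1 else 0)"
    proof (cases "I = J")
      case False
      then obtain t where "t \<in> {1..d}" "?g t I \<noteq> ?g t J" using digits_inject[OF IJ] by blast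
      then show ?thesis using False by (intro trans[OF prod_zero]) auto
    qed simp
    finally show "(Sigma_mat d n \<phi> \<theta> * ?V) $$ (I, J) = 1\<^sub>m (n ^ d) $$ (I, J)" using IJ by simp
  qed (use carrier_matD[OF Sigma_mat_carrier[OF pos]] in simp_all)
qed

definition phi_factor :: "nat \<Rightarrow> real \<Rightarrow> real" where
  "phi_factor m u = (if m = 0 then 1 / u ^ d else if m = 1 then - real d / u ^ (d + 1) else real d * (real d + 1) / u ^ (d + 2))"

lemma phi_factor_derivative:
  assumes u: "0 < u" and m: "m < 2"
  shows "(phi_factor m has_real_derivative phi_factor (Suc m) u) (at u)"
proof -
  have D: "((\<lambda>v. 1 / v ^ k) has_real_derivative - real k / u ^ (k + 1)) (at u)" for k
  proof -
    have "real k * u ^ (k - Suc 0) / (u ^ k * u ^ k) = real k / (u * u ^ k)"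
      using u by (cases k) (auto simp: field_simps)
    then show ?thesis
      using u by (auto intro!: derivative_eq_intros)
  qed
  have "((\<lambda>v. - real d * (1 / v ^ (d + 1))) has_real_derivative - real d * (- real (d + 1) / u ^ (d + 1 + 1))) (at u)"
    by (intro DERIV_cmult D)
  then have "((\<lambda>v. - real d / v ^ (d + 1)) has_real_derivative real d * (real d + 1) / u ^ (d + 2)) (at u)"
    by (simp add: algebra_simps)
  then have D1: "(phi_factor 1 has_real_derivative phi_factor (Suc 1) u) (at u)"
    by (simp add: phi_factor_def[abs_def])
  have D0: "(phi_factor 0 has_real_derivative phi_factor (Suc 0) u) (at u)"
    using D[of d] by (simp add: phi_factor_def[abs_def])
  show ?thesis using D0 D1 m by (cases m) (auto simp: less_Suc_eq numeral_2_eq_2)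
qed

text \<open>
  The inverse covariance matrix is \<open>\<phi>\<^sup>-\<^sup>d\<close> times a Kronecker product, so each of its entries is a product of
  functions of one parameter each; \<open>factor IJ t m\<close> is the \<open>m\<close>-th derivative of the one depending on parameter \<open>t\<close>.
\<close>

definition factor :: "nat \<times> nat \<Rightarrow> nat \<Rightarrow> nat \<Rightarrow> real \<Rightarrow> real" where
  "factor IJ t m u = (if t = 0 then phi_factor m u else matern_inv n m u $$ (digit n d t (fst IJ), digit n d t (snd IJ)))"

lemma factor_derivative:
  assumes "0 < u" "m < 2"
  shows "(factor IJ t m has_real_derivative factor IJ t (Suc m) u) (at u)"
  using phi_factor_derivative[OF assms] has_mat_derivative_entry[OF matern_inv_derivative(1)[OF assms] digit_lt digit_lt]
  by (cases "t = 0") (auto simp: factor_def[abs_def])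

text \<open>The part of \<open>- 1/2\<close> times the log-determinant that depends on coordinate
  \<open>t\<close>. Each one-dimensional determinant enters a \<open>d\<close>-fold Kronecker
  product with exponent \<open>n ^ (d - 1)\<close>, and \<phi> enters with exponent
  \<open>d * n ^ d\<close>.\<close>

definition logdet :: "nat \<Rightarrow> real \<Rightarrow> real" where
  "logdet t u = (if t = 0 then - (real (n ^ d) * real d / 2) * ln u
     else - (real (n ^ (d - 1)) / 2) * ln (Determinant.det (matern_mat n u)))"

definition logdet' :: "nat \<Rightarrow> real \<Rightarrow> real" where
  "logdet' t u = (if t = 0 then - (real (n ^ d) * real d / 2) * (1 / u)
     else - (real (n ^ (d - 1)) / 2) * (\<Sum>i<n. log_deriv_mat n u $$ (i, i)))"

definition logdet'' :: "nat \<Rightarrow> real \<Rightarrow> real" where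
  "logdet'' t u = (if t = 0 then real (n ^ d) * real d / (2 * u ^ 2)
     else - (real (n ^ (d - 1)) / 2) * (\<Sum>i<n. log_deriv_mat' n u $$ (i, i)))"

lemma logdet_derivative:
  assumes u: "0 < u"
  shows "(logdet t has_real_derivative logdet' t u) (at u)" "(logdet' t has_real_derivative logdet'' t u) (at u)"
proof -
  show "(logdet t has_real_derivative logdet' t u) (at u)"
  proof (cases "t = 0")
    case True
    have "((\<lambda>v. - (real (n ^ d) * real d / 2) * ln v) has_real_derivative - (real (n ^ d) * real d / 2) * (1 / u)) (at u)"
      using u by (intro DERIV_cmult) (auto intro!: derivative_eq_intros)
    then show ?thesis using True by (simp only: logdet_def[abs_def] logdet'_def simp_thms if_True)
  next
    case False
    then show ?thesis
      using DERIV_cmult[OF ln_det_matern_mat_derivative(1)[OF u]] by (simp only: logdet_def[abs_def] logdet'_def if_False)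
  qed
  show "(logdet' t has_real_derivative logdet'' t u) (at u)"
  proof (cases "t = 0")
    case True
    have "((\<lambda>v. - (real (n ^ d) * real d / 2) * (1 / v)) has_real_derivative - (real (n ^ d) * real d / 2) * (- (1 / u ^ 2))) (at u)"
      using u by (intro DERIV_cmult) (auto intro!: derivative_eq_intros simp: power2_eq_square)
    moreover have "- (real (n ^ d) * real d / 2) * (- (1 / u ^ 2)) = real (n ^ d) * real d / (2 * u ^ 2)"
      by simp
    ultimately show ?thesis using True by (simp only: logdet'_def[abs_def] logdet''_def simp_thms if_True)
  next
    case False
    then show ?thesis
      using DERIV_cmult[OF ln_det_matern_mat_derivative(2)[OF u]] by (simp only: logdet'_def[abs_def] logdet''_def if_False)
  qed
qed

text \<open>The separated form demanded by \<open>second_partial_sum_of_products\<close>, with the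
  observation confined to the weights. It is proved for all positive parameters, since the
  likelihood is differentiated around the true one.\<close>

lemma log_likelihood_eq:
  assumes x: "x \<in> carrier_vec (n ^ d)" and q: "\<And>t. t \<in> {0..d} \<Longrightarrow> 0 < q t"
  shows "log_likelihood d n q x = - (real (n ^ d) / 2) * (ln (2 * pi) + ln cst) + (\<Sum>t\<in>{0..d}. logdet t (q t))
    + (\<Sum>IJ\<in>{..<n ^ d} \<times> {..<n ^ d}. - (vec_index x (fst IJ) * vec_index x (snd IJ)) / (2 * cst) * (\<Prod>t\<in>{0..d}. factor IJ t 0 (q t)))"
proof -
  have pos: "\<forall>t\<in>{1..d}. 0 < q t" and q0: "0 < q 0" using q by auto
  let ?N = "n ^ d" and ?D = "Determinant.det (Sigma_mat d n (q 0) q)"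
    and ?Q = "scalar_prod x (inverse_mat (Sigma_mat d n (q 0) q) *\<^sub>v x)"
  have T: "{0..d} = insert 0 {1..d}" by auto
  have cst: "0 < cst" by simp
  have dp: "0 < Determinant.det (matern_mat n (q t))" if "t \<in> {1..d}" for t
    by (rule det_matern_mat_pos[OF bspec[OF pos that]])
  have dp': "Determinant.det (matern_mat n (q t)) \<noteq> 0" if "t \<in> {1..d}" for t
    using dp[OF that] by simp
  have D: "?D = (cst * q 0 ^ d) ^ ?N * (\<Prod>t\<in>{1..d}. Determinant.det (matern_mat n (q t)) ^ n ^ (d - 1))"
    by (rule det_Sigma_mat[OF pos])
  have k0: "0 < cst * q 0 ^ d" using q0 cst by simp
  have kN: "0 < (cst * q 0 ^ d) ^ ?N" by (rule zero_less_power[OF k0])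
  have dN: "0 < (\<Prod>t\<in>{1..d}. Determinant.det (matern_mat n (q t)) ^ n ^ (d - 1))"
    by (intro prod_pos zero_less_power dp)
  have Dp: "0 < ?D" unfolding D by (rule mult_pos_pos[OF kN dN])
  have "ln ?D = ln ((cst * q 0 ^ d) ^ ?N) + ln (\<Prod>t\<in>{1..d}. Determinant.det (matern_mat n (q t)) ^ n ^ (d - 1))"
    unfolding D by (rule ln_mult_pos[OF kN dN])
  also have "ln ((cst * q 0 ^ d) ^ ?N) = ?N * (ln cst + d * ln (q 0))"
    unfolding ln_realpow using q0 cst by (simp add: ln_mult_pos ln_realpow del: power_divide)
  also have "ln (\<Prod>t\<in>{1..d}. Determinant.det (matern_mat n (q t)) ^ n ^ (d - 1))
      = (\<Sum>t\<in>{1..d}. ln (Determinant.det (matern_mat n (q t)) ^ n ^ (d - 1)))"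
    using dp dp' by (intro ln_prod) auto
  also have "\<dots> = (\<Sum>t\<in>{1..d}. n ^ (d - 1) * ln (Determinant.det (matern_mat n (q t))))"
    by (intro sum.cong refl ln_realpow)
  finally have lnD: "- (1 / 2) * ln ?D = - (?N / 2) * ln cst + (\<Sum>t\<in>{0..d}. logdet t (q t))"
    unfolding T by (simp add: logdet_def sum_distrib_left algebra_simps)
  have "?Q = (\<Sum>I<?N. \<Sum>J<?N. vec_index x I * vec_index x J * (1 / (cst * q 0 ^ d)
      * (\<Prod>t\<in>{1..d}. matern_inv n 0 (q t) $$ (digit n d t I, digit n d t J))))"
    unfolding inverse_Sigma_mat[OF pos q0] using x
    by (auto simp: scalar_prod_def atLeast0LessThan sum_distrib_left mult_ac intro!: sum.cong)
  also have "\<dots> = (\<Sum>I<?N. \<Sum>J<?N. vec_index x I * vec_index x J / cst * (\<Prod>t\<in>{0..d}. factor (I, J) t 0 (q t)))"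
    unfolding T by (intro sum.cong refl) (simp add: factor_def phi_factor_def)
  also have "\<dots> = (\<Sum>IJ\<in>{..<?N} \<times> {..<?N}. vec_index x (fst IJ) * vec_index x (snd IJ) / cst * (\<Prod>t\<in>{0..d}. factor IJ t 0 (q t)))"
    by (simp add: sum.cartesian_product split_def)
  finally have Q: "- ?Q / 2 = (\<Sum>IJ\<in>{..<?N} \<times> {..<?N}. - (vec_index x (fst IJ) * vec_index x (snd IJ)) / (2 * cst) * (\<Prod>t\<in>{0..d}. factor IJ t 0 (q t)))"
    by (simp add: sum_divide_distrib sum_negf[symmetric] mult.commute)
  have "log_likelihood d n q x = ln ((2 * pi) powr (- real ?N / 2) * ?D powr (- 1 / 2) * exp (- ?Q / 2))"
    by (simp add: log_likelihood_def likelihood_def)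
  also have "\<dots> = - (?N / 2) * ln (2 * pi) + - (1 / 2) * ln ?D + - ?Q / 2"
    using Dp by (simp add: ln_mult_pos ln_powr)
  finally show ?thesis unfolding lnD Q by (simp add: algebra_simps)
qed

text \<open>Taking expectations replaces \<open>x_I * x_J\<close> by a covariance entry, and the
  result is the trace of the covariance against the twice differentiated inverse. Both are products
  over digits, so this trace is a product of one-dimensional ones; differentiation only changes the
  orders \<open>\<mu> t\<close>.\<close>

lemma fisher_info_log_likelihood:
  fixes X :: "'a \<Rightarrow> real Matrix.vec"
  assumes X: "multivariate_normal M X (0\<^sub>v (n ^ d)) (Sigma_mat d n \<phi> \<theta>)"
    and \<phi>: "0 < \<phi>" and \<theta>: "\<forall>t\<in>{1..d}. 0 < \<theta> t"
    and ij: "i \<in> {0..d}" "j \<in> {0..d}"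
  defines "\<mu> \<equiv> \<lambda>t. (if t = i then 1 else 0) + (if t = j then 1 else 0 :: nat)"
  shows "fisher_info_exists M X (log_likelihood d n) (param \<phi> \<theta>) i j"
    and "fisher_info M X (log_likelihood d n) (param \<phi> \<theta>) i j
      = \<phi> ^ d * phi_factor (\<mu> 0) \<phi> * (\<Prod>t\<in>{1..d}. \<Sum>k<n. (matern_inv n (\<mu> t) (\<theta> t) * matern_mat n (\<theta> t)) $$ (k, k)) / 2
        - (if i = j then logdet'' i (param \<phi> \<theta> i) else 0)"
proof -
  let ?p = "param \<phi> \<theta>" and ?N = "n ^ d" and ?S = "{..<n ^ d} \<times> {..<n ^ d}" and ?\<Sigma> = "Sigma_mat d n \<phi> \<theta>"
  let ?A = "if i = j then logdet'' i (?p i) else 0"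
  define P where "P IJ = (\<Prod>t\<in>{0..d}. factor IJ t (\<mu> t) (?p t))" for IJ
  have pr: "prob_space M" and XM: "\<And>\<omega>. \<omega> \<in> space M \<Longrightarrow> X \<omega> \<in> carrier_vec ?N"
    using X unfolding multivariate_normal_def by auto
  interpret prob_space M by fact
  have p: "0 < ?p t" if "t \<in> {0..d}" for t using \<phi> \<theta> that by (auto simp: param_def)
  have cst: "0 < cst" by simp
  have sec: "second_partial_exists i j (\<lambda>q. log_likelihood d n q (X \<omega>)) ?p"
    "partial_deriv i (partial_deriv j (\<lambda>q. log_likelihood d n q (X \<omega>))) ?p
      = ?A + (\<Sum>IJ\<in>?S. - (vec_index (X \<omega>) (fst IJ) * vec_index (X \<omega>) (snd IJ)) / (2 * cst) * P IJ)"
    if w: "\<omega> \<in> space M" for \<omega>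
    unfolding P_def \<mu>_def
    by (rule second_partial_sum_of_products[where T = "{0..d}" and S = ?S and a = logdet and a' = logdet' and a'' = logdet''
          and H = factor and c = "- (real ?N / 2) * (ln (2 * pi) + ln cst)"
          and w = "\<lambda>IJ. - (vec_index (X \<omega>) (fst IJ) * vec_index (X \<omega>) (snd IJ)) / (2 * cst)"];
        (rule log_likelihood_eq[OF XM[OF w]] logdet_derivative factor_derivative p ij finite_atLeastAtMost; assumption)?)+
  have sym: "?\<Sigma> $$ (I, J) = ?\<Sigma> $$ (J, I)" if "I < ?N" "J < ?N" for I J
    using that by (simp add: Sigma_mat_entry[OF \<theta>] matern_mat_symmetric[OF digit_lt digit_lt])
  have nonneg: "0 \<le> ?\<Sigma> $$ (I, J)" if "I < ?N" "J < ?N" for I J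
  proof -
    have "0 \<le> matern_mat n (\<theta> t) $$ (digit n d t I, digit n d t J)" if "t \<in> {1..d}" for t
      using bspec[OF \<theta> that] by (simp add: matern_mat_entry[OF digit_lt digit_lt])
    then show ?thesis
      unfolding Sigma_mat_entry[OF \<theta> that] using \<phi> by (intro mult_nonneg_nonneg prod_nonneg) auto
  qed
  note mom = multivariate_normal_second_moment[OF X Sigma_mat_carrier[OF \<theta>] sym nonneg]
  have int1: "integrable M (\<lambda>\<omega>. - (vec_index (X \<omega>) (fst IJ) * vec_index (X \<omega>) (snd IJ)) / (2 * cst) * P IJ)" if "IJ \<in> ?S" for IJ
    using that by (intro integrable_mult_left integrable_divide integrable_minus mom) auto
  have int: "integrable M (\<lambda>\<omega>. ?A + (\<Sum>IJ\<in>?S. - (vec_index (X \<omega>) (fst IJ) * vec_index (X \<omega>) (snd IJ)) / (2 * cst) * P IJ))"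
    by (intro Bochner_Integration.integrable_add Bochner_Integration.integrable_sum int1) auto
  have "integrable M (\<lambda>\<omega>. partial_deriv i (partial_deriv j (\<lambda>q. log_likelihood d n q (X \<omega>))) ?p)"
    using int by (rule Bochner_Integration.integrable_cong[THEN iffD1, rotated 2]) (auto simp: sec(2))
  then show "fisher_info_exists M X (log_likelihood d n) ?p i j"
    using sec(1) by (auto simp: fisher_info_exists_def)
  have "(\<integral>\<omega>. partial_deriv i (partial_deriv j (\<lambda>q. log_likelihood d n q (X \<omega>))) ?p \<partial>M)
      = (\<integral>\<omega>. ?A + (\<Sum>IJ\<in>?S. - (vec_index (X \<omega>) (fst IJ) * vec_index (X \<omega>) (snd IJ)) / (2 * cst) * P IJ) \<partial>M)"
    by (rule Bochner_Integration.integral_cong) (auto simp: sec(2))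
  also have "\<dots> = ?A + (\<Sum>IJ\<in>?S. (\<integral>\<omega>. - (vec_index (X \<omega>) (fst IJ) * vec_index (X \<omega>) (snd IJ)) / (2 * cst) * P IJ \<partial>M))"
  proof -
    have "integrable M (\<lambda>\<omega>. \<Sum>IJ\<in>?S. - (vec_index (X \<omega>) (fst IJ) * vec_index (X \<omega>) (snd IJ)) / (2 * cst) * P IJ)"
      by (intro Bochner_Integration.integrable_sum int1)
    then show ?thesis
      by (simp only: Bochner_Integration.integral_add[OF integrable_const] Bochner_Integration.integral_sum[OF int1]
          lebesgue_integral_const prob_space scaleR_one)
  qed
  also have "(\<Sum>IJ\<in>?S. (\<integral>\<omega>. - (vec_index (X \<omega>) (fst IJ) * vec_index (X \<omega>) (snd IJ)) / (2 * cst) * P IJ \<partial>M))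
      = (\<Sum>IJ\<in>?S. - ?\<Sigma> $$ (fst IJ, snd IJ) / (2 * cst) * P IJ)"
  proof (intro sum.cong refl)
    fix IJ assume IJ: "IJ \<in> ?S"
    have "(\<integral>\<omega>. - (vec_index (X \<omega>) (fst IJ) * vec_index (X \<omega>) (snd IJ)) / (2 * cst) * P IJ \<partial>M)
        = (\<integral>\<omega>. vec_index (X \<omega>) (fst IJ) * vec_index (X \<omega>) (snd IJ) * (- P IJ / (2 * cst)) \<partial>M)"
      by (intro Bochner_Integration.integral_cong) auto
    also have "\<dots> = ?\<Sigma> $$ (fst IJ, snd IJ) * (- P IJ / (2 * cst))"
      using mom(2)[of "fst IJ" "snd IJ"] IJ by (simp only: integral_mult_left_zero) auto
    finally show "(\<integral>\<omega>. - (vec_index (X \<omega>) (fst IJ) * vec_index (X \<omega>) (snd IJ)) / (2 * cst) * P IJ \<partial>M)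
        = - ?\<Sigma> $$ (fst IJ, snd IJ) / (2 * cst) * P IJ" by simp
  qed
  also have "\<dots> = (\<Sum>I<?N. \<Sum>J<?N. - ?\<Sigma> $$ (I, J) / (2 * cst) * P (I, J))"
    by (simp add: sum.cartesian_product split_def)
  also have "\<dots> = (\<Sum>I<?N. \<Sum>J<?N. - (\<phi> ^ d * phi_factor (\<mu> 0) \<phi> / 2) * (\<Prod>t\<in>{1..d}. matern_mat n (\<theta> t) $$ (digit n d t I, digit n d t J)
      * matern_inv n (\<mu> t) (\<theta> t) $$ (digit n d t I, digit n d t J)))"
  proof (intro sum.cong refl)
    fix I J assume "I \<in> {..<?N}" "J \<in> {..<?N}"
    then have IJ: "I < ?N" "J < ?N" by auto
    have "{0..d} = insert 0 {1..d}" by auto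
    then have "P (I, J) = phi_factor (\<mu> 0) \<phi> * (\<Prod>t\<in>{1..d}. matern_inv n (\<mu> t) (\<theta> t) $$ (digit n d t I, digit n d t J))"
      by (simp add: P_def factor_def param_def)
    then show "- ?\<Sigma> $$ (I, J) / (2 * cst) * P (I, J) = - (\<phi> ^ d * phi_factor (\<mu> 0) \<phi> / 2) * (\<Prod>t\<in>{1..d}. matern_mat n (\<theta> t) $$ (digit n d t I, digit n d t J)
      * matern_inv n (\<mu> t) (\<theta> t) $$ (digit n d t I, digit n d t J))"
      using cst by (simp add: Sigma_mat_entry[OF \<theta> IJ] prod.distrib)
  qed
  also have "\<dots> = - (\<phi> ^ d * phi_factor (\<mu> 0) \<phi> / 2) * (\<Sum>I<?N. \<Sum>J<?N. \<Prod>t\<in>{1..d}. matern_mat n (\<theta> t) $$ (digit n d t I, digit n d t J)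
      * matern_inv n (\<mu> t) (\<theta> t) $$ (digit n d t I, digit n d t J))"
    by (simp only: sum_distrib_left)
  also have "(\<Sum>I<?N. \<Sum>J<?N. \<Prod>t\<in>{1..d}. matern_mat n (\<theta> t) $$ (digit n d t I, digit n d t J)
      * matern_inv n (\<mu> t) (\<theta> t) $$ (digit n d t I, digit n d t J))
    = (\<Sum>I<?N. \<Prod>t\<in>{1..d}. \<Sum>l<n. matern_mat n (\<theta> t) $$ (digit n d t I, l) * matern_inv n (\<mu> t) (\<theta> t) $$ (digit n d t I, l))"
    by (intro sum.cong refl sum_prod_digits)
  also have "\<dots> = (\<Prod>t\<in>{1..d}. \<Sum>k<n. \<Sum>l<n. matern_mat n (\<theta> t) $$ (k, l) * matern_inv n (\<mu> t) (\<theta> t) $$ (k, l))"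
    by (rule sum_prod_digits)
  also have "\<dots> = (\<Prod>t\<in>{1..d}. \<Sum>k<n. (matern_inv n (\<mu> t) (\<theta> t) * matern_mat n (\<theta> t)) $$ (k, k))"
  \<comment> \<open>The entrywise product of two matrices becomes a trace by the symmetry of
    \<open>matern_mat\<close>.\<close>
  proof (intro prod.cong refl sum.cong)
    fix t k assume t: "t \<in> {1..d}" and k: "k \<in> {..<n}"
    have "\<mu> t = 0 \<or> \<mu> t = 1 \<or> \<mu> t = Suc 1" by (auto simp: \<mu>_def)
    then have c: "matern_inv n (\<mu> t) (\<theta> t) \<in> carrier_mat n n"
      using matern_inv_0(1)[OF bspec[OF \<theta> t]] matern_inv_1_carrier[OF bspec[OF \<theta> t]] matern_inv_2_carrier[OF bspec[OF \<theta> t]] by metis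
    have k': "k < n" using k by simp
    show "(\<Sum>l<n. matern_mat n (\<theta> t) $$ (k, l) * matern_inv n (\<mu> t) (\<theta> t) $$ (k, l))
        = (matern_inv n (\<mu> t) (\<theta> t) * matern_mat n (\<theta> t)) $$ (k, k)"
      unfolding times_mat_entry[OF c matern_mat_carrier(1) k' k']
      using k' by (intro sum.cong refl) (simp add: mult.commute matern_mat_symmetric[of k])
  qed
  finally show "fisher_info M X (log_likelihood d n) ?p i j
      = \<phi> ^ d * phi_factor (\<mu> 0) \<phi> * (\<Prod>t\<in>{1..d}. \<Sum>k<n. (matern_inv n (\<mu> t) (\<theta> t) * matern_mat n (\<theta> t)) $$ (k, k)) / 2 - ?A"
    by (simp add: fisher_info_def)
qed

text \<open>Every undifferentiated coordinate contributes a factor \<open>n\<close>, so one or two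
  differentiated \<theta> coordinates leave \<open>n ^ (d - 1)\<close> or
  \<open>n ^ (d - 2)\<close>. In the \<phi> entry \<open>d * (d + 1)\<close> from the quadratic form
  minus \<open>d\<close> from the log-determinant gives \<open>d ^ 2\<close>.\<close>

lemma fisher_info_values:
  fixes X :: "'a \<Rightarrow> real Matrix.vec"
  assumes X: "multivariate_normal M X (0\<^sub>v (n ^ d)) (Sigma_mat d n \<phi> \<theta>)"
    and \<phi>: "0 < \<phi>" and \<theta>: "\<forall>t\<in>{1..d}. 0 < \<theta> t"
  defines "F \<equiv> fisher_info M X (log_likelihood d n) (param \<phi> \<theta>)"
    and "\<tau> \<equiv> \<lambda>t. \<Sum>i<n. log_deriv_mat n (\<theta> t) $$ (i, i)"
  shows "F 0 0 = real d ^ 2 * real n ^ d / (2 * \<phi> ^ 2)"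
    and "t \<in> {1..d} \<Longrightarrow> F t t = real n ^ (d - 1) / 2 * (\<Sum>i<n. (log_deriv_mat n (\<theta> t) * log_deriv_mat n (\<theta> t)) $$ (i, i))"
    and "t \<in> {1..d} \<Longrightarrow> F 0 t = real d * real n ^ (d - 1) / (2 * \<phi>) * \<tau> t"
    and "s \<in> {1..d} \<Longrightarrow> t \<in> {1..d} \<Longrightarrow> s \<noteq> t \<Longrightarrow> F s t = real n ^ (d - 2) / 2 * \<tau> s * \<tau> t"
proof -
  let ?tr = "\<lambda>m t. \<Sum>k<n. (matern_inv n m (\<theta> t) * matern_mat n (\<theta> t)) $$ (k, k)"
  have tr: "?tr 0 t = n" "?tr 1 t = - \<tau> t" "?tr (Suc 1) t = (\<Sum>i<n. (log_deriv_mat n (\<theta> t) * log_deriv_mat n (\<theta> t)) $$ (i, i))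
      - (\<Sum>i<n. log_deriv_mat' n (\<theta> t) $$ (i, i))" if "t \<in> {1..d}" for t
    using trace_matern_inv[OF bspec[OF \<theta> that], of n] by (simp_all only: \<tau>_def)
  have info: "F i j = \<phi> ^ d * phi_factor ((if 0 = i then 1 else 0) + (if 0 = j then 1 else 0)) \<phi>
      * (\<Prod>t\<in>{1..d}. ?tr ((if t = i then 1 else 0) + (if t = j then 1 else 0)) t) / 2
      - (if i = j then logdet'' i (param \<phi> \<theta> i) else 0)" if "i \<in> {0..d}" "j \<in> {0..d}" for i j
    unfolding F_def by (rule fisher_info_log_likelihood(2)[OF X \<phi> \<theta> that])
  have one: "(\<Prod>t\<in>{1..d}. ?tr (\<mu> t) t) = real n ^ d" if "\<And>t. t \<in> {1..d} \<Longrightarrow> \<mu> t = 0" for \<mu>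
  proof -
    have "(\<Prod>t\<in>{1..d}. ?tr (\<mu> t) t) = (\<Prod>t\<in>{1..d}. real n)"
      by (intro prod.cong refl) (simp only: that tr)
    then show ?thesis by simp
  qed
  have two: "(\<Prod>t\<in>{1..d}. ?tr (\<mu> t) t) = ?tr (\<mu> s) s * real n ^ (d - 1)"
    if "s \<in> {1..d}" "\<And>t. t \<in> {1..d} \<Longrightarrow> t \<noteq> s \<Longrightarrow> \<mu> t = 0" for \<mu> s
  proof -
    have "(\<Prod>t\<in>{1..d} - {s}. ?tr (\<mu> t) t) = (\<Prod>t\<in>{1..d} - {s}. real n)"
    proof (intro prod.cong refl)
      fix t assume "t \<in> {1..d} - {s}"
      then show "?tr (\<mu> t) t = real n" using that(2)[of t] tr(1)[of t] by simp
    qed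
    also have "\<dots> = real n ^ (d - 1)" using that(1) by simp
    finally show ?thesis using that(1) by (subst prod.remove[of _ s]) auto
  qed
  have three: "(\<Prod>t\<in>{1..d}. ?tr (\<mu> t) t) = ?tr (\<mu> r) r * ?tr (\<mu> s) s * real n ^ (d - 2)"
    if "r \<in> {1..d}" "s \<in> {1..d}" "r \<noteq> s" "\<And>t. t \<in> {1..d} \<Longrightarrow> t \<noteq> r \<Longrightarrow> t \<noteq> s \<Longrightarrow> \<mu> t = 0" for \<mu> r s
  proof -
    have "(\<Prod>t\<in>{1..d} - {r} - {s}. ?tr (\<mu> t) t) = (\<Prod>t\<in>{1..d} - {r} - {s}. real n)"
    proof (intro prod.cong refl)
      fix t assume "t \<in> {1..d} - {r} - {s}"
      then show "?tr (\<mu> t) t = real n" using that(4)[of t] tr(1)[of t] by simp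
    qed
    also have "\<dots> = real n ^ (d - 2)" using that by (simp add: card_Diff_singleton_if numeral_2_eq_2)
    finally have rest: "(\<Prod>t\<in>{1..d} - {r} - {s}. ?tr (\<mu> t) t) = real n ^ (d - 2)" .
    have "(\<Prod>t\<in>{1..d}. ?tr (\<mu> t) t) = ?tr (\<mu> r) r * (\<Prod>t\<in>{1..d} - {r}. ?tr (\<mu> t) t)"
      using that by (intro prod.remove) auto
    also have "(\<Prod>t\<in>{1..d} - {r}. ?tr (\<mu> t) t) = ?tr (\<mu> s) s * (\<Prod>t\<in>{1..d} - {r} - {s}. ?tr (\<mu> t) t)"
      using that by (intro prod.remove) auto
    finally show ?thesis unfolding rest by (simp only: mult.assoc)
  qed
  have h: "\<phi> ^ d * phi_factor 0 \<phi> = 1" "\<phi> ^ d * phi_factor 1 \<phi> = - real d / \<phi>" "\<phi> ^ d * phi_factor (1 + 1) \<phi> = real d * (real d + 1) / \<phi> ^ 2"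
    using \<phi> by (simp_all add: phi_factor_def power_add power2_eq_square)
  have "F 0 0 = \<phi> ^ d * phi_factor (1 + 1) \<phi> * real n ^ d / 2 - logdet'' 0 \<phi>"
    using info[of 0 0] one[of "\<lambda>t. (if t = 0 then 1 else 0) + (if t = 0 then 1 else 0)"] by (simp add: param_def)
  then show "F 0 0 = real d ^ 2 * real n ^ d / (2 * \<phi> ^ 2)"
    unfolding h using \<phi> by (simp add: logdet''_def field_simps power2_eq_square)
  show "F t t = real n ^ (d - 1) / 2 * (\<Sum>i<n. (log_deriv_mat n (\<theta> t) * log_deriv_mat n (\<theta> t)) $$ (i, i))" if t: "t \<in> {1..d}"
  proof -
    have "F t t = \<phi> ^ d * phi_factor 0 \<phi> * (?tr (Suc 1) t * real n ^ (d - 1)) / 2 - logdet'' t (\<theta> t)"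
      using info[of t t] two[OF t, of "\<lambda>x. (if x = t then 1 else 0) + (if x = t then 1 else 0)"] t by (simp add: param_def)
    then show ?thesis
      unfolding h tr(3)[OF t] using t by (simp add: logdet''_def algebra_simps del: index_mult_mat)
  qed
  show "F 0 t = real d * real n ^ (d - 1) / (2 * \<phi>) * \<tau> t" if t: "t \<in> {1..d}"
  proof -
    have "F 0 t = \<phi> ^ d * phi_factor 1 \<phi> * (?tr 1 t * real n ^ (d - 1)) / 2"
      using info[of 0 t] two[OF t, of "\<lambda>x. (if x = 0 then 1 else 0) + (if x = t then 1 else 0)"] t by simp
    then show ?thesis
      unfolding h tr(2)[OF t] by (simp add: mult_ac)
  qed
  show "F s t = real n ^ (d - 2) / 2 * \<tau> s * \<tau> t" if st: "s \<in> {1..d}" "t \<in> {1..d}" "s \<noteq> t"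
  proof -
    have "F s t = \<phi> ^ d * phi_factor 0 \<phi> * (?tr 1 s * ?tr 1 t * real n ^ (d - 2)) / 2"
      using info[of s t] three[OF st, of "\<lambda>x. (if x = s then 1 else 0) + (if x = t then 1 else 0)"] st by simp
    then show ?thesis
      unfolding h tr(2)[OF st(1)] tr(2)[OF st(2)] by simp
  qed
qed

end

theorem theorem8:
  fixes d :: nat and \<phi> :: real and \<theta> :: "nat \<Rightarrow> real"
    and M :: "nat \<Rightarrow> 'a measure" and X :: "nat \<Rightarrow> 'a \<Rightarrow> real vec"
    and I :: "nat \<Rightarrow> nat \<Rightarrow> nat \<Rightarrow> real"
  assumes "1 \<le> d" and "0 < \<phi>" and "\<And>t. t \<in> {1..d} \<Longrightarrow> 0 < \<theta> t"
    and "\<And>n. 1 \<le> n \<Longrightarrow> multivariate_normal (M n) (X n) (0\<^sub>v (n ^ d)) (Sigma_mat d n \<phi> \<theta>)"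
  defines "I \<equiv> \<lambda>n. fisher_info (M n) (X n) (log_likelihood d n) (param \<phi> \<theta>)"
  shows "(\<forall>n\<ge>1. \<forall>i\<in>{0..d}. \<forall>j\<in>{0..d}.
            fisher_info_exists (M n) (X n) (log_likelihood d n) (param \<phi> \<theta>) i j)
    \<and> (\<forall>n\<ge>1. I n 0 0 = real d ^ 2 * real n ^ d / (2 * \<phi> ^ 2))
    \<and> (\<forall>t\<in>{1..d}. (\<lambda>n. I n t t - real n ^ (d - 1) * (2 * \<theta> t + 5) / \<theta> t ^ 2)
            \<in> O(\<lambda>n. real n powr (real d - 2)))
    \<and> (\<forall>t\<in>{1..d}. (\<lambda>n. I n 0 t - (- (real d * real n ^ (d - 1) * (\<theta> t + 2) / (\<phi> * \<theta> t))))
            \<in> O(\<lambda>n. real n powr (real d - 2)))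
    \<and> (\<forall>s\<in>{1..d}. \<forall>t\<in>{1..d}. s \<noteq> t \<longrightarrow>
            (\<lambda>n. I n s t) \<in> O(\<lambda>n. real n powr (real d - 2)))"
proof -
  have \<theta>: "\<forall>t\<in>{1..d}. 0 < \<theta> t" using assms(3) by blast
  have X: "multivariate_normal (M n) (X n) (0\<^sub>v (n ^ d)) (Sigma_mat d n \<phi> \<theta>)" if "0 < n" for n
    using assms(4) that by simp
  note exists = fisher_info_log_likelihood(1)[OF _ X assms(2) \<theta>]
  define \<tau> where "\<tau> n t = (\<Sum>i<n. log_deriv_mat n (\<theta> t) $$ (i, i))" for n t
  define \<sigma> where "\<sigma> n t = (\<Sum>i<n. (log_deriv_mat n (\<theta> t) * log_deriv_mat n (\<theta> t)) $$ (i, i))" for n t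
  have \<tau>: "(\<lambda>n. \<tau> n t + 2 * (\<theta> t + 2) / \<theta> t) \<in> O(\<lambda>n. 1 / real n)"
    and \<sigma>: "(\<lambda>n. \<sigma> n t - 2 * (2 * \<theta> t + 5) / \<theta> t ^ 2) \<in> O(\<lambda>n. 1 / real n)" if "t \<in> {1..d}" for t
    unfolding \<tau>_def \<sigma>_def using trace_log_deriv_mat[OF assms(3)[OF that]] by simp_all
  \<comment> \<open>For \<open>d = 1\<close> the claimed order is \<open>1 / n\<close>, which a
    power with natural exponent \<open>d - 2\<close> would truncate to 1; hence the real
    exponent.\<close>
  have pow1: "real n ^ (d - 1) * (1 / real n) = real n powr (real d - 2)" if "0 < n" for n
  proof -
    have "real n powr (real d - 2) = real n powr (real (d - 1) - 1)"
      using assms(1) by (simp add: of_nat_diff)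
    then show ?thesis using that by (simp add: powr_diff powr_realpow)
  qed
  \<comment> \<open>Two distinct indices in \<open>{1..d}\<close> force \<open>2 \<le> d\<close>, so
    here the natural exponent agrees with the real one.\<close>
  have pow2: "real n ^ (d - 2) = real n powr (real d - 2)" if "0 < n" "2 \<le> d" for n
    using that by (simp add: powr_realpow[symmetric] of_nat_diff)
  have O1: "(\<lambda>n. real n ^ (d - 1) * f n) \<in> O(\<lambda>n. real n powr (real d - 2))" if "f \<in> O(\<lambda>n. 1 / real n)" for f :: "nat \<Rightarrow> real"
  proof -
    have "(\<lambda>n. real n ^ (d - 1) * f n) \<in> O(\<lambda>n. real n ^ (d - 1) * (1 / real n))"
      by (rule landau_o.big.mult_left[OF that])
    also have "(\<lambda>n. real n ^ (d - 1) * (1 / real n)) \<in> \<Theta>(\<lambda>n. real n powr (real d - 2))"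
      by (rule bigthetaI_cong, rule eventually_mono[OF eventually_gt_at_top[of 0] pow1])
    finally show ?thesis .
  qed
  have bounded: "(\<lambda>n. \<tau> n t) \<in> O(\<lambda>_. 1)" if "t \<in> {1..d}" for t
  proof -
    have "(\<lambda>n::nat. 1 / real n) \<in> O(\<lambda>_. 1)" by real_asymp
    then have "(\<lambda>n. \<tau> n t + 2 * (\<theta> t + 2) / \<theta> t) \<in> O(\<lambda>_. 1)"
      using \<tau>[OF that] landau_o.big_trans by blast
    then have "(\<lambda>n. (\<tau> n t + 2 * (\<theta> t + 2) / \<theta> t) - 2 * (\<theta> t + 2) / \<theta> t) \<in> O(\<lambda>_. 1)"
      by (rule sum_in_bigo) simp
    then show ?thesis by simp
  qed
  show ?thesis
  proof (intro conjI ballI allI impI)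
    fix n :: nat and i j assume "1 \<le> n" "i \<in> {0..d}" "j \<in> {0..d}"
    then show "fisher_info_exists (M n) (X n) (log_likelihood d n) (param \<phi> \<theta>) i j"
      by (intro exists) auto
  next
    fix n :: nat assume "1 \<le> n"
    then show "I n 0 0 = real d ^ 2 * real n ^ d / (2 * \<phi> ^ 2)"
      unfolding I_def by (intro fisher_info_values(1)[OF _ X assms(2) \<theta>]) auto
  next
    fix t assume t: "t \<in> {1..d}"
    have "I n t t - real n ^ (d - 1) * (2 * \<theta> t + 5) / \<theta> t ^ 2
        = 1 / 2 * (real n ^ (d - 1) * (\<sigma> n t - 2 * (2 * \<theta> t + 5) / \<theta> t ^ 2))" if "0 < n" for n
      unfolding I_def fisher_info_values(2)[OF that X[OF that] assms(2) \<theta> t] \<sigma>_def[symmetric]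
      by (simp add: algebra_simps)
    then have "\<forall>\<^sub>F n in sequentially. I n t t - real n ^ (d - 1) * (2 * \<theta> t + 5) / \<theta> t ^ 2
        = 1 / 2 * (real n ^ (d - 1) * (\<sigma> n t - 2 * (2 * \<theta> t + 5) / \<theta> t ^ 2))"
      by (rule eventually_mono[OF eventually_gt_at_top[of 0]])
    moreover have "(\<lambda>n. 1 / 2 * (real n ^ (d - 1) * (\<sigma> n t - 2 * (2 * \<theta> t + 5) / \<theta> t ^ 2))) \<in> O(\<lambda>n. real n powr (real d - 2))"
      using O1[OF \<sigma>[OF t]] by (subst landau_o.big.cmult_in_iff) auto
    ultimately show "(\<lambda>n. I n t t - real n ^ (d - 1) * (2 * \<theta> t + 5) / \<theta> t ^ 2) \<in> O(\<lambda>n. real n powr (real d - 2))"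
      by (rule landau_o.big.in_cong[THEN iffD2])
  next
    fix t assume t: "t \<in> {1..d}"
    have "I n 0 t - (- (real d * real n ^ (d - 1) * (\<theta> t + 2) / (\<phi> * \<theta> t)))
        = real d / (2 * \<phi>) * (real n ^ (d - 1) * (\<tau> n t + 2 * (\<theta> t + 2) / \<theta> t))" if "0 < n" for n
      unfolding I_def fisher_info_values(3)[OF that X[OF that] assms(2) \<theta> t] \<tau>_def[symmetric]
      using assms(2) assms(3)[OF t] by (simp add: field_simps)
    then have "\<forall>\<^sub>F n in sequentially. I n 0 t - (- (real d * real n ^ (d - 1) * (\<theta> t + 2) / (\<phi> * \<theta> t)))
        = real d / (2 * \<phi>) * (real n ^ (d - 1) * (\<tau> n t + 2 * (\<theta> t + 2) / \<theta> t))"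
      by (rule eventually_mono[OF eventually_gt_at_top[of 0]])
    moreover have "(\<lambda>n. real d / (2 * \<phi>) * (real n ^ (d - 1) * (\<tau> n t + 2 * (\<theta> t + 2) / \<theta> t))) \<in> O(\<lambda>n. real n powr (real d - 2))"
      using O1[OF \<tau>[OF t]] assms(1,2) by (subst landau_o.big.cmult_in_iff) auto
    ultimately show "(\<lambda>n. I n 0 t - (- (real d * real n ^ (d - 1) * (\<theta> t + 2) / (\<phi> * \<theta> t)))) \<in> O(\<lambda>n. real n powr (real d - 2))"
      by (rule landau_o.big.in_cong[THEN iffD2])
  next
    fix s t assume st: "s \<in> {1..d}" "t \<in> {1..d}" "s \<noteq> t"
    then have d: "2 \<le> d" by auto
    have "I n s t = real n powr (real d - 2) * (1 / 2 * (\<tau> n s * \<tau> n t))" if "0 < n" for n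
      unfolding I_def fisher_info_values(4)[OF that X[OF that] assms(2) \<theta> st] \<tau>_def[symmetric] pow2[OF that d]
      by simp
    then have "\<forall>\<^sub>F n in sequentially. I n s t = real n powr (real d - 2) * (1 / 2 * (\<tau> n s * \<tau> n t))"
      by (rule eventually_mono[OF eventually_gt_at_top[of 0]])
    moreover have "(\<lambda>n. real n powr (real d - 2) * (1 / 2 * (\<tau> n s * \<tau> n t))) \<in> O(\<lambda>n. real n powr (real d - 2) * (1 / 2 * (1 * 1)))"
      by (intro landau_o.big.mult landau_o.big_refl bounded st)
    then have "(\<lambda>n. real n powr (real d - 2) * (1 / 2 * (\<tau> n s * \<tau> n t))) \<in> O(\<lambda>n. real n powr (real d - 2))"
      by simp
    ultimately show "(\<lambda>n. I n s t) \<in> O(\<lambda>n. real n powr (real d - 2))"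
      by (rule landau_o.big.in_cong[THEN iffD2])
  qed
qed

end
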